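(* Let $E$ be a unital Banach algebra, $a<b$, and let $A:[a,b]\to E$ be a right regulated mapping such that $A(t_1)A(t_2)=A(t_2)A(t_1)$ for all $t_1,t_2\in[a,b]$. Given an arbitrary $\varepsilon>0$, let $\Lambda_\varepsilon\subset[a,b]$ be the well-ordered set associated with $A$ and $\varepsilon$ (defined in the context). Then the following properties are equivalent: 1. $A$ is strongly Kurzweil product integrable. 2. $A$ is strongly Henstock-Kurzweil integrable. 3. The step mapping $A_\varepsilon:[a,b]\to E$ given by $A_\varepsilon(t)=A(\beta+)$ for $t\in[\beta,S(\beta))$, $\beta\in\Lambda_\varepsilon^{<b}$, and $A_\varepsilon(b)=A(b)$, is strongly Henstock-Kurzweil integrable. 4. The family $((S(\beta)-\beta)A(\beta+))_{\beta\in\Lambda_\varepsilon^{<b}}$ is summable.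
   Context: A unital Banach algebra is a complete normed algebra with unit $I$, $\|I\|=1$. $A:[a,b]\to E$ is right regulated if the right limit $A(t+)$ exists in $E$ at every $t\in[a,b)$. For a well-ordered $\Lambda\subset\mathbb R\cup\{\infty\}$: $S(\beta)$ is the smallest element of $\Lambda$ greater than $\beta$; $\Lambda^{<\gamma}=\{\alpha\in\Lambda:\alpha<\gamma\}$; an element that is neither a successor $S(\beta)$ nor the minimum is a limit element. The set $\Lambda_\varepsilon$: define $G_\varepsilon:[a,b]\to[a,b]$ by $G_\varepsilon(x)=\sup\{y\in(x,b]:\|A(s)-A(t)\|\le\varepsilon\text{ for all }s,t\in(x,y)\}$ for $x\in[a,b)$ and $G_\varepsilon(b)=b$. $\Lambda_\varepsilon$ is the well-ordered subset of $[a,b]$ determined by: $a=\min\Lambda_\varepsilon$, and for $\gamma>a$, $\gamma\in\Lambda_\varepsilon$ if and only if $\gamma=\sup\{G_\varepsilon(x):x\in\Lambda_\varepsilon^{<\gamma}\}$. (Known: such $\Lambda_\varepsilon$ exists, has maximum $b$, $[a,b)$ is the disjoint union of the intervals $[\beta,S(\beta))$, $\beta\in\Lambda_\varepsilon^{<b}$, and $\|A(s)-A(t)\|\le\varepsilon$ whenever $s,t\in(\beta,S(\beta))$, $\beta\in\Lambda_\varepsilon^{<b}$.) Summability: let $\Lambda'$ be a nonempty well-ordered subset of $\mathbb R\cup\{\infty\}$, $a'=\min\Lambda'$, $b'=\sup\Lambda'$. A family $(x_\alpha)_{\alpha\in\Lambda'}$ in $E$ is summable if for every $\gamma\in\Lambda'\cup\{b'\}$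 there is $\Sigma_{\alpha\in\Lambda'^{<\gamma}}x_\alpha\in E$ such that: (i) $\Sigma_{\alpha\in\Lambda'^{<a'}}x_\alpha=0$, and if $\gamma=S(\beta)$, $\beta\in\Lambda'$, then $\Sigma_{\alpha\in\Lambda'^{<\gamma}}x_\alpha=x_\beta+\Sigma_{\alpha\in\Lambda'^{<\beta}}x_\alpha$; (ii) if $\gamma$ is a limit element (of $\Lambda'\cup\{b'\}$), then for each $\eta>0$ there is $\beta_\eta\in\Lambda'^{<\gamma}$ with $\|\Sigma_{\alpha\in\Lambda'^{<\beta}}x_\alpha-\Sigma_{\alpha\in\Lambda'^{<\gamma}}x_\alpha\|<\eta$ for all $\beta\in\Lambda'\cap[\beta_\eta,\gamma)$. Here $\Lambda'=\Lambda_\varepsilon^{<b}$. Tagged partition of $[a,b]$: $(\xi_i,[t_{i-1},t_i])_{i=1}^m$ with $a=t_0<\dots<t_m=b$, $\xi_i\in[t_{i-1},t_i]$; for a gauge $\delta:[a,b]\to\mathbb R^+$ it is $\delta$-fine if $[t_{i-1},t_i]\subset(\xi_i-\delta(\xi_i),\xi_i+\delta(\xi_i))$ for all $i$. $B:[a,b]\to E$ is strongly Kurzweil product integrable if there is $W:[a,b]\to E$ with $W(t)$ invertible for all $t$, $W$ and $W^{-1}$ bounded, such that for every $\eta>0$ there is a gauge $\delta$ with $\sum_{i=1}^m\|I+B(\xi_i)(t_i-t_{i-1})-W(t_i)W(t_{i-1})^{-1}\|<\eta$ for every $\delta$-fine tagged partition of $[a,b]$. $B$ is strongly Henstock-Kurzweil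 integrable if there is $F:[a,b]\to E$ such that for every $\eta>0$ there is a gauge $\delta$ with $\sum_{i=1}^m\|B(\xi_i)(t_i-t_{i-1})-(F(t_i)-F(t_{i-1}))\|<\eta$ for every $\delta$-fine tagged partition of $[a,b]$. *)

theory Defs
  imports "HOL-Analysis.Analysis"
begin

section \<open>Well-ordered subsets of a linear order\<close>

definition well_ordered :: "'i::linorder set \<Rightarrow> bool"
  where "well_ordered \<Lambda> \<longleftrightarrow> well_order_on \<Lambda> {(x, y). x \<in> \<Lambda> \<and> y \<in> \<Lambda> \<and> x \<le> y}"

definition below :: "'i::linorder set \<Rightarrow> 'i \<Rightarrow> 'i set"
  where "below \<Lambda> \<gamma> = {\<alpha> \<in> \<Lambda>. \<alpha> < \<gamma>}"

definition is_succ :: "'i::linorder set \<Rightarrow> 'i \<Rightarrow> 'i \<Rightarrow> bool"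
  where "is_succ \<Lambda> \<beta> \<gamma> \<longleftrightarrow> \<gamma> \<in> \<Lambda> \<and> \<beta> < \<gamma> \<and> (\<forall>\<delta>\<in>\<Lambda>. \<beta> < \<delta> \<longrightarrow> \<gamma> \<le> \<delta>)"

definition Succ :: "'i::linorder set \<Rightarrow> 'i \<Rightarrow> 'i"
  where "Succ \<Lambda> \<beta> = (THE \<gamma>. is_succ \<Lambda> \<beta> \<gamma>)"

definition is_min :: "'i::linorder set \<Rightarrow> 'i \<Rightarrow> bool"
  where "is_min \<Lambda> \<alpha> \<longleftrightarrow> \<alpha> \<in> \<Lambda> \<and> (\<forall>\<delta>\<in>\<Lambda>. \<alpha> \<le> \<delta>)"

definition limit_element :: "'i::linorder set \<Rightarrow> 'i \<Rightarrow> bool"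
  where "limit_element \<Lambda> \<gamma> \<longleftrightarrow>
    \<gamma> \<in> \<Lambda> \<and> \<not> is_min \<Lambda> \<gamma> \<and> \<not> (\<exists>\<beta>\<in>\<Lambda>. is_succ \<Lambda> \<beta> \<gamma>)"

text \<open>
  Summability of a family indexed by a nonempty well-ordered set. The value \<open>\<sigma> \<gamma>\<close> is the
  sum of \<open>x \<alpha>\<close> over all \<open>\<alpha> \<in> \<Lambda>\<close> with \<open>\<alpha> < \<gamma>\<close>, and \<open>\<gamma>\<close> ranges over \<open>\<Lambda>\<close> together with its
  supremum. The index type may be \<^typ>\<open>ereal\<close> (subsets of the line with infinity added) or
  \<^typ>\<open>real\<close>; over \<^typ>\<open>real\<close> the set has to be bounded above for \<open>Sup \<Lambda>\<close> to be meaningful.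
\<close>

definition wo_summable ::
    "'i::conditionally_complete_linorder set \<Rightarrow> ('i \<Rightarrow> 'e::real_normed_vector) \<Rightarrow> bool"
  where "wo_summable \<Lambda> x \<longleftrightarrow> (\<exists>\<sigma>.
    (\<forall>\<gamma>. is_min \<Lambda> \<gamma> \<longrightarrow> \<sigma> \<gamma> = 0) \<and>
    (\<forall>\<beta>\<in>\<Lambda>. \<forall>\<gamma>. is_succ (insert (Sup \<Lambda>) \<Lambda>) \<beta> \<gamma> \<longrightarrow> \<sigma> \<gamma> = x \<beta> + \<sigma> \<beta>) \<and>
    (\<forall>\<gamma>. limit_element (insert (Sup \<Lambda>) \<Lambda>) \<gamma> \<longrightarrow>
      (\<forall>\<eta>>0. \<exists>\<beta>0\<in>below \<Lambda> \<gamma>. \<forall>\<beta>\<in>\<Lambda> \<inter> {\<beta>0..<\<gamma>}. norm (\<sigma> \<beta> - \<sigma> \<gamma>) < \<eta>)))"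

section \<open>Right regulated mappings and the associated well-ordered set\<close>

text \<open>
  A mapping from \<open>[a, b]\<close> to \<open>E\<close> is a total function on \<^typ>\<open>real\<close> of which only the values
  on \<open>{a..b}\<close> matter. The right limit of \<open>A\<close> at \<open>t\<close> is \<open>Lim (at_right t) A\<close>.
\<close>

definition right_regulated :: "real \<Rightarrow> real \<Rightarrow> (real \<Rightarrow> 'e::real_normed_vector) \<Rightarrow> bool"
  where "right_regulated a b A \<longleftrightarrow> (\<forall>t\<in>{a..<b}. \<exists>l. (A \<longlongrightarrow> l) (at_right t))"

definition G_eps :: "real \<Rightarrow> (real \<Rightarrow> 'e::real_normed_vector) \<Rightarrow> real \<Rightarrow> real \<Rightarrow> real"
  where "G_eps b A \<epsilon> x =
    (if x < b
     then Sup {y \<in> {x<..b}. \<forall>s\<in>{x<..<y}. \<forall>t\<in>{x<..<y}. norm (A s - A t) \<le> \<epsilon>}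
     else b)"

definition is_Lambda ::
    "real \<Rightarrow> real \<Rightarrow> (real \<Rightarrow> 'e::real_normed_vector) \<Rightarrow> real \<Rightarrow> real set \<Rightarrow> bool"
  where "is_Lambda a b A \<epsilon> \<Lambda> \<longleftrightarrow>
    \<Lambda> \<subseteq> {a..b} \<and> well_ordered \<Lambda> \<and> is_min \<Lambda> a \<and>
    (\<forall>\<gamma>>a. \<gamma> \<in> \<Lambda> \<longleftrightarrow> \<gamma> = Sup (G_eps b A \<epsilon> ` below \<Lambda> \<gamma>))"

text \<open>The description is justified by the lemma \<open>is_Lambda_ex1\<close> below.\<close>

definition Lambda_eps ::
    "real \<Rightarrow> real \<Rightarrow> (real \<Rightarrow> 'e::real_normed_vector) \<Rightarrow> real \<Rightarrow> real set"
  where "Lambda_eps a b A \<epsilon> = (THE \<Lambda>. is_Lambda a b A \<epsilon> \<Lambda>)"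

definition A_eps ::
    "real \<Rightarrow> real \<Rightarrow> (real \<Rightarrow> 'e::real_normed_vector) \<Rightarrow> real \<Rightarrow> real \<Rightarrow> 'e"
  where "A_eps a b A \<epsilon> t =
    (if t = b then A b
     else Lim (at_right (THE \<beta>. \<beta> \<in> below (Lambda_eps a b A \<epsilon>) b \<and>
                                t \<in> {\<beta>..<Succ (Lambda_eps a b A \<epsilon>) \<beta>})) A)"

section \<open>Strong integrals\<close>

text \<open>The tag \<open>\<xi> i\<close> belongs to the interval \<open>[t i, t (i + 1)]\<close>, for \<open>i < m\<close>.\<close>

definition tagged_partition ::
    "real \<Rightarrow> real \<Rightarrow> nat \<Rightarrow> (nat \<Rightarrow> real) \<Rightarrow> (nat \<Rightarrow> real) \<Rightarrow> bool"
  where "tagged_partition a b m \<xi> t \<longleftrightarrow>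
    t 0 = a \<and> t m = b \<and> (\<forall>i<m. t i < t (Suc i) \<and> \<xi> i \<in> {t i..t (Suc i)})"

definition pos_gauge :: "real \<Rightarrow> real \<Rightarrow> (real \<Rightarrow> real) \<Rightarrow> bool"
  where "pos_gauge a b \<delta> \<longleftrightarrow> (\<forall>x\<in>{a..b}. \<delta> x > 0)"

definition delta_fine ::
    "(real \<Rightarrow> real) \<Rightarrow> nat \<Rightarrow> (nat \<Rightarrow> real) \<Rightarrow> (nat \<Rightarrow> real) \<Rightarrow> bool"
  where "delta_fine \<delta> m \<xi> t \<longleftrightarrow>
    (\<forall>i<m. {t i..t (Suc i)} \<subseteq> {\<xi> i - \<delta> (\<xi> i)<..<\<xi> i + \<delta> (\<xi> i)})"

definition is_inverse :: "'e::ring_1 \<Rightarrow> 'e \<Rightarrow> bool"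
  where "is_inverse x y \<longleftrightarrow> x * y = 1 \<and> y * x = 1"

definition invertible_elem :: "'e::ring_1 \<Rightarrow> bool"
  where "invertible_elem x \<longleftrightarrow> (\<exists>y. is_inverse x y)"

definition inv_elem :: "'e::ring_1 \<Rightarrow> 'e"
  where "inv_elem x = (THE y. is_inverse x y)"

definition strongly_Kurzweil_product_integrable ::
    "real \<Rightarrow> real \<Rightarrow> (real \<Rightarrow> 'e::{real_normed_algebra_1, banach}) \<Rightarrow> bool"
  where "strongly_Kurzweil_product_integrable a b B \<longleftrightarrow> (\<exists>W.
    (\<forall>t\<in>{a..b}. invertible_elem (W t)) \<and>
    bounded (W ` {a..b}) \<and> bounded ((\<lambda>t. inv_elem (W t)) ` {a..b}) \<and>
    (\<forall>\<eta>>0. \<exists>\<delta>. pos_gauge a b \<delta> \<and>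
      (\<forall>m \<xi> t. tagged_partition a b m \<xi> t \<and> delta_fine \<delta> m \<xi> t \<longrightarrow>
        (\<Sum>i<m. norm (1 + (t (Suc i) - t i) *\<^sub>R B (\<xi> i)
                      - W (t (Suc i)) * inv_elem (W (t i)))) < \<eta>)))"

definition strongly_HK_integrable ::
    "real \<Rightarrow> real \<Rightarrow> (real \<Rightarrow> 'e::banach) \<Rightarrow> bool"
  where "strongly_HK_integrable a b B \<longleftrightarrow> (\<exists>F.
    \<forall>\<eta>>0. \<exists>\<delta>. pos_gauge a b \<delta> \<and>
      (\<forall>m \<xi> t. tagged_partition a b m \<xi> t \<and> delta_fine \<delta> m \<xi> t \<longrightarrow>
        (\<Sum>i<m. norm ((t (Suc i) - t i) *\<^sub>R B (\<xi> i)
                      - (F (t (Suc i)) - F (t i)))) < \<eta>))"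

section \<open>The definitions by description are meaningful\<close>

lemma is_succ_unique: "is_succ \<Lambda> \<beta> \<gamma> \<Longrightarrow> is_succ \<Lambda> \<beta> \<gamma>' \<Longrightarrow> \<gamma> = \<gamma>'"
  unfolding is_succ_def by (meson order_antisym)

lemma Succ_eq: "is_succ \<Lambda> \<beta> \<gamma> \<Longrightarrow> Succ \<Lambda> \<beta> = \<gamma>"
  unfolding Succ_def by (rule the_equality) (auto intro: is_succ_unique)

lemma is_inverse_unique: "is_inverse x y \<Longrightarrow> is_inverse x z \<Longrightarrow> y = z"
  unfolding is_inverse_def by (metis mult.assoc mult.left_neutral mult.right_neutral)

lemma inv_elem_eq: "is_inverse x y \<Longrightarrow> inv_elem x = y"
  unfolding inv_elem_def by (rule the_equality) (auto intro: is_inverse_unique)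

lemma well_ordered_iff:
  "well_ordered \<Lambda> \<longleftrightarrow> (\<forall>T\<subseteq>\<Lambda>. T \<noteq> {} \<longrightarrow> (\<exists>m. is_min T m))"
proof -
  let ?r = "{(x, y). x \<in> \<Lambda> \<and> y \<in> \<Lambda> \<and> x \<le> y}"
  have lin: "linear_order_on \<Lambda> ?r"
    unfolding linear_order_on_def partial_order_on_def preorder_on_def
      refl_on_def trans_def antisym_def total_on_def by auto
  have "wf (?r - Id) \<longleftrightarrow> (\<forall>T\<subseteq>\<Lambda>. T \<noteq> {} \<longrightarrow> (\<exists>m. is_min T m))" (is "_ \<longleftrightarrow> ?R")
  proof
    assume wf: "wf (?r - Id)"
    show ?R
    proof (intro allI impI)
      fix T assume T: "T \<subseteq> \<Lambda>" "T \<noteq> {}"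
      then obtain t where t: "t \<in> T" by blast
      obtain z where z: "z \<in> T" "\<And>y. (y, z) \<in> ?r - Id \<Longrightarrow> y \<notin> T"
        using wf t unfolding wf_eq_minimal by meson
      have "is_min T z"
        unfolding is_min_def
      proof (intro conjI ballI)
        fix y assume y: "y \<in> T"
        show "z \<le> y"
        proof (rule ccontr)
          assume "\<not> z \<le> y"
          then have "(y, z) \<in> ?r - Id" using y z(1) T by auto
          then show False using z(2) y by blast
        qed
      qed (rule z(1))
      then show "\<exists>m. is_min T m" ..
    qed
  next
    assume R: ?R
    show "wf (?r - Id)"
    proof (rule wfI_min)
      fix x Q assume x: "(x::'a) \<in> Q"
      show "\<exists>z\<in>Q. \<forall>y. (y, z) \<in> ?r - Id \<longrightarrow> y \<notin> Q"
      proof (cases "Q \<inter> \<Lambda> = {}")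
        case True
        then show ?thesis using x by auto
      next
        case False
        then obtain m where "is_min (Q \<inter> \<Lambda>) m" using R by (metis inf_le2)
        then show ?thesis unfolding is_min_def by (intro bexI[of _ m]) (auto dest: order_antisym)
      qed
    qed
  qed
  then show ?thesis
    unfolding well_ordered_def well_order_on_def using lin by simp
qed

lemma G_eps_properties:
  assumes rr: "right_regulated a b A" and eps: "\<epsilon> > 0" and x: "x \<in> {a..b}"
  shows "G_eps b A \<epsilon> x \<in> {x..b}" and "x < b \<Longrightarrow> x < G_eps b A \<epsilon> x"
    and "\<And>z. x \<le> z \<Longrightarrow> z \<le> b \<Longrightarrow> G_eps b A \<epsilon> x \<le> G_eps b A \<epsilon> z"
proof -
  define Y where "Y x = {y \<in> {x<..b}. \<forall>s\<in>{x<..<y}. \<forall>t\<in>{x<..<y}. norm (A s - A t) \<le> \<epsilon>}" for x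
  have G: "G_eps b A \<epsilon> x = (if x < b then Sup (Y x) else b)" for x
    by (simp add: G_eps_def Y_def)
  have bdd: "bdd_above (Y x)" for x
    by (rule bdd_aboveI[of _ b]) (auto simp: Y_def)
  have ne: "Y x \<noteq> {}" if "a \<le> x" "x < b" for x
  proof -
    obtain l where "(A \<longlongrightarrow> l) (at_right x)"
      using rr \<open>a \<le> x\<close> \<open>x < b\<close> unfolding right_regulated_def by force
    then have "eventually (\<lambda>s. dist (A s) l < \<epsilon> / 2) (at_right x)"
      using eps by (intro tendstoD) auto
    then obtain c where c: "c > x" "\<And>s. x < s \<Longrightarrow> s < c \<Longrightarrow> dist (A s) l < \<epsilon> / 2"
      unfolding eventually_at_right_field by auto
    have "min b c \<in> Y x"
      unfolding Y_def
    proof (intro CollectI conjI ballI)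
      fix s t assume "s \<in> {x<..<min b c}" "t \<in> {x<..<min b c}"
      then have "dist (A s) l < \<epsilon> / 2" "dist (A t) l < \<epsilon> / 2" using c(2) by auto
      then have "dist (A s) (A t) < \<epsilon>" by (rule dist_triangle_half_l)
      then show "norm (A s - A t) \<le> \<epsilon>" by (simp add: dist_norm)
    qed (use that c(1) in auto)
    then show ?thesis by blast
  qed
  have gt: "x < G_eps b A \<epsilon> x" if "a \<le> x" "x < b" for x
  proof -
    obtain y where "y \<in> Y x" using ne \<open>a \<le> x\<close> \<open>x < b\<close> by blast
    then have "x < y" "y \<le> Sup (Y x)" using cSup_upper[OF _ bdd] by (auto simp: Y_def)
    then show ?thesis using that by (simp add: G)
  qed
  have le: "G_eps b A \<epsilon> x \<le> b" if "a \<le> x" for x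
    using cSup_least[OF ne[OF that], of b] by (auto simp: G Y_def)
  show "x < b \<Longrightarrow> x < G_eps b A \<epsilon> x" using gt x by auto
  show "G_eps b A \<epsilon> x \<in> {x..b}"
    using gt[of x] le[of x] x by (cases "x < b") (auto simp: G)
  show "G_eps b A \<epsilon> x \<le> G_eps b A \<epsilon> z" if z: "x \<le> z" "z \<le> b" for z
  proof (cases "z < b")
    case False
    then show ?thesis using le[of x] x by (simp add: G)
  next
    case True
    have "y \<le> G_eps b A \<epsilon> z" if y: "y \<in> Y x" for y
    proof (cases "y \<le> z")
      case True
      then show ?thesis using gt[of z] x z \<open>z < b\<close> by auto
    next
      case False
      then have "y \<in> Y z" using y z unfolding Y_def by auto
      then show ?thesis using cSup_upper[OF _ bdd] \<open>z < b\<close> by (simp add: G)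
    qed
    then have "Sup (Y x) \<le> G_eps b A \<epsilon> z"
      using ne[of x] x z True by (intro cSup_least) auto
    then show ?thesis using z True by (simp add: G)
  qed
qed

lemma is_Lambda_unique:
  assumes L: "is_Lambda a b A \<epsilon> \<Lambda>" and L': "is_Lambda a b A \<epsilon> \<Lambda>'"
  shows "\<Lambda> = \<Lambda>'"
proof (rule ccontr)
  assume ne: "\<Lambda> \<noteq> \<Lambda>'"
  define D where "D = (\<Lambda> - \<Lambda>') \<union> (\<Lambda>' - \<Lambda>)"
  have wo: "well_ordered \<Lambda>" "well_ordered \<Lambda>'" using L L' by (auto simp: is_Lambda_def)
  obtain m where m: "is_min D m"
  proof (cases "\<Lambda> - \<Lambda>' = {} \<or> \<Lambda>' - \<Lambda> = {}")
    case True
    then show ?thesis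
    proof (elim disjE)
      assume "\<Lambda> - \<Lambda>' = {}"
      then have "D \<subseteq> \<Lambda>'" "D \<noteq> {}" using ne unfolding D_def by auto
      then show ?thesis using wo(2) that unfolding well_ordered_iff by blast
    next
      assume "\<Lambda>' - \<Lambda> = {}"
      then have "D \<subseteq> \<Lambda>" "D \<noteq> {}" using ne unfolding D_def by auto
      then show ?thesis using wo(1) that unfolding well_ordered_iff by blast
    qed
  next
    case False
    have "\<exists>p. is_min (\<Lambda> - \<Lambda>') p" "\<exists>q. is_min (\<Lambda>' - \<Lambda>) q"
      using wo False unfolding well_ordered_iff by (simp_all add: Diff_subset)
    then obtain p q where "is_min (\<Lambda> - \<Lambda>') p" "is_min (\<Lambda>' - \<Lambda>) q" by blast
    then have "is_min D (min p q)"
      unfolding is_min_def D_def by (auto simp: min_def intro: order_trans)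
    then show ?thesis by (rule that)
  qed
  have "x \<in> \<Lambda> \<longleftrightarrow> x \<in> \<Lambda>'" if "x < m" for x
    using m that leD[of m x] unfolding is_min_def D_def by blast
  then have eq: "below \<Lambda> m = below \<Lambda>' m" unfolding below_def by auto
  have mD: "m \<in> D" using m by (simp add: is_min_def)
  have "a \<in> \<Lambda>" "a \<in> \<Lambda>'" "\<Lambda> \<subseteq> {a..b}" "\<Lambda>' \<subseteq> {a..b}"
    using L L' by (auto simp: is_Lambda_def is_min_def)
  then have "m > a" using mD unfolding D_def by (auto simp: less_le)
  then have "m \<in> \<Lambda> \<longleftrightarrow> m \<in> \<Lambda>'"
    using L L' eq unfolding is_Lambda_def by auto
  then show False using mD by (auto simp: D_def)
qed

lemma is_Lambda_exists:
  assumes ab: "a < b" and rr: "right_regulated a b A" and eps: "\<epsilon> > 0"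
  shows "\<exists>\<Lambda>. is_Lambda a b A \<epsilon> \<Lambda>"
proof -
  let ?G = "G_eps b A \<epsilon>"
  note Gp = G_eps_properties[OF rr eps]
  define closed_set where "closed_set X \<longleftrightarrow>
    a \<in> X \<and> (\<forall>x\<in>X. ?G x \<in> X) \<and> (\<forall>Y. Y \<subseteq> X \<and> Y \<noteq> {} \<longrightarrow> Sup Y \<in> X)" for X
  define M where "M = \<Inter>{X. X \<subseteq> {a..b} \<and> closed_set X}"
  have Sup_ab: "Sup Y \<in> {a..b}" if "Y \<subseteq> {a..b}" "Y \<noteq> {}" for Y :: "real set"
  proof -
    obtain y where "y \<in> Y" using \<open>Y \<noteq> {}\<close> by blast
    moreover have "bdd_above Y" using that by (meson bdd_above_Icc bdd_above_mono)
    ultimately have "y \<le> Sup Y" "a \<le> y" using cSup_upper that by auto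
    moreover have "Sup Y \<le> b" using that by (intro cSup_least) auto
    ultimately show ?thesis by auto
  qed
  have cl_ab: "closed_set {a..b}"
    unfolding closed_set_def
  proof (intro conjI ballI allI impI)
    show "a \<in> {a..b}" using ab by simp
    show "?G x \<in> {a..b}" if "x \<in> {a..b}" for x using Gp(1)[OF that] that by auto
    show "Sup Y \<in> {a..b}" if "Y \<subseteq> {a..b} \<and> Y \<noteq> {}" for Y using Sup_ab that by blast
  qed
  have Mleast: "M \<subseteq> X" if "X \<subseteq> {a..b}" "closed_set X" for X
    using that unfolding M_def by blast
  have Mab: "M \<subseteq> {a..b}" using Mleast[OF subset_refl cl_ab] .
  have clM: "closed_set M"
    unfolding closed_set_def
  proof (intro conjI ballI allI impI)
    show "a \<in> M" unfolding M_def closed_set_def by blast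
    show "?G x \<in> M" if "x \<in> M" for x using that unfolding M_def closed_set_def by blast
    show "Sup Y \<in> M" if Y: "Y \<subseteq> M \<and> Y \<noteq> {}" for Y
      unfolding M_def
    proof (intro InterI)
      fix X assume "X \<in> {X. X \<subseteq> {a..b} \<and> closed_set X}"
      moreover from this have "Y \<subseteq> X" using Y unfolding M_def by blast
      ultimately show "Sup Y \<in> X" using Y unfolding closed_set_def by blast
    qed
  qed
  then have aM: "a \<in> M" and GM: "\<And>x. x \<in> M \<Longrightarrow> ?G x \<in> M"
    and SM: "\<And>Y. Y \<subseteq> M \<Longrightarrow> Y \<noteq> {} \<Longrightarrow> Sup Y \<in> M"
    unfolding closed_set_def by auto
  have bdd: "bdd_above Y" if "Y \<subseteq> M" for Y
    using that Mab by (meson bdd_above_Icc bdd_above_mono order_trans)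
  have ind: "\<forall>x\<in>M. P x"
    if "P a" "\<And>x. x \<in> M \<Longrightarrow> P x \<Longrightarrow> P (?G x)"
       "\<And>Y. Y \<subseteq> M \<Longrightarrow> Y \<noteq> {} \<Longrightarrow> \<forall>y\<in>Y. P y \<Longrightarrow> P (Sup Y)" for P
  proof -
    have "closed_set {x \<in> M. P x}"
      unfolding closed_set_def
    proof (intro conjI ballI allI impI)
      fix Y assume "Y \<subseteq> {x \<in> M. P x} \<and> Y \<noteq> {}"
      then have "Y \<subseteq> M" "Y \<noteq> {}" "\<forall>y\<in>Y. P y" by auto
      then show "Sup Y \<in> {x \<in> M. P x}" using SM that(3) by blast
    qed (use aM GM that(1,2) in auto)
    moreover have "{x \<in> M. P x} \<subseteq> {a..b}" using Mab by blast
    ultimately have "M \<subseteq> {x \<in> M. P x}" by (intro Mleast)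
    then show ?thesis by blast
  qed
  have Mb: "a \<le> x" "x \<le> b" if "x \<in> M" for x using that Mab by auto
  have Gge: "x \<le> ?G x" "?G x \<le> b" if "x \<in> M" for x using Gp(1)[of x] Mb[OF that] by auto
  have Gmono: "?G x \<le> ?G y" if "x \<in> M" "y \<in> M" "x \<le> y" for x y
    using Gp(3)[of x y] Mb[OF that(1)] Mb[OF that(2)] that(3) by simp
  have Ggt: "x < ?G x" if "x \<in> M" "x < b" for x using Gp(2)[of x] Mb[OF that(1)] that(2) by simp
  have gap: "\<forall>x\<in>M. x \<le> y \<or> ?G y \<le> x" if y: "y \<in> M" "\<forall>x\<in>M. x < y \<longrightarrow> ?G x \<le> y" for y
  proof (rule ind)
    show "a \<le> y \<or> ?G y \<le> a" using Mb(1)[OF y(1)] by simp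
    show "?G x \<le> y \<or> ?G y \<le> ?G x" if x: "x \<in> M" "x \<le> y \<or> ?G y \<le> x" for x
    proof -
      consider "x = y" | "x < y" | "?G y \<le> x" using x(2) by linarith
      then show ?thesis
      proof cases
        case 2
        then show ?thesis using y(2) x(1) by blast
      qed (use Gge(1)[OF x(1)] in auto)
    qed
    show "Sup Y \<le> y \<or> ?G y \<le> Sup Y"
      if Y: "Y \<subseteq> M" "Y \<noteq> {}" "\<forall>x\<in>Y. x \<le> y \<or> ?G y \<le> x" for Y
    proof (cases "\<forall>x\<in>Y. x \<le> y")
      case True
      then show ?thesis using Y by (simp add: cSup_least)
    next
      case False
      then obtain x where "x \<in> Y" "?G y \<le> x" using Y by blast
      then show ?thesis using cSup_upper[OF _ bdd[OF Y(1)], of x] by linarith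
    qed
  qed
  have "\<forall>y\<in>M. \<forall>x\<in>M. x < y \<longrightarrow> ?G x \<le> y"
  proof (rule ind)
    show "\<forall>x\<in>M. x < a \<longrightarrow> ?G x \<le> a" using Mb(1) by (meson leD)
    show "\<forall>x\<in>M. x < ?G y \<longrightarrow> ?G x \<le> ?G y"
      if "y \<in> M" "\<forall>x\<in>M. x < y \<longrightarrow> ?G x \<le> y" for y
      using gap[OF that] Gmono[OF _ that(1)] by (meson not_le)
    show "\<forall>x\<in>M. x < Sup Y \<longrightarrow> ?G x \<le> Sup Y"
      if Y: "Y \<subseteq> M" "Y \<noteq> {}" "\<forall>y\<in>Y. \<forall>x\<in>M. x < y \<longrightarrow> ?G x \<le> y" for Y
    proof (intro ballI impI)
      fix x assume x: "x \<in> M" "x < Sup Y"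
      then obtain y where y: "y \<in> Y" "x < y" using less_cSupE[OF _ Y(2)] by blast
      then have "?G x \<le> y" using Y x by blast
      also have "y \<le> Sup Y" using y bdd[OF Y(1)] by (intro cSup_upper) auto
      finally show "?G x \<le> Sup Y" .
    qed
  qed
  then have next_le: "?G x \<le> y" if "x \<in> M" "y \<in> M" "x < y" for x y using that by blast
  have "is_Lambda a b A \<epsilon> M"
    unfolding is_Lambda_def
  proof (intro conjI allI impI)
    show "M \<subseteq> {a..b}" by (rule Mab)
    show "is_min M a" unfolding is_min_def using aM Mab by auto
    show "well_ordered M"
      unfolding well_ordered_iff
    proof (intro allI impI)
      fix T assume T: "T \<subseteq> M" "T \<noteq> {}"
      define L where "L = {z \<in> M. \<forall>t\<in>T. z \<le> t}"
      have "a \<in> L" unfolding L_def using aM T(1) Mb(1) by blast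
      then have L: "L \<subseteq> M" "L \<noteq> {}" by (auto simp: L_def)
      have s: "Sup L \<in> M" by (rule SM[OF L])
      have le: "Sup L \<le> t" if "t \<in> T" for t
        using that L(2) by (intro cSup_least) (auto simp: L_def)
      have "Sup L \<in> T"
      proof (rule ccontr)
        assume nT: "Sup L \<notin> T"
        then have lt: "Sup L < t" if "t \<in> T" for t 
          using le[OF that] nT that by (cases "t = Sup L") auto
        have "?G (Sup L) \<le> t" if "t \<in> T" for t
          using next_le[OF s _ lt[OF that]] that T(1) by blast
        then have "?G (Sup L) \<in> L" using GM[OF s] unfolding L_def by blast
        then have "?G (Sup L) \<le> Sup L" using bdd[OF L(1)] by (intro cSup_upper)
        moreover obtain t where "t \<in> T" using T(2) by blast
        then have "Sup L < b" using lt[of t] Mb(2)[of t] T(1) by force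
        ultimately show False using Ggt[OF s] by simp
      qed
      then show "\<exists>m. is_min T m" using le unfolding is_min_def by blast
    qed
    fix \<gamma> assume \<gamma>: "a < \<gamma>"
    let ?Y = "?G ` below M \<gamma>"
    have "a \<in> below M \<gamma>" using aM \<gamma> by (simp add: below_def)
    then have Y: "?Y \<subseteq> M" "?Y \<noteq> {}" using GM unfolding below_def by blast+
    show "\<gamma> \<in> M \<longleftrightarrow> \<gamma> = Sup ?Y"
    proof
      assume gM: "\<gamma> \<in> M"
      have le: "Sup ?Y \<le> \<gamma>"
      proof (rule cSup_least[OF Y(2)])
        fix y assume "y \<in> ?Y"
        then obtain x where "y = ?G x" "x \<in> M" "x < \<gamma>" unfolding below_def by blast
        then show "y \<le> \<gamma>" using next_le[OF _ gM] by simp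
      qed
      show "\<gamma> = Sup ?Y"
      proof (rule ccontr)
        assume "\<gamma> \<noteq> Sup ?Y"
        with le have lt: "Sup ?Y < \<gamma>" by simp
        have s: "Sup ?Y \<in> M" by (rule SM[OF Y])
        then have "Sup ?Y \<in> below M \<gamma>" using lt by (simp add: below_def)
        then have "?G (Sup ?Y) \<in> ?Y" by (rule imageI)
        then have "?G (Sup ?Y) \<le> Sup ?Y" using bdd[OF Y(1)] by (intro cSup_upper)
        moreover have "Sup ?Y < b" using lt Mb(2)[OF gM] by simp
        ultimately show False using Ggt[OF s] by simp
      qed
    next
      assume "\<gamma> = Sup ?Y"
      then show "\<gamma> \<in> M" using SM[OF Y] by simp
    qed
  qed
  then show ?thesis ..
qed

lemma is_Lambda_ex1:
  assumes "a < b" "right_regulated a b A" "\<epsilon> > 0"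
  shows "\<exists>!\<Lambda>. is_Lambda a b A \<epsilon> \<Lambda>"
  using is_Lambda_exists[OF assms] is_Lambda_unique by blast

lemma is_Lambda_Lambda_eps:
  assumes "a < b" "right_regulated a b A" "\<epsilon> > 0"
  shows "is_Lambda a b A \<epsilon> (Lambda_eps a b A \<epsilon>)"
  unfolding Lambda_eps_def by (rule theI'[OF is_Lambda_ex1[OF assms]])

end

(*
Each of the four properties says that some F has a prescribed right derivative everywhere. A right
regulated A is strongly Henstock-Kurzweil integrable iff there is a continuous F with right
derivative A(x+) at every x in [a,b): the mean value inequality for right derivatives shows that F
approximates A with error eta * (t - s) off the countable set Lambda_eta, and continuity of F deals
with Lambda_eta. A bounded right regulated map has such an F, as a uniform limit of primitives of
step maps; since A - A_eps has bounded right limits, A and A_eps have primitives simultaneously.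
A primitive of the step map A_eps is affine on each [beta, S(beta)], so its values on Lambda_eps
are exactly the transfinite sums.

For the product integral, a primitive F of A gives W = exp F by commutativity. Conversely, W has
right derivative A(x+) W(x), and commutes with A because W^-1 c W is constant for every c commuting
with A. On short intervals [s,t] the series of log (W W(s)^-1) is then a primitive of A, and these
local primitives are glued together.
*)
theory Submission
  imports Defs
begin

text \<open>A right regulated mapping may blow up when a point is approached from the left, so in
  general \<open>A\<close> has no bound and the transfinite sums converge only conditionally. What
  survives is uniqueness: a continuous function whose right derivative vanishes everywhere on [a, b)
  is constant. The commutation relations of F and of W come from applying this to a commutator or a
  conjugate.

  The set \<Lambda>_\<eta> is the right exceptional set because a point \<xi> outside it lies inside
  an open interval on which \<open>A\<close> oscillates by at most \<eta>; so A(\<xi>) itself, and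
  not only A(\<xi>+), is close to all right limits nearby. At points of the set the value A(\<xi>)
  is arbitrary.

  The logarithm has to be local because its series is available only near 1, and W(t) W(a)^-1 may
  move far away from 1. Right multiplication of W by an invertible constant preserves its
  differential equation; this freedom is used twice, to make W commute with \<open>A\<close> and to
  let each short interval start at 1.\<close>

section \<open>Right derivatives\<close>

lemma has_vector_derivative_at_right_iff:
  "(F has_vector_derivative l) (at_right x) \<longleftrightarrow>
    ((\<lambda>y. (F y - F x) /\<^sub>R (y - x)) \<longlongrightarrow> l) (at_right x)" (is "?L \<longleftrightarrow> ?R")
proof -
  have "?L \<longleftrightarrow> ((\<lambda>y. (1 / norm (y - x)) *\<^sub>R (F y - (F x + (y - x) *\<^sub>R l))) \<longlongrightarrow> 0) (at_right x)"
    by (simp add: has_vector_derivative_def has_derivative_within bounded_linear_scaleR_left)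
  also have "\<dots> \<longleftrightarrow> ((\<lambda>y. (F y - F x) /\<^sub>R (y - x) - l) \<longlongrightarrow> 0) (at_right x)"
  proof (intro filterlim_cong eventually_at_rightI[of x "x + 1"])
    fix y assume "y \<in> {x<..<x + 1}"
    moreover from this have "(y - x) *\<^sub>R l /\<^sub>R (y - x) = l" by simp
    ultimately show "(1 / norm (y - x)) *\<^sub>R (F y - (F x + (y - x) *\<^sub>R l)) = (F y - F x) /\<^sub>R (y - x) - l"
      by (simp add: diff_diff_eq[symmetric] scaleR_diff_right[of "inverse (y - x)"] divide_inverse
        del: scaleR_scaleR)
  qed auto
  also have "\<dots> \<longleftrightarrow> ?R" by (simp add: LIM_zero_iff)
  finally show ?thesis .
qed

text \<open>The form used in the estimates: no division, and an error proportional to the length, so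
  that errors on adjacent intervals add up.\<close>

lemma has_vector_derivative_at_right_iff_eps:
  "(F has_vector_derivative l) (at_right x) \<longleftrightarrow>
    (\<forall>e>0. \<exists>h>0. \<forall>y. x < y \<and> y < x + h \<longrightarrow> norm (F y - F x - (y - x) *\<^sub>R l) \<le> e * (y - x))"
    (is "?L \<longleftrightarrow> ?R")
proof
  have eq: "dist ((F y - F x) /\<^sub>R (y - x)) l = norm (F y - F x - (y - x) *\<^sub>R l) / (y - x)"
    if "x < y" for y
  proof -
    have "(F y - F x) /\<^sub>R (y - x) - l = (F y - F x - (y - x) *\<^sub>R l) /\<^sub>R (y - x)"
      using that by (simp add: scaleR_diff_right)
    then show ?thesis using that by (simp add: dist_norm divide_inverse)
  qed
  show ?R if L: ?L
  proof (intro allI impI)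
    fix e :: real assume e: "e > 0"
    from L e have "eventually (\<lambda>y. dist ((F y - F x) /\<^sub>R (y - x)) l < e) (at_right x)"
      unfolding has_vector_derivative_at_right_iff by (rule tendstoD)
    then obtain c where c: "c > x" "\<And>y. x < y \<Longrightarrow> y < c \<Longrightarrow> dist ((F y - F x) /\<^sub>R (y - x)) l < e"
      unfolding eventually_at_right_field by auto
    show "\<exists>h>0. \<forall>y. x < y \<and> y < x + h \<longrightarrow> norm (F y - F x - (y - x) *\<^sub>R l) \<le> e * (y - x)"
    proof (intro exI[of _ "c - x"] conjI allI impI)
      fix y assume y: "x < y \<and> y < x + (c - x)"
      then have "norm (F y - F x - (y - x) *\<^sub>R l) / (y - x) < e" using c(2)[of y] eq by auto
      then show "norm (F y - F x - (y - x) *\<^sub>R l) \<le> e * (y - x)"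
        using y by (simp add: pos_divide_less_eq less_imp_le)
    qed (use c in auto)
  qed
  show ?L if R: ?R
    unfolding has_vector_derivative_at_right_iff
  proof (rule tendstoI)
    fix e :: real assume e: "e > 0"
    then obtain h where h: "h > 0"
      "\<And>y. x < y \<Longrightarrow> y < x + h \<Longrightarrow> norm (F y - F x - (y - x) *\<^sub>R l) \<le> e / 2 * (y - x)"
      using R half_gt_zero[OF e] by meson
    show "eventually (\<lambda>y. dist ((F y - F x) /\<^sub>R (y - x)) l < e) (at_right x)"
    proof (rule eventually_at_rightI[of x "x + h"])
      fix y assume y: "y \<in> {x<..<x + h}"
      have "norm (F y - F x - (y - x) *\<^sub>R l) / (y - x) \<le> e / 2"
        using h(2)[of y] y by (simp add: pos_divide_le_eq)
      also have "e / 2 < e" using e by simp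
      finally show "dist ((F y - F x) /\<^sub>R (y - x)) l < e" using y eq by simp
    qed (use h in auto)
  qed
qed

lemma tendsto_at_right_if_continuous_on:
  fixes F :: "real \<Rightarrow> 'e::real_normed_vector"
  assumes "continuous_on {a..b} F" "x \<in> {a..<b}"
  shows "(F \<longlongrightarrow> F x) (at_right x)"
proof -
  have "(F \<longlongrightarrow> F x) (at x within {a..b})"
    using assms by (simp add: continuous_on_def)
  then have "(F \<longlongrightarrow> F x) (at x within {x..b})"
    by (rule tendsto_within_subset) (use assms in auto)
  then show ?thesis using assms by (simp add: at_within_Icc_at_right)
qed

section \<open>Continuous primitives with respect to the right derivative\<close>

text \<open>Right differentiability alone does not exclude jumps from the left, so continuity is
  asked for separately; together they determine \<open>F\<close> on the interval up to a
  constant.\<close>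

definition primitive :: "real \<Rightarrow> real \<Rightarrow> (real \<Rightarrow> 'e::real_normed_vector) \<Rightarrow> (real \<Rightarrow> 'e) \<Rightarrow> bool"
  where "primitive a b f F \<longleftrightarrow> continuous_on {a..b} F \<and>
    (\<forall>x\<in>{a..<b}. (F has_vector_derivative f x) (at_right x))"

lemma primitive_subset:
  "primitive a b f F \<Longrightarrow> a \<le> s \<Longrightarrow> t \<le> b \<Longrightarrow> primitive s t f F"
  unfolding primitive_def by (auto elim: continuous_on_subset)

lemma primitive_add:
  "primitive a b f F \<Longrightarrow> primitive a b g G \<Longrightarrow> primitive a b (\<lambda>x. f x + g x) (\<lambda>x. F x + G x)"
  unfolding primitive_def by (auto intro!: continuous_intros derivative_intros)

lemma primitive_diff:
  "primitive a b f F \<Longrightarrow> primitive a b g G \<Longrightarrow> primitive a b (\<lambda>x. f x - g x) (\<lambda>x. F x - G x)"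
  unfolding primitive_def by (auto intro!: continuous_intros derivative_intros)

lemma primitive_const: "primitive a b (\<lambda>x. 0) (\<lambda>x. c)"
  unfolding primitive_def by (auto intro!: continuous_intros derivative_intros)

lemma primitive_linear: "primitive a b (\<lambda>x. l) (\<lambda>x. x *\<^sub>R l)"
  unfolding primitive_def
  by (auto intro!: continuous_intros derivative_eq_intros)

lemma primitive_cong:
  "primitive a b f F \<Longrightarrow> (\<And>x. x \<in> {a..<b} \<Longrightarrow> f x = g x) \<Longrightarrow> primitive a b g F"
  unfolding primitive_def by auto

text \<open>Mean value inequality by continuous induction: closedness of \<open>S\<close> comes from
  continuity of \<open>F\<close>, and at the supremum \<open>c\<close> of \<open>S\<close> the right
  derivative carries the bound, with slope \<open>M + e\<close>, a little beyond \<open>c\<close>.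
  The slack \<open>e\<close> absorbs the error of the derivative.\<close>

lemma primitive_norm_bound:
  fixes F :: "real \<Rightarrow> 'e::real_normed_vector"
  assumes F: "primitive a b f F" and ab: "a \<le> b" and M: "\<And>x. x \<in> {a..<b} \<Longrightarrow> norm (f x) \<le> M"
  shows "norm (F b - F a) \<le> M * (b - a)"
proof (rule field_le_epsilon)
  fix e0 :: real assume e0: "e0 > 0"
  \<comment> \<open>The summand 1 covers a = b; in the end the slack costs e (b - a) \<le>
    e0.\<close>
  define e where "e = e0 / (b - a + 1)"
  have e: "e > 0" using e0 ab by (simp add: e_def)
  \<comment> \<open>Membership speaks of x alone and not of all points up to x; the argument uses
    only that \<open>S\<close> has a largest element.\<close>
  define S where "S = {x\<in>{a..b}. norm (F x - F a) \<le> (M + e) * (x - a)}"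
  have cont: "continuous_on {a..b} F" using F by (simp add: primitive_def)
  have "closed S"
    unfolding S_def
    by (intro continuous_on_closed_Collect_le continuous_intros cont)
  have "a \<in> S" using ab by (simp add: S_def)
  have bdd: "bdd_above S" by (rule bdd_aboveI[of _ b]) (simp add: S_def)
  define c where "c = Sup S"
  have cS: "c \<in> S"
    unfolding c_def using \<open>closed S\<close> \<open>a \<in> S\<close> bdd by (intro closed_contains_Sup) auto
  have "c = b"
  proof (rule ccontr)
    assume "c \<noteq> b"
    then have c: "c \<in> {a..<b}" using cS by (auto simp: S_def)
    then obtain h where h: "h > 0"
      "\<And>y. c < y \<Longrightarrow> y < c + h \<Longrightarrow> norm (F y - F c - (y - c) *\<^sub>R f c) \<le> e * (y - c)"
      using F e unfolding primitive_def has_vector_derivative_at_right_iff_eps by meson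
    define y where "y = min b (c + h / 2)"
    have y: "c < y" "y < c + h" "y \<le> b" using c h(1) by (auto simp: y_def)
    have "norm (F y - F c) \<le> norm (F y - F c - (y - c) *\<^sub>R f c) + norm ((y - c) *\<^sub>R f c)"
      using norm_triangle_ineq[of "F y - F c - (y - c) *\<^sub>R f c" "(y - c) *\<^sub>R f c"] by simp
    also have "\<dots> \<le> e * (y - c) + (y - c) * M"
      using h(2)[OF y(1,2)] M[OF c] y(1) by (intro add_mono) (auto intro!: mult_left_mono)
    finally have "norm (F y - F c) \<le> (M + e) * (y - c)" by (simp add: algebra_simps)
    moreover have "norm (F c - F a) \<le> (M + e) * (c - a)" using cS by (simp add: S_def)
    moreover have "norm (F y - F a) \<le> norm (F y - F c) + norm (F c - F a)"
      using norm_triangle_ineq[of "F y - F c" "F c - F a"] by simp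
    ultimately have "norm (F y - F a) \<le> (M + e) * (y - a)" by (simp add: algebra_simps)
    then have "y \<in> S" using y c by (auto simp: S_def)
    then have "y \<le> c" unfolding c_def by (rule cSup_upper[OF _ bdd])
    then show False using y by simp
  qed
  then have "norm (F b - F a) \<le> (M + e) * (b - a)" using cS by (simp add: S_def)
  also have "\<dots> \<le> M * (b - a) + e0"
    using e0 ab by (simp add: e_def field_simps)
  finally show "norm (F b - F a) \<le> M * (b - a) + e0" .
qed

text \<open>Subtracting the linear function x l reduces the comparison with a constant slope to the
  mean value inequality.\<close>

lemma primitive_approx:
  fixes F :: "real \<Rightarrow> 'e::real_normed_vector"
  assumes F: "primitive s t f F" and st: "s \<le> t"
    and e: "\<And>x. x \<in> {s..<t} \<Longrightarrow> norm (f x - l) \<le> e"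
  shows "norm (F t - F s - (t - s) *\<^sub>R l) \<le> e * (t - s)"
proof -
  have "primitive s t (\<lambda>x. f x - l) (\<lambda>x. F x - x *\<^sub>R l)"
    by (rule primitive_diff[OF F primitive_linear])
  from primitive_norm_bound[OF this st e] show ?thesis by (simp add: algebra_simps)
qed

text \<open>Uniqueness of primitives, the mean value inequality with M = 0. It is applied below to
  commutators and to conjugates by W.\<close>

lemma primitive_zero_const:
  assumes F: "primitive a b (\<lambda>x. 0) F" and t: "t \<in> {a..b}"
  shows "F t = F a"
  using primitive_norm_bound[OF primitive_subset[OF F, of a t], of 0] t by simp

lemma primitive_combine:
  assumes F: "primitive a c f F" and G: "primitive c b f G" and acb: "a \<le> c" "c \<le> b"
  shows "\<exists>H. primitive a b f H"
proof
  define H where "H x = (if x \<le> c then F x else G x + (F c - G c))" for x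
  show "primitive a b f H"
    unfolding primitive_def
  proof (intro conjI ballI)
    have "continuous_on ({a..c} \<union> {c..b}) H"
      unfolding H_def using F G
      by (intro continuous_on_If) (auto simp: primitive_def intro!: continuous_intros)
    moreover have "{a..c} \<union> {c..b} = {a..b}" using acb by auto
    ultimately show "continuous_on {a..b} H" by simp
  next
    fix x assume x: "x \<in> {a..<b}"
    show "(H has_vector_derivative f x) (at_right x)"
    proof (cases "x < c")
      case True
      have "(F has_vector_derivative f x) (at_right x)" using F True x by (simp add: primitive_def)
      moreover have "eventually (\<lambda>y. (F y - F x) /\<^sub>R (y - x) = (H y - H x) /\<^sub>R (y - x)) (at_right x)"
        by (rule eventually_at_rightI[of x c]) (use True in \<open>auto simp: H_def\<close>)
      ultimately show ?thesis
        unfolding has_vector_derivative_at_right_iff by (simp only: tendsto_cong)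
    next
      \<comment> \<open>The point c belongs here: its right derivative sees only the shifted
        \<open>G\<close>, whose value at c is \<open>F c\<close>.\<close>
      case False
      have "(G has_vector_derivative f x) (at_right x)" using G False x by (simp add: primitive_def)
      moreover have "eventually (\<lambda>y. (G y - G x) /\<^sub>R (y - x) = (H y - H x) /\<^sub>R (y - x)) (at_right x)"
        by (rule eventually_at_rightI[of x b]) (use False x in \<open>auto simp: H_def\<close>)
      ultimately show ?thesis
        unfolding has_vector_derivative_at_right_iff by (simp only: tendsto_cong)
    qed
  qed
qed

text \<open>By the mean value inequality the increments of two approximate primitives differ by a
  small multiple of the length t - s, and this survives the passage to the limit. Proportionality to
  the length is what carries over right derivatives; uniform convergence of the primitives would
  give only continuity.\<close>

lemma primitive_if_approximable:
  fixes f :: "real \<Rightarrow> 'e::banach"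
  assumes ab: "a \<le> b"
    and app: "\<And>e. e > 0 \<Longrightarrow> \<exists>g G. primitive a b g G \<and> (\<forall>x\<in>{a..<b}. norm (g x - f x) \<le> e)"
  shows "\<exists>F. primitive a b f F"
proof -
  define e :: "nat \<Rightarrow> real" where "e n = inverse (real (Suc n))" for n
  have e_pos: "e n > 0" for n by (simp add: e_def)
  have e_lim: "e \<longlonglongrightarrow> 0" unfolding e_def by (rule LIMSEQ_inverse_real_of_nat)
  obtain g G where G: "\<And>n. primitive a b (g n) (G n)"
    and g: "\<And>n x. x \<in> {a..<b} \<Longrightarrow> norm (g n x - f x) \<le> e n"
    using app[OF e_pos] by metis
  have cmp: "norm ((G n t - G n s) - (G m t - G m s)) \<le> (e n + e m) * (t - s)"
    if "a \<le> s" "s \<le> t" "t \<le> b" for m n s t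
  proof -
    have "norm ((G n t - G m t) - (G n s - G m s)) \<le> (e n + e m) * (t - s)"
    proof (rule primitive_norm_bound)
      show "primitive s t (\<lambda>x. g n x - g m x) (\<lambda>x. G n x - G m x)"
        using that by (intro primitive_diff primitive_subset[OF G])
      fix x assume "x \<in> {s..<t}"
      then have x: "x \<in> {a..<b}" using that by auto
      show "norm (g n x - g m x) \<le> e n + e m"
        using norm_triangle_ineq4[of "g n x - f x" "g m x - f x"] g[OF x, of n] g[OF x, of m]
        by simp
    qed (rule that)
    then show ?thesis by (simp add: algebra_simps)
  qed
  \<comment> \<open>Increments from a, since the \<open>G n\<close> are fixed only up to additive
    constants.\<close>
  define F where "F t = lim (\<lambda>n. G n t - G n a)" for t
  have F: "(\<lambda>n. G n t - G n a) \<longlonglongrightarrow> F t" if t: "t \<in> {a..b}" for t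
  proof -
    have "Cauchy (\<lambda>n. G n t - G n a)"
    proof (rule metric_CauchyI)
      fix r :: real assume r: "r > 0"
      have "(\<lambda>n. e n * (2 * (t - a))) \<longlonglongrightarrow> 0" using tendsto_mult_left_zero[OF e_lim] .
      then have "eventually (\<lambda>n. e n * (2 * (t - a)) < r) sequentially"
        using r by (rule order_tendstoD)
      then obtain N where N: "\<And>n. n \<ge> N \<Longrightarrow> e n * (2 * (t - a)) < r"
        unfolding eventually_sequentially by blast
      show "\<exists>M. \<forall>m\<ge>M. \<forall>n\<ge>M. dist (G m t - G m a) (G n t - G n a) < r"
      proof (intro exI[of _ N] allI impI)
        fix m n assume mn: "N \<le> m" "N \<le> n"
        have "dist (G m t - G m a) (G n t - G n a) \<le> (e m + e n) * (t - a)"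
          using cmp[of a t m n] t by (simp add: dist_norm)
        also have "\<dots> < r" using N[OF mn(1)] N[OF mn(2)] by (simp add: algebra_simps)
        finally show "dist (G m t - G m a) (G n t - G n a) < r" .
      qed
    qed
    then show ?thesis
      unfolding F_def using Cauchy_convergent convergent_LIMSEQ_iff by blast
  qed
  have FG: "norm ((F t - F s) - (G n t - G n s)) \<le> e n * (t - s)"
    if "a \<le> s" "s \<le> t" "t \<le> b" for n s t
  proof (rule LIMSEQ_le)
    have st: "s \<in> {a..b}" "t \<in> {a..b}" using that by auto
    show "(\<lambda>m. norm (((G m t - G m a) - (G m s - G m a)) - (G n t - G n s)))
      \<longlonglongrightarrow> norm ((F t - F s) - (G n t - G n s))"
      by (intro tendsto_intros F st)
    have "(\<lambda>m. (e m + e n) * (t - s)) \<longlonglongrightarrow> (0 + e n) * (t - s)" by (intro tendsto_intros e_lim)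
    then show "(\<lambda>m. (e m + e n) * (t - s)) \<longlonglongrightarrow> e n * (t - s)" by simp
    show "\<exists>N. \<forall>m\<ge>N. norm (((G m t - G m a) - (G m s - G m a)) - (G n t - G n s)) \<le> (e m + e n) * (t - s)"
      using cmp[OF that, of _ n] by simp
  qed
  have "primitive a b f F"
    unfolding primitive_def
  proof (intro conjI ballI)
    show "continuous_on {a..b} F"
    proof (rule uniform_limit_theorem[where F = sequentially])
      show "\<forall>\<^sub>F n in sequentially. continuous_on {a..b} (\<lambda>t. G n t - G n a + F a)"
        using G by (intro always_eventually) (auto simp: primitive_def intro!: continuous_intros)
      show "uniform_limit {a..b} (\<lambda>n t. G n t - G n a + F a) F sequentially"
      proof (rule uniform_limitI)
        fix r :: real assume r: "r > 0"
        have "(\<lambda>n. e n * (b - a)) \<longlonglongrightarrow> 0" using tendsto_mult_left_zero[OF e_lim] .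
        then have "eventually (\<lambda>n. e n * (b - a) < r) sequentially"
          using r by (rule order_tendstoD)
        then show "\<forall>\<^sub>F n in sequentially. \<forall>t\<in>{a..b}. dist (G n t - G n a + F a) (F t) < r"
        proof eventually_elim
          fix n assume n: "e n * (b - a) < r"
          show "\<forall>t\<in>{a..b}. dist (G n t - G n a + F a) (F t) < r"
          proof
            fix t assume t: "t \<in> {a..b}"
            have "dist (G n t - G n a + F a) (F t) \<le> e n * (t - a)"
              using FG[of a t n] t by (simp add: dist_norm norm_minus_commute algebra_simps)
            also have "\<dots> \<le> e n * (b - a)" using t e_pos[of n] by (intro mult_left_mono) auto
            finally show "dist (G n t - G n a + F a) (F t) < r" using n by simp
          qed
        qed
      qed
    qed auto
  next
    fix x assume x: "x \<in> {a..<b}"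
    show "(F has_vector_derivative f x) (at_right x)"
      unfolding has_vector_derivative_at_right_iff_eps
    proof (intro allI impI)
      fix r :: real assume r: "r > 0"
      then have "eventually (\<lambda>n. e n < r / 3) sequentially"
        using order_tendstoD(2)[OF e_lim, of "r / 3"] by simp
      then obtain n where n: "e n < r / 3" unfolding eventually_sequentially by blast
      have "(G n has_vector_derivative g n x) (at_right x)" using G x by (simp add: primitive_def)
      then obtain h where h: "h > 0"
        "\<And>y. x < y \<Longrightarrow> y < x + h \<Longrightarrow> norm (G n y - G n x - (y - x) *\<^sub>R g n x) \<le> r / 3 * (y - x)"
        unfolding has_vector_derivative_at_right_iff_eps using r
        by (meson divide_pos_pos zero_less_numeral)
      show "\<exists>h>0. \<forall>y. x < y \<and> y < x + h \<longrightarrow> norm (F y - F x - (y - x) *\<^sub>R f x) \<le> r * (y - x)"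
      proof (intro exI[of _ "min h (b - x)"] conjI allI impI)
        fix y assume y: "x < y \<and> y < x + min h (b - x)"
        \<comment> \<open>Three errors of at most r / 3 times the length: \<open>F\<close> against
          \<open>G n\<close>, \<open>G n\<close> against its own derivative, \<open>g n\<close>
          against \<open>f\<close>.\<close>
        have 1: "norm ((F y - F x) - (G n y - G n x)) \<le> r / 3 * (y - x)"
        proof -
          have "norm ((F y - F x) - (G n y - G n x)) \<le> e n * (y - x)"
            using FG[of x y n] x y by auto
          also have "\<dots> \<le> r / 3 * (y - x)" using n y by (intro mult_right_mono) auto
          finally show ?thesis .
        qed
        have 2: "norm (G n y - G n x - (y - x) *\<^sub>R g n x) \<le> r / 3 * (y - x)"
          using h(2) y by auto
        have "norm ((y - x) *\<^sub>R g n x - (y - x) *\<^sub>R f x) = (y - x) * norm (g n x - f x)"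
          using y by (simp flip: scaleR_diff_right)
        also have "\<dots> \<le> (y - x) * (r / 3)"
          using g[OF x, of n] n y by (intro mult_left_mono) auto
        finally have 3: "norm ((y - x) *\<^sub>R g n x - (y - x) *\<^sub>R f x) \<le> r / 3 * (y - x)"
          by (simp add: mult.commute)
        have "norm (F y - F x - (y - x) *\<^sub>R f x) \<le> norm ((F y - F x) - (G n y - G n x))
          + (norm (G n y - G n x - (y - x) *\<^sub>R g n x)
          + norm ((y - x) *\<^sub>R g n x - (y - x) *\<^sub>R f x))"
          using order_trans[OF norm_triangle_ineq add_left_mono[OF norm_triangle_ineq],
            of "(F y - F x) - (G n y - G n x)" "G n y - G n x - (y - x) *\<^sub>R g n x"
               "(y - x) *\<^sub>R g n x - (y - x) *\<^sub>R f x"]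
          by simp
        then show "norm (F y - F x - (y - x) *\<^sub>R f x) \<le> r * (y - x)"
          using 1 2 3 by (simp add: algebra_simps)
      qed (use h x in auto)
    qed
  qed
  then show ?thesis by blast
qed

section \<open>Sums over fine tagged partitions\<close>

text \<open>One shape for both strong integrals: \<Theta> is the error committed on the subinterval
  with tag \<xi> and end points s, t. As the norms stand inside the sum, a part of a partition
  inherits the bound of the whole.\<close>

definition strongly_null ::
    "real \<Rightarrow> real \<Rightarrow> (real \<Rightarrow> real \<Rightarrow> real \<Rightarrow> 'e::real_normed_vector) \<Rightarrow> bool"
  where "strongly_null a b \<Theta> \<longleftrightarrow>
    (\<forall>\<eta>>0. \<exists>\<delta>. pos_gauge a b \<delta> \<and>
      (\<forall>m \<xi> t. tagged_partition a b m \<xi> t \<and> delta_fine \<delta> m \<xi> t \<longrightarrow>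
        (\<Sum>i<m. norm (\<Theta> (\<xi> i) (t i) (t (Suc i)))) < \<eta>))"

lemma strongly_HK_integrable_iff:
  "strongly_HK_integrable a b B \<longleftrightarrow>
    (\<exists>F. strongly_null a b (\<lambda>\<xi> s t. (t - s) *\<^sub>R B \<xi> - (F t - F s)))"
  unfolding strongly_HK_integrable_def strongly_null_def ..

lemma tagged_partition_less:
  assumes "tagged_partition a b m \<xi> t" "i < j" "j \<le> m"
  shows "t i < t j"
  using assms(2,3)
proof (induction j)
  case (Suc j)
  then have "t j < t (Suc j)" using assms(1) by (simp add: tagged_partition_def)
  then show ?case using Suc by (cases "i = j") auto
qed simp

lemma tagged_partition_le:
  assumes "tagged_partition a b m \<xi> t" "i \<le> j" "j \<le> m"
  shows "t i \<le> t j"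
  using tagged_partition_less[OF assms(1), of i j] assms by (cases "i = j") auto

lemma tagged_partition_bounds:
  assumes tp: "tagged_partition a b m \<xi> t" and i: "i < m"
  shows "a \<le> t i" "t i \<le> \<xi> i" "\<xi> i \<le> t (Suc i)" "t (Suc i) \<le> b" "t i < t (Suc i)"
  using tagged_partition_le[OF tp, of 0 i] tagged_partition_le[OF tp, of "Suc i" m] assms
  unfolding tagged_partition_def by auto

lemma tagged_partition_telescope:
  fixes F :: "real \<Rightarrow> 'e::real_normed_vector"
  assumes "tagged_partition a b m \<xi> t"
  shows "(\<Sum>i<m. F (t (Suc i)) - F (t i)) = F b - F a"
  using assms sum_lessThan_telescope[of "\<lambda>i. F (t i)" m] by (simp add: tagged_partition_def)

text \<open>The sum rule quantifies over g after the joined partition is fixed, so one joined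
  partition serves every error function.\<close>

lemma tagged_partition_join:
  assumes 1: "tagged_partition a c m \<xi> t" "delta_fine \<delta> m \<xi> t"
    and 2: "tagged_partition c b n \<xi>' t'" "delta_fine \<delta> n \<xi>' t'"
  obtains \<zeta> u where "tagged_partition a b (m + n) \<zeta> u" "delta_fine \<delta> (m + n) \<zeta> u"
    "\<And>g :: real \<Rightarrow> real \<Rightarrow> real \<Rightarrow> real. (\<Sum>i<m+n. g (\<zeta> i) (u i) (u (Suc i))) =
      (\<Sum>i<m. g (\<xi> i) (t i) (t (Suc i))) + (\<Sum>i<n. g (\<xi>' i) (t' i) (t' (Suc i)))"
proof -
  \<comment> \<open>Both families of nodes contain c, as \<open>t m = t' 0\<close>; hence \<le> for
    the nodes but < for the tags.\<close>
  define u where "u i = (if i \<le> m then t i else t' (i - m))" for i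
  define \<zeta> where "\<zeta> i = (if i < m then \<xi> i else \<xi>' (i - m))" for i
  have tm: "t m = t' 0" using 1 2 by (simp add: tagged_partition_def)
  have u1: "u i = t i" "u (Suc i) = t (Suc i)" "\<zeta> i = \<xi> i" if "i < m" for i
    using that by (auto simp: u_def \<zeta>_def)
  have u2: "u (m + i) = t' i" "u (Suc (m + i)) = t' (Suc i)" "\<zeta> (m + i) = \<xi>' i" for i
    using tm by (auto simp: u_def \<zeta>_def Suc_diff_le)
  have all: "(\<forall>i<m+n. P i) \<longleftrightarrow> (\<forall>i<m. P i) \<and> (\<forall>i<n. P (m + i))" for P
  proof (intro iffI conjI allI impI)
    fix i assume P: "(\<forall>i<m. P i) \<and> (\<forall>i<n. P (m + i))" and i: "i < m + n"
    show "P i"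
    proof (cases "i < m")
      case False
      then have "i = m + (i - m)" "i - m < n" using i by auto
      then show ?thesis using P by metis
    qed (use P in blast)
  qed auto
  have u0: "u 0 = a" "u (m + n) = b"
    using 1 2 u2(1)[of n] by (auto simp: u_def tagged_partition_def)
  have sum: "(\<Sum>i<m+n. f i) = (\<Sum>i<m. f i) + (\<Sum>i<n. f (m + i))" for f :: "nat \<Rightarrow> real"
    by (induction n) auto
  show ?thesis
  proof (rule that)
    show "tagged_partition a b (m + n) \<zeta> u"
      using 1 2 unfolding tagged_partition_def all by (simp add: u0 u1 u2)
    show "delta_fine \<delta> (m + n) \<zeta> u"
      using 1 2 unfolding delta_fine_def all by (simp add: u1 u2)
    show "(\<Sum>i<m+n. g (\<zeta> i) (u i) (u (Suc i))) =
      (\<Sum>i<m. g (\<xi> i) (t i) (t (Suc i))) + (\<Sum>i<n. g (\<xi>' i) (t' i) (t' (Suc i)))"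
      for g :: "real \<Rightarrow> real \<Rightarrow> real \<Rightarrow> real"
      unfolding sum by (simp add: u1 u2)
  qed
qed

text \<open>Cousin's lemma by bisection: fine partitions of adjacent intervals join, and a short
  interval containing x is fine with x as its only tag.\<close>

lemma fine_tagged_partition_exists:
  assumes \<delta>: "pos_gauge a b \<delta>" and st: "a \<le> s" "s \<le> t" "t \<le> b"
  shows "\<exists>m \<xi> u. tagged_partition s t m \<xi> u \<and> delta_fine \<delta> m \<xi> u"
  using st(2)
proof (induction rule: Bolzano)
  case (trans u v w)
  then obtain m \<xi> p n \<xi>' p' where 1: "tagged_partition u v m \<xi> p" "delta_fine \<delta> m \<xi> p"
    and 2: "tagged_partition v w n \<xi>' p'" "delta_fine \<delta> n \<xi>' p'" by blast
  show ?case by (rule tagged_partition_join[OF 1 2]) blast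
next
  case (local x)
  show ?case
  proof (intro exI[of _ "\<delta> x"] conjI allI impI)
    show "\<delta> x > 0" using \<delta> st local by (simp add: pos_gauge_def)
    fix u v assume uv: "u \<le> x \<and> x \<le> v \<and> v - u < \<delta> x"
    show "\<exists>m \<xi> p. tagged_partition u v m \<xi> p \<and> delta_fine \<delta> m \<xi> p"
    proof (cases "u = v")
      case True
      \<comment> \<open>Nodes increase strictly, so a degenerate interval has the empty
        partition.\<close>
      then have "tagged_partition u v 0 (\<lambda>_. u) (\<lambda>_. u) \<and> delta_fine \<delta> 0 (\<lambda>_. u) (\<lambda>_. u)"
        by (simp add: tagged_partition_def delta_fine_def)
      then show ?thesis by blast
    next
      case False
      then have "tagged_partition u v 1 (\<lambda>_. x) (\<lambda>i. if i = 0 then u else v) \<and>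
          delta_fine \<delta> 1 (\<lambda>_. x) (\<lambda>i. if i = 0 then u else v)"
        using uv by (auto simp: tagged_partition_def delta_fine_def)
      then show ?thesis by blast
    qed
  qed
qed

text \<open>Cousin's lemma fills the two remaining intervals with fine partitions, and their terms
  are nonnegative. For strong integrals this plays the part of the Saks-Henstock lemma.\<close>

lemma subinterval_sum_less:
  fixes g :: "real \<Rightarrow> real \<Rightarrow> real \<Rightarrow> real"
  assumes \<delta>: "pos_gauge a b \<delta>"
    and sum: "\<And>m \<xi> t. tagged_partition a b m \<xi> t \<Longrightarrow> delta_fine \<delta> m \<xi> t \<Longrightarrow>
        (\<Sum>i<m. g (\<xi> i) (t i) (t (Suc i))) < \<eta>"
    and g: "\<And>x u v. g x u v \<ge> 0"
    and st: "a \<le> s" "s \<le> r" "r \<le> b"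
    and tp: "tagged_partition s r m \<xi> t" "delta_fine \<delta> m \<xi> t"
  shows "(\<Sum>i<m. g (\<xi> i) (t i) (t (Suc i))) < \<eta>"
proof -
  obtain m1 \<xi>1 t1 where 1: "tagged_partition a s m1 \<xi>1 t1" "delta_fine \<delta> m1 \<xi>1 t1"
    using fine_tagged_partition_exists[OF \<delta>, of a s] st by auto
  obtain m2 \<xi>2 t2 where 2: "tagged_partition r b m2 \<xi>2 t2" "delta_fine \<delta> m2 \<xi>2 t2"
    using fine_tagged_partition_exists[OF \<delta>, of r b] st by auto
  obtain \<zeta> u where 3: "tagged_partition a r (m1 + m) \<zeta> u" "delta_fine \<delta> (m1 + m) \<zeta> u"
    "\<And>g :: real \<Rightarrow> real \<Rightarrow> real \<Rightarrow> real. (\<Sum>i<m1+m. g (\<zeta> i) (u i) (u (Suc i))) =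
      (\<Sum>i<m1. g (\<xi>1 i) (t1 i) (t1 (Suc i))) + (\<Sum>i<m. g (\<xi> i) (t i) (t (Suc i)))"
    by (rule tagged_partition_join[OF 1 tp], rule that)
  obtain \<zeta>' u' where 4: "tagged_partition a b (m1 + m + m2) \<zeta>' u'" "delta_fine \<delta> (m1 + m + m2) \<zeta>' u'"
    "\<And>g :: real \<Rightarrow> real \<Rightarrow> real \<Rightarrow> real. (\<Sum>i<m1+m+m2. g (\<zeta>' i) (u' i) (u' (Suc i))) =
      (\<Sum>i<m1+m. g (\<zeta> i) (u i) (u (Suc i))) + (\<Sum>i<m2. g (\<xi>2 i) (t2 i) (t2 (Suc i)))"
    by (rule tagged_partition_join[OF 3(1,2) 2], rule that)
  have "(\<Sum>i<m1. g (\<xi>1 i) (t1 i) (t1 (Suc i))) \<ge> 0" "(\<Sum>i<m2. g (\<xi>2 i) (t2 i) (t2 (Suc i))) \<ge> 0"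
    by (simp_all add: sum_nonneg g)
  then show ?thesis using sum[OF 4(1,2)] 3(3)[of g] 4(3)[of g] by linarith
qed

text \<open>On a fine partition of [s, t] the increments of \<open>F\<close> telescope, the
  comparison of \<Psi> with the slope l costs e times the total length, and the strong error is
  below any given \<eta>.\<close>

lemma strongly_null_approx:
  fixes F :: "real \<Rightarrow> 'e::real_normed_vector"
  assumes null: "strongly_null a b (\<lambda>\<xi> s t. \<Psi> \<xi> s t - (F t - F s))"
    and st: "a \<le> s" "s \<le> t" "t \<le> b"
    and near: "\<And>\<xi> u v. s \<le> u \<Longrightarrow> u \<le> \<xi> \<Longrightarrow> \<xi> \<le> v \<Longrightarrow> v \<le> t \<Longrightarrow>
      norm (\<Psi> \<xi> u v - (v - u) *\<^sub>R l) \<le> e * (v - u)"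
  shows "norm (F t - F s - (t - s) *\<^sub>R l) \<le> e * (t - s)"
proof (rule field_le_epsilon)
  fix \<eta> :: real assume "\<eta> > 0"
  then obtain \<delta> where \<delta>: "pos_gauge a b \<delta>"
    and sum: "\<And>m \<xi> p. tagged_partition a b m \<xi> p \<Longrightarrow> delta_fine \<delta> m \<xi> p \<Longrightarrow>
        (\<Sum>i<m. norm (\<Psi> (\<xi> i) (p i) (p (Suc i)) - (F (p (Suc i)) - F (p i)))) < \<eta>"
    using null unfolding strongly_null_def by meson
  obtain m \<xi> p where p: "tagged_partition s t m \<xi> p" "delta_fine \<delta> m \<xi> p"
    using fine_tagged_partition_exists[OF \<delta> st] by blast
  have small: "(\<Sum>i<m. norm (\<Psi> (\<xi> i) (p i) (p (Suc i)) - (F (p (Suc i)) - F (p i)))) < \<eta>"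
    using subinterval_sum_less[where g="\<lambda>x u v. norm (\<Psi> x u v - (F v - F u))", OF \<delta> sum _ st p]
    by simp
  have "F t - F s - (t - s) *\<^sub>R l =
    (\<Sum>i<m. F (p (Suc i)) - F (p i)) - (\<Sum>i<m. p (Suc i) *\<^sub>R l - p i *\<^sub>R l)"
    using tagged_partition_telescope[OF p(1), of F]
      tagged_partition_telescope[OF p(1), of "\<lambda>x. x *\<^sub>R l"] by (simp add: algebra_simps)
  also have "\<dots> = (\<Sum>i<m. (\<Psi> (\<xi> i) (p i) (p (Suc i)) - (p (Suc i) - p i) *\<^sub>R l)
      - (\<Psi> (\<xi> i) (p i) (p (Suc i)) - (F (p (Suc i)) - F (p i))))"
    by (simp add: algebra_simps flip: sum_subtractf)
  also have "norm \<dots> \<le> (\<Sum>i<m. e * (p (Suc i) - p i)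
      + norm (\<Psi> (\<xi> i) (p i) (p (Suc i)) - (F (p (Suc i)) - F (p i))))"
  proof (rule sum_norm_le)
    fix i assume "i \<in> {..<m}"
    then have "norm (\<Psi> (\<xi> i) (p i) (p (Suc i)) - (p (Suc i) - p i) *\<^sub>R l) \<le> e * (p (Suc i) - p i)"
      using tagged_partition_bounds[OF p(1), of i] by (intro near) auto
    then show "norm (\<Psi> (\<xi> i) (p i) (p (Suc i)) - (p (Suc i) - p i) *\<^sub>R l
        - (\<Psi> (\<xi> i) (p i) (p (Suc i)) - (F (p (Suc i)) - F (p i))))
      \<le> e * (p (Suc i) - p i) + norm (\<Psi> (\<xi> i) (p i) (p (Suc i)) - (F (p (Suc i)) - F (p i)))"
      by (rule order_trans[OF norm_triangle_ineq4 add_right_mono])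
  qed
  also have "\<dots> = e * (t - s)
      + (\<Sum>i<m. norm (\<Psi> (\<xi> i) (p i) (p (Suc i)) - (F (p (Suc i)) - F (p i))))"
    unfolding sum.distrib sum_distrib_left[symmetric]
      tagged_partition_telescope[OF p(1), of "\<lambda>x. x"] ..
  finally show "norm (F t - F s - (t - s) *\<^sub>R l) \<le> e * (t - s) + \<eta>" using small by simp
qed

text \<open>The partition of [s, t] with the single tag x, completed to one of [a, b], bounds the
  increment of \<open>F\<close> by the size of \<Psi> plus the strong error. Taking x as the right
  or the left end point gives continuity from both sides.\<close>

lemma strongly_null_continuous:
  fixes F :: "real \<Rightarrow> 'e::real_normed_vector"
  assumes null: "strongly_null a b (\<lambda>\<xi> s t. \<Psi> \<xi> s t - (F t - F s))"
    and small: "\<And>\<xi> \<eta>. \<xi> \<in> {a..b} \<Longrightarrow> \<eta> > 0 \<Longrightarrow>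
      \<exists>d>0. \<forall>s t. a \<le> s \<and> s \<le> \<xi> \<and> \<xi> \<le> t \<and> t \<le> b \<and> t - s < d \<longrightarrow> norm (\<Psi> \<xi> s t) \<le> \<eta>"
  shows "continuous_on {a..b} F"
  unfolding continuous_on_iff
proof (intro ballI allI impI)
  fix x and e :: real assume x: "x \<in> {a..b}" and e: "e > 0"
  obtain \<delta> where \<delta>: "pos_gauge a b \<delta>"
    and sum: "\<And>m \<xi> p. tagged_partition a b m \<xi> p \<Longrightarrow> delta_fine \<delta> m \<xi> p \<Longrightarrow>
        (\<Sum>i<m. norm (\<Psi> (\<xi> i) (p i) (p (Suc i)) - (F (p (Suc i)) - F (p i)))) < e / 2"
    using null half_gt_zero[OF e] unfolding strongly_null_def by meson
  obtain d where d: "d > 0"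
    "\<And>s t. a \<le> s \<Longrightarrow> s \<le> x \<Longrightarrow> x \<le> t \<Longrightarrow> t \<le> b \<Longrightarrow> t - s < d \<Longrightarrow> norm (\<Psi> x s t) \<le> e / 2"
    using small[OF x half_gt_zero[OF e]] by blast
  have key: "norm (F t - F s) < e"
    if st: "a \<le> s" "s \<le> x" "x \<le> t" "t \<le> b" "t - s < d" "t - s < \<delta> x" "s < t" for s t
  proof -
    have "(\<Sum>i<1. norm (\<Psi> ((\<lambda>_. x) i) ((\<lambda>i. if i = 0 then s else t) i)
        ((\<lambda>i. if i = 0 then s else t) (Suc i)) - (F ((\<lambda>i. if i = 0 then s else t) (Suc i))
        - F ((\<lambda>i. if i = 0 then s else t) i)))) < e / 2"
      by (rule subinterval_sum_less[where g="\<lambda>x u v. norm (\<Psi> x u v - (F v - F u))", OF \<delta> sum, of s t])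
         (use st in \<open>auto simp: tagged_partition_def delta_fine_def\<close>)
    then have 1: "norm (\<Psi> x s t - (F t - F s)) < e / 2" by simp
    have 2: "norm (\<Psi> x s t) \<le> e / 2" using d(2) st by blast
    have "norm (F t - F s) \<le> norm (\<Psi> x s t) + norm (\<Psi> x s t - (F t - F s))" by norm
    also have "\<dots> < e / 2 + e / 2" using 1 2 by linarith
    finally show ?thesis by simp
  qed
  show "\<exists>d>0. \<forall>y\<in>{a..b}. dist y x < d \<longrightarrow> dist (F y) (F x) < e"
  proof (intro exI[of _ "min d (\<delta> x)"] conjI ballI impI)
    show "min d (\<delta> x) > 0" using d(1) \<delta> x by (simp add: pos_gauge_def)
    fix y assume y: "y \<in> {a..b}" "dist y x < min d (\<delta> x)"
    consider "y < x" | "y = x" | "y > x" by linarith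
    then show "dist (F y) (F x) < e"
    proof cases
      case 1
      then show ?thesis using key[of y x] y x by (simp add: dist_norm norm_minus_commute)
    next
      case 2
      then show ?thesis using e by simp
    next
      case 3
      then show ?thesis using key[of x y] y x by (simp add: dist_norm)
    qed
  qed
qed

text \<open>The hypothesis \<open>near\<close> stays strictly to the right of x, because a right
  limit says nothing about a tag at x itself. The estimate is made on [s, y] with x < s, and
  continuity of \<open>F\<close> lets s tend to x.\<close>

lemma strongly_null_primitive:
  fixes F :: "real \<Rightarrow> 'e::real_normed_vector"
  assumes null: "strongly_null a b (\<lambda>\<xi> s t. \<Psi> \<xi> s t - (F t - F s))"
    and cont: "continuous_on {a..b} F"
    and near: "\<And>x e. x \<in> {a..<b} \<Longrightarrow> e > 0 \<Longrightarrow>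
      \<exists>h>0. \<forall>\<xi> u v. x < u \<and> u \<le> \<xi> \<and> \<xi> \<le> v \<and> v < x + h \<and> v \<le> b \<longrightarrow>
        norm (\<Psi> \<xi> u v - (v - u) *\<^sub>R l x) \<le> e * (v - u)"
  shows "primitive a b l F"
  unfolding primitive_def has_vector_derivative_at_right_iff_eps
proof (intro conjI ballI allI impI cont)
  fix x and e :: real assume x: "x \<in> {a..<b}" and e: "e > 0"
  obtain h where h: "h > 0" "\<And>\<xi> u v. x < u \<Longrightarrow> u \<le> \<xi> \<Longrightarrow> \<xi> \<le> v \<Longrightarrow> v < x + h \<Longrightarrow> v \<le> b \<Longrightarrow>
        norm (\<Psi> \<xi> u v - (v - u) *\<^sub>R l x) \<le> e * (v - u)"
    using near[OF x e] by blast
  show "\<exists>h>0. \<forall>y. x < y \<and> y < x + h \<longrightarrow> norm (F y - F x - (y - x) *\<^sub>R l x) \<le> e * (y - x)"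
  proof (intro exI[of _ "min h (b - x)"] conjI allI impI)
    fix y assume y: "x < y \<and> y < x + min h (b - x)"
    have F: "(F \<longlongrightarrow> F x) (at_right x)" by (rule tendsto_at_right_if_continuous_on[OF cont x])
    show "norm (F y - F x - (y - x) *\<^sub>R l x) \<le> e * (y - x)"
    proof (rule tendsto_le[OF trivial_limit_at_right_real])
      show "((\<lambda>s. norm (F y - F s - (y - s) *\<^sub>R l x)) \<longlongrightarrow> norm (F y - F x - (y - x) *\<^sub>R l x)) (at_right x)"
        by (intro tendsto_intros F)
      show "((\<lambda>s. e * (y - s)) \<longlongrightarrow> e * (y - x)) (at_right x)" by (intro tendsto_intros)
      show "\<forall>\<^sub>F s in at_right x. norm (F y - F s - (y - s) *\<^sub>R l x) \<le> e * (y - s)"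
      proof (rule eventually_at_rightI[of x y])
        fix s assume s: "s \<in> {x<..<y}"
        show "norm (F y - F s - (y - s) *\<^sub>R l x) \<le> e * (y - s)"
          by (rule strongly_null_approx[OF null]) (use s x y h(2) in auto)
      qed (use y in auto)
    qed
  qed (use h x in auto)
qed

text \<open>
  On the countable exceptional set the error at the \<open>n\<close>-th point is kept below \<open>\<eta> / 2\<^sup>n\<close>;
  this suffices because a point is the tag of at most two subintervals.
\<close>

lemma strongly_nullI:
  fixes \<Theta> :: "real \<Rightarrow> real \<Rightarrow> real \<Rightarrow> 'e::real_normed_vector"
  assumes small: "\<And>\<xi> \<eta>. \<xi> \<in> {a..b} \<Longrightarrow> \<eta> > 0 \<Longrightarrow>
      \<exists>d>0. \<forall>s t. a \<le> s \<and> s \<le> \<xi> \<and> \<xi> \<le> t \<and> t \<le> b \<and> t - s < d \<longrightarrow> norm (\<Theta> \<xi> s t) \<le> \<eta>"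
    and straddle: "\<And>\<eta>. \<eta> > 0 \<Longrightarrow> \<exists>C. countable C \<and> (\<forall>\<xi>\<in>{a..b} - C.
      \<exists>d>0. \<forall>s t. a \<le> s \<and> s \<le> \<xi> \<and> \<xi> \<le> t \<and> t \<le> b \<and> t - s < d \<longrightarrow> norm (\<Theta> \<xi> s t) \<le> \<eta> * (t - s))"
    and ab: "a \<le> b"
  shows "strongly_null a b \<Theta>"
  unfolding strongly_null_def
proof (intro allI impI)
  fix e :: real assume e: "e > 0"
  \<comment> \<open>The budget is \<eta> (b - a) from the lengths and 4 \<eta> from the exceptional
    tags; 5 makes the final inequality strict.\<close>
  define \<eta> where "\<eta> = e / (b - a + 5)"
  have \<eta>: "\<eta> > 0" using e ab by (simp add: \<eta>_def)
  obtain C where C: "countable C" and str: "\<And>\<xi>. \<xi>\<in>{a..b} - C \<Longrightarrow>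
      \<exists>d>0. \<forall>s t. a \<le> s \<and> s \<le> \<xi> \<and> \<xi> \<le> t \<and> t \<le> b \<and> t - s < d \<longrightarrow> norm (\<Theta> \<xi> s t) \<le> \<eta> * (t - s)"
    using straddle[OF \<eta>] by (elim exE conjE) (rule that, auto)
  define w where "w x = (if x \<in> C then \<eta> * (1/2) ^ to_nat_on C x else 0)" for x
  have w_nonneg: "w x \<ge> 0" for x using \<eta> by (simp add: w_def)
  have wsum: "sum w K \<le> 2 * \<eta>" if K: "finite K" for K
  proof -
    have "sum w K = (\<Sum>x\<in>K \<inter> C. \<eta> * (1/2) ^ to_nat_on C x)"
      unfolding w_def using K by (simp add: sum.inter_restrict)
    also have "\<dots> = (\<Sum>n\<in>to_nat_on C ` (K \<inter> C). \<eta> * (1/2) ^ n)"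
      by (subst sum.reindex) (use inj_on_to_nat_on[OF C] in \<open>auto intro: inj_on_subset\<close>)
    also have "\<dots> \<le> (\<Sum>n. \<eta> * (1/2) ^ n)"
      using K \<eta> by (intro sum_le_suminf summable_mult summable_geometric) auto
    also have "\<dots> = 2 * \<eta>" using suminf_geometric[of "1/2::real"] by (simp add: suminf_mult)
    finally show ?thesis .
  qed
  have "\<exists>d>0. \<forall>s t. a \<le> s \<and> s \<le> \<xi> \<and> \<xi> \<le> t \<and> t \<le> b \<and> t - s < d \<longrightarrow>
      norm (\<Theta> \<xi> s t) \<le> \<eta> * (t - s) + w \<xi>" if \<xi>: "\<xi> \<in> {a..b}" for \<xi>
  proof (cases "\<xi> \<in> C")
    case True
    then have "w \<xi> > 0" using \<eta> by (simp add: w_def)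
    from small[OF \<xi> this] obtain d where d: "d > 0"
      "\<And>s t. a \<le> s \<and> s \<le> \<xi> \<and> \<xi> \<le> t \<and> t \<le> b \<and> t - s < d \<Longrightarrow> norm (\<Theta> \<xi> s t) \<le> w \<xi>"
      by blast
    have "norm (\<Theta> \<xi> s t) \<le> \<eta> * (t - s) + w \<xi>"
      if "a \<le> s \<and> s \<le> \<xi> \<and> \<xi> \<le> t \<and> t \<le> b \<and> t - s < d" for s t
      using d(2)[OF that] that \<eta> by (simp add: add_increasing)
    then show ?thesis using d(1) by blast
  next
    case False
    then show ?thesis using str[of \<xi>] \<xi> by (simp add: w_def)
  qed
  then obtain \<delta> where \<delta>: "\<And>\<xi>. \<xi> \<in> {a..b} \<Longrightarrow> \<delta> \<xi> > 0"
    "\<And>\<xi> s t. \<xi> \<in> {a..b} \<Longrightarrow> a \<le> s \<and> s \<le> \<xi> \<and> \<xi> \<le> t \<and> t \<le> b \<and> t - s < \<delta> \<xi> \<Longrightarrow>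
      norm (\<Theta> \<xi> s t) \<le> \<eta> * (t - s) + w \<xi>"
    by metis
  show "\<exists>\<delta>. pos_gauge a b \<delta> \<and> (\<forall>m \<xi> t. tagged_partition a b m \<xi> t \<and> delta_fine \<delta> m \<xi> t \<longrightarrow>
        (\<Sum>i<m. norm (\<Theta> (\<xi> i) (t i) (t (Suc i)))) < e)"
  \<comment> \<open>Halving turns fineness around the tag into the bound
    \<open>\<delta> (\<xi> i)\<close> on the length of the subinterval.\<close>
  proof (intro exI[of _ "\<lambda>x. \<delta> x / 2"] conjI allI impI)
    show "pos_gauge a b (\<lambda>x. \<delta> x / 2)" using \<delta>(1) by (simp add: pos_gauge_def)
    fix m \<xi> t assume "tagged_partition a b m \<xi> t \<and> delta_fine (\<lambda>x. \<delta> x / 2) m \<xi> t"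
    then have tp: "tagged_partition a b m \<xi> t" and fine: "delta_fine (\<lambda>x. \<delta> x / 2) m \<xi> t" by auto
    note tb = tagged_partition_bounds[OF tp]
    have "(\<Sum>i<m. norm (\<Theta> (\<xi> i) (t i) (t (Suc i)))) \<le> (\<Sum>i<m. \<eta> * (t (Suc i) - t i) + w (\<xi> i))"
    proof (rule sum_mono)
      fix i assume "i \<in> {..<m}"
      then have i: "i < m" by simp
      have "{t i..t (Suc i)} \<subseteq> {\<xi> i - \<delta> (\<xi> i) / 2<..<\<xi> i + \<delta> (\<xi> i) / 2}"
        using fine i by (simp add: delta_fine_def)
      moreover have "t i \<in> {t i..t (Suc i)}" "t (Suc i) \<in> {t i..t (Suc i)}" using tb[OF i] by auto
      ultimately have "\<xi> i - \<delta> (\<xi> i) / 2 < t i" "t (Suc i) < \<xi> i + \<delta> (\<xi> i) / 2" by auto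
      then show "norm (\<Theta> (\<xi> i) (t i) (t (Suc i))) \<le> \<eta> * (t (Suc i) - t i) + w (\<xi> i)"
        using tb[OF i] by (intro \<delta>(2)) auto
    qed
    also have "\<dots> = \<eta> * (b - a) + (\<Sum>i<m. w (\<xi> i))"
      unfolding sum.distrib sum_distrib_left[symmetric]
        tagged_partition_telescope[OF tp, of "\<lambda>x. x"] ..
    \<comment> \<open>A tag at the left end determines its subinterval, and so does a tag in the
      rest \<open>(t i, t (Suc i)]\<close>. Hence the tags are distinct within each class, and
      \<open>wsum\<close> applies to each class separately.\<close>
    also have "(\<Sum>i<m. w (\<xi> i)) = (\<Sum>i\<in>{i\<in>{..<m}. \<xi> i = t i}. w (\<xi> i)) + (\<Sum>i\<in>{i\<in>{..<m}. \<xi> i \<noteq> t i}. w (\<xi> i))"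
      by (subst sum.Int_Diff[of "{..<m}" _ "{i. \<xi> i = t i}"])
         (auto intro!: arg_cong2[where f="(+)"] sum.cong)
    also have "\<dots> \<le> 2 * \<eta> + 2 * \<eta>"
    proof (rule add_mono)
      have "inj_on \<xi> {i\<in>{..<m}. \<xi> i = t i}"
      proof (rule inj_onI)
        fix i j assume "i \<in> {i\<in>{..<m}. \<xi> i = t i}" "j \<in> {i\<in>{..<m}. \<xi> i = t i}" "\<xi> i = \<xi> j"
        then show "i = j" using tagged_partition_less[OF tp, of i j] tagged_partition_less[OF tp, of j i]
          by (cases i j rule: linorder_cases) auto
      qed
      then have "(\<Sum>i\<in>{i\<in>{..<m}. \<xi> i = t i}. w (\<xi> i)) = sum w (\<xi> ` {i\<in>{..<m}. \<xi> i = t i})"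
        by (simp only: sum.reindex comp_def)
      then show "(\<Sum>i\<in>{i\<in>{..<m}. \<xi> i = t i}. w (\<xi> i)) \<le> 2 * \<eta>" using wsum by simp
      have ne: "\<xi> i \<noteq> \<xi> j" if "i < j" "j < m" "\<xi> j \<noteq> t j" for i j
        using tb[of i] tb[of j] tagged_partition_le[OF tp, of "Suc i" j] that by auto
      have "inj_on \<xi> {i\<in>{..<m}. \<xi> i \<noteq> t i}"
      proof (rule inj_onI)
        fix i j assume "i \<in> {i\<in>{..<m}. \<xi> i \<noteq> t i}" "j \<in> {i\<in>{..<m}. \<xi> i \<noteq> t i}" "\<xi> i = \<xi> j"
        then show "i = j" using ne[of i j] ne[of j i] by (cases i j rule: linorder_cases) auto
      qed
      then have "(\<Sum>i\<in>{i\<in>{..<m}. \<xi> i \<noteq> t i}. w (\<xi> i)) = sum w (\<xi> ` {i\<in>{..<m}. \<xi> i \<noteq> t i})"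
        by (simp only: sum.reindex comp_def)
      then show "(\<Sum>i\<in>{i\<in>{..<m}. \<xi> i \<noteq> t i}. w (\<xi> i)) \<le> 2 * \<eta>" using wsum by simp
    qed
    also have "\<eta> * (b - a) + (2 * \<eta> + 2 * \<eta>) < \<eta> * (b - a + 5)"
      using \<eta> by (simp add: algebra_simps)
    also have "\<dots> = e" using ab by (simp add: \<eta>_def)
    finally show "(\<Sum>i<m. norm (\<Theta> (\<xi> i) (t i) (t (Suc i)))) < e" by simp
  qed
qed

section \<open>Step mappings and transfinite sums\<close>

text \<open>What is kept of \<Lambda>_\<epsilon>: every point of [a, b) lies in a step that leads
  from an element to its successor.\<close>

locale step_partition =
  fixes a b :: real and \<Lambda> :: "real set"
  assumes ab: "a < b" and sub: "\<Lambda> \<subseteq> {a..b}" and a_mem: "a \<in> \<Lambda>" and b_mem: "b \<in> \<Lambda>"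
    and cover: "x \<in> {a..<b} \<Longrightarrow> \<exists>\<beta>\<in>\<Lambda>. \<exists>\<gamma>. is_succ \<Lambda> \<beta> \<gamma> \<and> \<beta> \<le> x \<and> x < \<gamma>"
begin

text \<open>\<open>cover\<close> at \<beta> gives a step [\<beta>', \<gamma>) containing \<beta>; if
  \<beta>' < \<beta>, then the successor \<gamma> of \<beta>' would be at most \<beta>.\<close>

lemma is_succ_Succ:
  assumes "\<beta> \<in> \<Lambda>" "\<beta> < b"
  shows "is_succ \<Lambda> \<beta> (Succ \<Lambda> \<beta>)"
proof -
  have "\<beta> \<in> {a..<b}" using assms sub by auto
  then obtain \<beta>' \<gamma> where s: "\<beta>' \<in> \<Lambda>" "is_succ \<Lambda> \<beta>' \<gamma>" "\<beta>' \<le> \<beta>" "\<beta> < \<gamma>"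
    using cover by blast
  then have "\<beta>' = \<beta>" using assms(1) unfolding is_succ_def by force
  then show ?thesis using s(2) Succ_eq by metis
qed

lemma Succ_mem: "\<beta> \<in> \<Lambda> \<Longrightarrow> \<beta> < b \<Longrightarrow> Succ \<Lambda> \<beta> \<in> \<Lambda>"
  and Succ_greater: "\<beta> \<in> \<Lambda> \<Longrightarrow> \<beta> < b \<Longrightarrow> \<beta> < Succ \<Lambda> \<beta>"
  using is_succ_Succ by (simp_all add: is_succ_def)

lemma Succ_le:
  assumes "\<beta> \<in> \<Lambda>" "\<gamma> \<in> \<Lambda>" "\<beta> < \<gamma>"
  shows "Succ \<Lambda> \<beta> \<le> \<gamma>"
proof -
  have "\<beta> < b" using assms sub by force
  then show ?thesis using is_succ_Succ[OF assms(1)] assms by (simp add: is_succ_def)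
qed

lemma Succ_le_b: "\<beta> \<in> \<Lambda> \<Longrightarrow> \<beta> < b \<Longrightarrow> Succ \<Lambda> \<beta> \<le> b"
  using Succ_mem sub by force

text \<open>Phrased exactly as the description inside \<^const>\<open>A_eps\<close>.\<close>

definition base :: "real \<Rightarrow> real"
  where "base x = (THE \<beta>. \<beta> \<in> below \<Lambda> b \<and> x \<in> {\<beta>..<Succ \<Lambda> \<beta>})"

lemma base_eq:
  assumes "\<beta> \<in> \<Lambda>" "\<beta> < b" "\<beta> \<le> x" "x < Succ \<Lambda> \<beta>"
  shows "base x = \<beta>"
  unfolding base_def
proof (rule the_equality)
  show "\<beta> \<in> below \<Lambda> b \<and> x \<in> {\<beta>..<Succ \<Lambda> \<beta>}" using assms by (simp add: below_def)
  fix \<beta>' assume "\<beta>' \<in> below \<Lambda> b \<and> x \<in> {\<beta>'..<Succ \<Lambda> \<beta>'}"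
  then have "\<beta>' \<in> \<Lambda>" "\<beta>' \<le> x" "x < Succ \<Lambda> \<beta>'" by (auto simp: below_def)
  then show "\<beta>' = \<beta>"
    using Succ_le[of \<beta> \<beta>'] Succ_le[of \<beta>' \<beta>] assms by (cases \<beta> \<beta>' rule: linorder_cases) auto
qed

lemma base:
  assumes "x \<in> {a..<b}"
  shows "base x \<in> \<Lambda>" "base x < b" "base x \<le> x" "x < Succ \<Lambda> (base x)"
proof -
  obtain \<beta> \<gamma> where s: "\<beta> \<in> \<Lambda>" "is_succ \<Lambda> \<beta> \<gamma>" "\<beta> \<le> x" "x < \<gamma>"
    using cover[OF assms] by blast
  have "\<beta> < b" using s(3) assms by simp
  moreover have "Succ \<Lambda> \<beta> = \<gamma>" using s(2) by (rule Succ_eq)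
  ultimately have "base x = \<beta>" using s by (intro base_eq) auto
  then show "base x \<in> \<Lambda>" "base x < b" "base x \<le> x" "x < Succ \<Lambda> (base x)"
    using s \<open>\<beta> < b\<close> \<open>Succ \<Lambda> \<beta> = \<gamma>\<close> by auto
qed

lemma base_mem: "\<beta> \<in> \<Lambda> \<Longrightarrow> \<beta> < b \<Longrightarrow> base \<beta> = \<beta>"
  using Succ_greater by (intro base_eq) auto

text \<open>Every step contains a rational number, and \<open>base\<close> recovers the step from
  it.\<close>

lemma countable_steps: "countable \<Lambda>"
proof -
  have "\<Lambda> \<subseteq> insert b (base ` \<rat>)"
  proof
    fix \<beta> assume \<beta>: "\<beta> \<in> \<Lambda>"
    show "\<beta> \<in> insert b (base ` \<rat>)"
    proof (cases "\<beta> = b")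
      case False
      then have "\<beta> < b" using \<beta> sub by force
      obtain q where q: "q \<in> \<rat>" "\<beta> < q" "q < Succ \<Lambda> \<beta>"
        using Rats_dense_in_real[OF Succ_greater[OF \<beta> \<open>\<beta> < b\<close>]] by blast
      then have "base q = \<beta>" using \<beta> \<open>\<beta> < b\<close> by (intro base_eq) auto
      then show ?thesis using q by blast
    qed simp
  qed
  then show ?thesis by (rule countable_subset) (simp add: countable_rat)
qed

lemma limit_element_iff:
  "limit_element \<Lambda> \<gamma> \<longleftrightarrow> \<gamma> \<in> \<Lambda> \<and> \<gamma> \<noteq> a \<and> (\<forall>\<beta>\<in>\<Lambda>. \<beta> < b \<longrightarrow> Succ \<Lambda> \<beta> \<noteq> \<gamma>)"
proof -
  have "is_min \<Lambda> \<gamma> \<longleftrightarrow> \<gamma> = a" using a_mem sub by (fastforce simp: is_min_def)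
  moreover have "is_succ \<Lambda> \<beta> \<gamma> \<longleftrightarrow> \<beta> < b \<and> Succ \<Lambda> \<beta> = \<gamma>" if "\<beta> \<in> \<Lambda>" for \<beta>
  proof
    assume s: "is_succ \<Lambda> \<beta> \<gamma>"
    then have "\<beta> < \<gamma>" "\<gamma> \<le> b" using sub by (auto simp: is_succ_def)
    then show "\<beta> < b \<and> Succ \<Lambda> \<beta> = \<gamma>" using Succ_eq[OF s] by simp
  next
    assume "\<beta> < b \<and> Succ \<Lambda> \<beta> = \<gamma>"
    then show "is_succ \<Lambda> \<beta> \<gamma>" using is_succ_Succ[OF that] by simp
  qed
  ultimately show ?thesis unfolding limit_element_def by blast
qed

text \<open>The step containing y ends at or before \<gamma>, and not at \<gamma>, which is no
  successor; its end is the desired element.\<close>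

lemma limit_element_approx:
  assumes "limit_element \<Lambda> \<gamma>" "y < \<gamma>"
  shows "\<exists>\<beta>\<in>\<Lambda>. y < \<beta> \<and> \<beta> < \<gamma>"
proof -
  have \<gamma>: "\<gamma> \<in> \<Lambda>" "\<gamma> \<noteq> a" "\<And>\<beta>. \<beta> \<in> \<Lambda> \<Longrightarrow> \<beta> < b \<Longrightarrow> Succ \<Lambda> \<beta> \<noteq> \<gamma>"
    using assms(1) by (auto simp: limit_element_iff)
  then have "a < \<gamma>" "\<gamma> \<le> b" using sub by force+
  define y' where "y' = max a y"
  have y': "y' \<in> {a..<b}" "y' < \<gamma>" "y \<le> y'"
    using \<open>a < \<gamma>\<close> \<open>\<gamma> \<le> b\<close> assms(2) by (auto simp: y'_def)
  note base = base[OF y'(1)]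
  have "Succ \<Lambda> (base y') \<le> \<gamma>" using base y' \<gamma> by (intro Succ_le) auto
  moreover have "Succ \<Lambda> (base y') \<noteq> \<gamma>" using base \<gamma> by blast
  ultimately show ?thesis using base y' Succ_mem by (intro bexI[of _ "Succ \<Lambda> (base y')"]) auto
qed

section \<open>Transfinite sums and primitives of step mappings\<close>

text \<open>Here \<sigma> is constrained on all of \<Lambda>, with the total sum at b, so that it
  can be read as the values of a primitive whether or not b is a limit element.\<close>

definition step_sums :: "(real \<Rightarrow> 'e::real_normed_vector) \<Rightarrow> (real \<Rightarrow> 'e) \<Rightarrow> bool"
  where "step_sums c \<sigma> \<longleftrightarrow> \<sigma> a = 0 \<and>
    (\<forall>\<beta>\<in>\<Lambda>. \<beta> < b \<longrightarrow> \<sigma> (Succ \<Lambda> \<beta>) = (Succ \<Lambda> \<beta> - \<beta>) *\<^sub>R c \<beta> + \<sigma> \<beta>) \<and>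
    (\<forall>\<gamma>. limit_element \<Lambda> \<gamma> \<longrightarrow> (\<forall>\<eta>>0. \<exists>\<beta>0\<in>\<Lambda>. \<beta>0 < \<gamma> \<and>
      (\<forall>\<beta>\<in>\<Lambda>. \<beta>0 \<le> \<beta> \<and> \<beta> < \<gamma> \<longrightarrow> norm (\<sigma> \<beta> - \<sigma> \<gamma>) < \<eta>)))"

text \<open>On a step the integrand is constant, so the mean value inequality with error 0 gives the
  exact increment; at limit elements the sums converge by continuity of \<open>F\<close>.\<close>

lemma step_sums_if_primitive:
  assumes F: "primitive a b (\<lambda>x. c (base x)) F"
  shows "step_sums c (\<lambda>\<gamma>. F \<gamma> - F a)"
  unfolding step_sums_def
proof (intro conjI ballI allI impI)
  fix \<beta> assume \<beta>: "\<beta> \<in> \<Lambda>" "\<beta> < b"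
  have "norm (F (Succ \<Lambda> \<beta>) - F \<beta> - (Succ \<Lambda> \<beta> - \<beta>) *\<^sub>R c \<beta>) \<le> 0 * (Succ \<Lambda> \<beta> - \<beta>)"
  proof (rule primitive_approx)
    show "primitive \<beta> (Succ \<Lambda> \<beta>) (\<lambda>x. c (base x)) F"
      using F by (rule primitive_subset) (use \<beta> sub Succ_le_b in auto)
    show "norm (c (base x) - c \<beta>) \<le> 0" if "x \<in> {\<beta>..<Succ \<Lambda> \<beta>}" for x
      using base_eq[of \<beta> x] that \<beta> by simp
  qed (use Succ_greater[OF \<beta>] in simp)
  then show "F (Succ \<Lambda> \<beta>) - F a = (Succ \<Lambda> \<beta> - \<beta>) *\<^sub>R c \<beta> + (F \<beta> - F a)"
    by (simp add: algebra_simps)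
next
  fix \<gamma> and \<eta> :: real assume \<gamma>: "limit_element \<Lambda> \<gamma>" and \<eta>: "\<eta> > 0"
  then have \<gamma>_mem: "\<gamma> \<in> \<Lambda>" by (simp add: limit_element_def)
  then have "\<gamma> \<in> {a..b}" using sub by blast
  then obtain d where d: "d > 0" "\<And>y. y \<in> {a..b} \<Longrightarrow> dist y \<gamma> < d \<Longrightarrow> dist (F y) (F \<gamma>) < \<eta>"
    using F \<eta> unfolding primitive_def continuous_on_iff by metis
  obtain \<beta>0 where \<beta>0: "\<beta>0 \<in> \<Lambda>" "\<gamma> - d < \<beta>0" "\<beta>0 < \<gamma>"
    using limit_element_approx[OF \<gamma>, of "\<gamma> - d"] d(1) by auto
  show "\<exists>\<beta>0\<in>\<Lambda>. \<beta>0 < \<gamma> \<and> (\<forall>\<beta>\<in>\<Lambda>. \<beta>0 \<le> \<beta> \<and> \<beta> < \<gamma> \<longrightarrow> norm (F \<beta> - F a - (F \<gamma> - F a)) < \<eta>)"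
  proof (intro bexI[of _ \<beta>0] conjI ballI impI)
    fix \<beta> assume \<beta>: "\<beta> \<in> \<Lambda>" "\<beta>0 \<le> \<beta> \<and> \<beta> < \<gamma>"
    then have "dist (F \<beta>) (F \<gamma>) < \<eta>" using \<beta>0 sub by (intro d(2)) (auto simp: dist_real_def)
    then show "norm (F \<beta> - F a - (F \<gamma> - F a)) < \<eta>" by (simp add: dist_norm)
  qed (use \<beta>0 in auto)
qed simp

text \<open>Linear interpolation of \<sigma>. Right derivatives are immediate because every point
  has an affine piece to its right; convergence of the sums is used for continuity from the left at
  limit elements.\<close>

lemma primitive_if_step_sums:
  assumes \<sigma>: "step_sums c \<sigma>"
  shows "\<exists>F. primitive a b (\<lambda>x. c (base x)) F"
proof
  define F where "F t = (if t < b then \<sigma> (base t) + (t - base t) *\<^sub>R c (base t) else \<sigma> b)" for t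
  have succ: "\<sigma> (Succ \<Lambda> \<beta>) = (Succ \<Lambda> \<beta> - \<beta>) *\<^sub>R c \<beta> + \<sigma> \<beta>" if "\<beta> \<in> \<Lambda>" "\<beta> < b" for \<beta>
    using \<sigma> that unfolding step_sums_def by blast
  have F_mem: "F \<gamma> = \<sigma> \<gamma>" if "\<gamma> \<in> \<Lambda>" for \<gamma>
    using base_mem[OF that] that sub unfolding F_def by force
  have F_step: "F t = \<sigma> \<beta> + (t - \<beta>) *\<^sub>R c \<beta>"
    if "\<beta> \<in> \<Lambda>" "\<beta> < b" "\<beta> \<le> t" "t \<le> Succ \<Lambda> \<beta>" for \<beta> t
  proof (cases "t = Succ \<Lambda> \<beta>")
    case True
    then show ?thesis using F_mem[OF Succ_mem] succ that by simp
  next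
    case False
    then have "base t = \<beta>" "t < b" using base_eq that Succ_le_b[of \<beta>] by auto
    then show ?thesis by (simp add: F_def)
  qed
  have deriv: "(F has_vector_derivative c (base x)) (at_right x)" if x: "x \<in> {a..<b}" for x
    unfolding has_vector_derivative_at_right_iff_eps
  proof (intro allI impI)
    fix e :: real assume e: "e > 0"
    note bx = base[OF x]
    show "\<exists>h>0. \<forall>y. x < y \<and> y < x + h \<longrightarrow> norm (F y - F x - (y - x) *\<^sub>R c (base x)) \<le> e * (y - x)"
    proof (intro exI[of _ "Succ \<Lambda> (base x) - x"] conjI allI impI)
      fix y assume y: "x < y \<and> y < x + (Succ \<Lambda> (base x) - x)"
      have "F y - F x - (y - x) *\<^sub>R c (base x) = 0"
        using F_step[OF bx(1,2), of x] F_step[OF bx(1,2), of y] bx y by (simp add: scaleR_diff_left)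
      then show "norm (F y - F x - (y - x) *\<^sub>R c (base x)) \<le> e * (y - x)" using e y by simp
    qed (use bx in auto)
  qed
  have right: "(F \<longlongrightarrow> F x) (at_right x)" if x: "x \<in> {a..<b}" for x
    using has_vector_derivative_continuous[OF deriv[OF x]] by (simp add: continuous_within)
  have left: "(F \<longlongrightarrow> F x) (at_left x)" if x: "x \<in> {a<..b}" for x
  proof (cases "\<exists>\<beta>\<in>\<Lambda>. \<beta> < x \<and> x \<le> Succ \<Lambda> \<beta>")
    case True
    then obtain \<beta> where \<beta>: "\<beta> \<in> \<Lambda>" "\<beta> < x" "x \<le> Succ \<Lambda> \<beta>" by blast
    then have Fb: "F t = \<sigma> \<beta> + (t - \<beta>) *\<^sub>R c \<beta>" if "\<beta> \<le> t" "t \<le> x" for t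
      using F_step[of \<beta> t] that x by auto
    have "((\<lambda>t. \<sigma> \<beta> + (t - \<beta>) *\<^sub>R c \<beta>) \<longlongrightarrow> F x) (at_left x)"
      using Fb[of x] \<beta>(2) by (auto intro!: tendsto_eq_intros)
    moreover have "eventually (\<lambda>t. \<sigma> \<beta> + (t - \<beta>) *\<^sub>R c \<beta> = F t) (at_left x)"
      by (rule eventually_at_leftI[of \<beta>]) (use \<beta> Fb in auto)
    ultimately show ?thesis by (simp only: tendsto_cong)
  next
    case False
    \<comment> \<open>No step reaches x from the left, so x is an element of \<Lambda> and neither a
      successor nor the minimum.\<close>
    have x_mem: "x \<in> \<Lambda>"
    proof (rule ccontr)
      assume "x \<notin> \<Lambda>"
      then have "x \<in> {a..<b}" using b_mem x by (cases "x = b") auto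
      then have "base x \<in> \<Lambda>" "base x < x" "x \<le> Succ \<Lambda> (base x)"
        using base[of x] \<open>x \<notin> \<Lambda>\<close> by (auto simp: less_le)
      then show False using False by blast
    qed
    have lim: "limit_element \<Lambda> x"
      unfolding limit_element_iff using x_mem x False Succ_greater by auto
    show ?thesis
    proof (rule tendstoI)
      fix \<eta> :: real assume "\<eta> > 0"
      then obtain \<beta>0 where \<beta>0: "\<beta>0 \<in> \<Lambda>" "\<beta>0 < x"
        "\<And>\<beta>. \<beta> \<in> \<Lambda> \<Longrightarrow> \<beta>0 \<le> \<beta> \<Longrightarrow> \<beta> < x \<Longrightarrow> norm (\<sigma> \<beta> - \<sigma> x) < \<eta>"
        using \<sigma> lim unfolding step_sums_def by blast
      show "eventually (\<lambda>t. dist (F t) (F x) < \<eta>) (at_left x)"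
      proof (rule eventually_at_leftI[of \<beta>0])
        fix t assume t: "t \<in> {\<beta>0<..<x}"
        then have tab: "t \<in> {a..<b}" using \<beta>0(1) sub x by force
        define \<beta> where "\<beta> = base t"
        note bt = base[OF tab, folded \<beta>_def]
        have "\<beta>0 \<le> \<beta>" using Succ_le[OF bt(1) \<beta>0(1)] bt t by force
        have "Succ \<Lambda> \<beta> < x" using False bt t by force
        \<comment> \<open>On its step \<open>F\<close> is a convex combination of the sums at both
          ends, and these lie in the ball around \<open>\<sigma> x\<close>. Convexity of the ball
          replaces an estimate of the slopes, which may be unbounded near x.\<close>
        define u where "u = (t - \<beta>) / (Succ \<Lambda> \<beta> - \<beta>)"
        have u: "0 \<le> u" "u \<le> 1" "u * (Succ \<Lambda> \<beta> - \<beta>) = t - \<beta>" using bt by (auto simp: u_def)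
        have "F t = \<sigma> \<beta> + u *\<^sub>R (\<sigma> (Succ \<Lambda> \<beta>) - \<sigma> \<beta>)"
          using F_step[OF bt(1,2), of t] bt succ[OF bt(1,2)] u(3) by simp
        also have "\<dots> = (1 - u) *\<^sub>R \<sigma> \<beta> + u *\<^sub>R \<sigma> (Succ \<Lambda> \<beta>)"
          by (simp add: algebra_simps)
        also have "\<dots> \<in> ball (\<sigma> x) \<eta>"
          using \<beta>0(3)[of \<beta>] \<beta>0(3)[OF Succ_mem[OF bt(1,2)]] bt \<open>\<beta>0 \<le> \<beta>\<close> \<open>Succ \<Lambda> \<beta> < x\<close> t u
          by (intro convexD_alt[OF convex_ball]) (auto simp: dist_norm norm_minus_commute)
        finally show "dist (F t) (F x) < \<eta>" using F_mem[OF x_mem] by (simp add: dist_commute)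
      qed (use \<beta>0 in auto)
    qed
  qed
  show "primitive a b (\<lambda>x. c (base x)) F"
    unfolding primitive_def
  proof (intro conjI ballI deriv)
    show "continuous_on {a..b} F"
      by (rule continuous_on_IccI) (use ab left right in \<open>auto intro!: filterlim_split_at\<close>)
  qed
qed

text \<open>Remove the largest index \<alpha>: the earlier steps fit below \<alpha>, and the step of
  \<alpha> ends at or before \<gamma>.\<close>

lemma sum_lengths_le:
  assumes "finite J" "J \<subseteq> {\<alpha> \<in> \<Lambda>. \<beta> \<le> \<alpha> \<and> \<alpha> < \<gamma>}" "\<gamma> \<in> \<Lambda>" "\<beta> \<le> \<gamma>"
  shows "(\<Sum>\<alpha>\<in>J. Succ \<Lambda> \<alpha> - \<alpha>) \<le> \<gamma> - \<beta>"
  using assms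
proof (induction J arbitrary: \<gamma> rule: finite_linorder_max_induct)
  case (insert \<alpha> J)
  have "(\<Sum>\<alpha>\<in>J. Succ \<Lambda> \<alpha> - \<alpha>) \<le> \<alpha> - \<beta>" by (rule insert.IH) (use insert.hyps insert.prems in auto)
  moreover have "Succ \<Lambda> \<alpha> \<le> \<gamma>" using insert.prems by (intro Succ_le) auto
  moreover have "\<alpha> \<notin> J" using insert.hyps by blast
  ultimately show ?case using insert.hyps by simp
qed simp

text \<open>With bounded slopes the family is absolutely summable, because the steps starting in
  [\<beta>, \<gamma>) have total length at most \<gamma> - \<beta>. Unordered sums over initial
  segments then satisfy the recursion, and the same estimate for a tail gives the limit
  condition.\<close>

lemma step_sums_bounded:
  fixes c :: "real \<Rightarrow> 'e::banach"
  assumes c: "\<And>\<beta>. \<beta> \<in> \<Lambda> \<Longrightarrow> \<beta> < b \<Longrightarrow> norm (c \<beta>) \<le> M"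
  shows "\<exists>\<sigma>. step_sums c \<sigma>"
proof
  define x where "x \<alpha> = (Succ \<Lambda> \<alpha> - \<alpha>) *\<^sub>R c \<alpha>" for \<alpha>
  define I where "I \<beta> \<gamma> = {\<alpha>\<in>\<Lambda>. \<beta> \<le> \<alpha> \<and> \<alpha> < \<gamma>}" for \<beta> \<gamma>
  define \<sigma> where "\<sigma> \<gamma> = infsum x (I a \<gamma>)" for \<gamma>
  have M: "M \<ge> 0" using c[OF a_mem ab] norm_ge_zero[of "c a"] by linarith
  have finite_bound: "(\<Sum>\<alpha>\<in>J. norm (x \<alpha>)) \<le> M * (\<gamma> - \<beta>)"
    if "finite J" "J \<subseteq> I \<beta> \<gamma>" "\<gamma> \<in> \<Lambda>" "\<beta> \<le> \<gamma>" for J \<beta> \<gamma>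
  proof -
    have "(\<Sum>\<alpha>\<in>J. norm (x \<alpha>)) \<le> (\<Sum>\<alpha>\<in>J. M * (Succ \<Lambda> \<alpha> - \<alpha>))"
    proof (rule sum_mono)
      fix \<alpha> assume "\<alpha> \<in> J"
      then have \<alpha>: "\<alpha> \<in> \<Lambda>" "\<alpha> < b" using that sub unfolding I_def by force+
      have "norm (x \<alpha>) = (Succ \<Lambda> \<alpha> - \<alpha>) * norm (c \<alpha>)"
        using Succ_greater[OF \<alpha>] by (simp add: x_def)
      also have "\<dots> \<le> (Succ \<Lambda> \<alpha> - \<alpha>) * M"
        using Succ_greater[OF \<alpha>] c[OF \<alpha>] by (intro mult_left_mono) auto
      finally show "norm (x \<alpha>) \<le> M * (Succ \<Lambda> \<alpha> - \<alpha>)" by (simp add: mult.commute)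
    qed
    also have "\<dots> \<le> M * (\<gamma> - \<beta>)"
      using sum_lengths_le[of J \<beta> \<gamma>] that M
      by (simp add: I_def mult_left_mono flip: sum_distrib_left)
    finally show ?thesis .
  qed
  have abs: "(\<lambda>\<alpha>. norm (x \<alpha>)) summable_on I \<beta> \<gamma>" if "\<gamma> \<in> \<Lambda>" "\<beta> \<le> \<gamma>" for \<beta> \<gamma>
  proof (rule nonneg_bdd_above_summable_on)
    show "bdd_above (sum (\<lambda>\<alpha>. norm (x \<alpha>)) ` {F. F \<subseteq> I \<beta> \<gamma> \<and> finite F})"
      by (rule bdd_aboveI2[of _ _ "M * (\<gamma> - \<beta>)"]) (use finite_bound that in auto)
  qed simp
  have bound: "norm (infsum x (I \<beta> \<gamma>)) \<le> M * (\<gamma> - \<beta>)" if "\<gamma> \<in> \<Lambda>" "\<beta> \<le> \<gamma>" for \<beta> \<gamma>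
  proof -
    have "norm (infsum x (I \<beta> \<gamma>)) \<le> infsum (\<lambda>\<alpha>. norm (x \<alpha>)) (I \<beta> \<gamma>)"
      by (rule norm_infsum_bound[OF abs[OF that]])
    also have "\<dots> \<le> M * (\<gamma> - \<beta>)"
      by (rule infsum_le_finite_sums[OF abs[OF that]]) (use finite_bound that in auto)
    finally show ?thesis .
  qed
  have split: "\<sigma> \<gamma> = \<sigma> \<beta> + infsum x (I \<beta> \<gamma>)" if "\<beta> \<in> \<Lambda>" "\<gamma> \<in> \<Lambda>" "\<beta> \<le> \<gamma>" for \<beta> \<gamma>
  proof -
    have "I a \<gamma> = I a \<beta> \<union> I \<beta> \<gamma>" "I a \<beta> \<inter> I \<beta> \<gamma> = {}"
      using that sub by (auto simp: I_def)
    moreover have "a \<le> \<beta>" using that sub by auto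
    ultimately show ?thesis
      unfolding \<sigma>_def using that abs
      by (simp add: infsum_Un_disjoint abs_summable_summable)
  qed
  show "step_sums c \<sigma>"
    unfolding step_sums_def
  proof (intro conjI ballI allI impI)
    have "I a a = {}" by (auto simp: I_def)
    then show "\<sigma> a = 0" by (simp add: \<sigma>_def)
  next
    fix \<beta> assume \<beta>: "\<beta> \<in> \<Lambda>" "\<beta> < b"
    have "I \<beta> (Succ \<Lambda> \<beta>) = {\<beta>}"
      using Succ_le[OF \<beta>(1)] Succ_greater[OF \<beta>] \<beta> by (force simp: I_def)
    then show "\<sigma> (Succ \<Lambda> \<beta>) = (Succ \<Lambda> \<beta> - \<beta>) *\<^sub>R c \<beta> + \<sigma> \<beta>"
      using split[OF \<beta>(1) Succ_mem[OF \<beta>]] Succ_greater[OF \<beta>] by (simp add: x_def)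
  next
    fix \<gamma> and \<eta> :: real assume \<gamma>: "limit_element \<Lambda> \<gamma>" and \<eta>: "\<eta> > 0"
    then have \<gamma>_mem: "\<gamma> \<in> \<Lambda>" by (simp add: limit_element_def)
    \<comment> \<open>M may be 0, so the quotient is taken with M + 1.\<close>
    obtain \<beta>0 where \<beta>0: "\<beta>0 \<in> \<Lambda>" "\<gamma> - \<eta> / (M + 1) < \<beta>0" "\<beta>0 < \<gamma>"
      using limit_element_approx[OF \<gamma>, of "\<gamma> - \<eta> / (M + 1)"] \<eta> M by auto
    show "\<exists>\<beta>0\<in>\<Lambda>. \<beta>0 < \<gamma> \<and> (\<forall>\<beta>\<in>\<Lambda>. \<beta>0 \<le> \<beta> \<and> \<beta> < \<gamma> \<longrightarrow> norm (\<sigma> \<beta> - \<sigma> \<gamma>) < \<eta>)"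
    proof (intro bexI[of _ \<beta>0] conjI ballI impI)
      fix \<beta> assume \<beta>: "\<beta> \<in> \<Lambda>" "\<beta>0 \<le> \<beta> \<and> \<beta> < \<gamma>"
      have "norm (\<sigma> \<beta> - \<sigma> \<gamma>) \<le> M * (\<gamma> - \<beta>)"
        using split[OF \<beta>(1) \<gamma>_mem] bound[OF \<gamma>_mem, of \<beta>] \<beta> by simp
      also have "\<dots> \<le> (M + 1) * (\<gamma> - \<beta>)" using \<beta> by (simp add: mult_right_mono)
      also have "\<dots> < \<eta>"
      proof -
        have "\<gamma> - \<beta> < \<eta> / (M + 1)" using \<beta> \<beta>0 by linarith
        then show ?thesis using M by (simp add: pos_less_divide_eq mult.commute)
      qed
      finally show "norm (\<sigma> \<beta> - \<sigma> \<gamma>) < \<eta>" .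
    qed (use \<beta>0 in auto)
  qed
qed

text \<open>
  If \<open>b\<close> is a successor, then \<open>Sup (below \<Lambda> b)\<close> is the predecessor of \<open>b\<close> and not \<open>b\<close> itself,
  so that \<^const>\<open>wo_summable\<close> says nothing about \<open>\<sigma> b\<close>, which then has to be supplied.
\<close>

lemma wo_summable_iff_step_sums:
  fixes c :: "real \<Rightarrow> 'e::real_normed_vector"
  shows "wo_summable (below \<Lambda> b) (\<lambda>\<beta>. (Succ \<Lambda> \<beta> - \<beta>) *\<^sub>R c \<beta>) \<longleftrightarrow> (\<exists>\<sigma>. step_sums c \<sigma>)"
proof -
  define x where "x \<beta> = (Succ \<Lambda> \<beta> - \<beta>) *\<^sub>R c \<beta>" for \<beta>
  have min: "is_min (below \<Lambda> b) \<gamma> \<longleftrightarrow> \<gamma> = a" for \<gamma>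
    using a_mem ab sub by (fastforce simp: is_min_def below_def)
  have below_below: "below (below \<Lambda> b) \<gamma> = {\<beta>\<in>\<Lambda>. \<beta> < \<gamma>}"
    "below \<Lambda> b \<inter> {\<beta>0..<\<gamma>} = {\<beta>\<in>\<Lambda>. \<beta>0 \<le> \<beta> \<and> \<beta> < \<gamma>}" if "\<gamma> \<in> \<Lambda>" for \<beta>0 \<gamma>
    using that sub by (force simp: below_def)+
  have succ_iff: "is_succ \<Lambda> \<beta> \<gamma> \<longleftrightarrow> \<gamma> = Succ \<Lambda> \<beta>" if "\<beta> \<in> below \<Lambda> b" for \<beta> \<gamma>
    using that is_succ_Succ[of \<beta>] Succ_eq[of \<Lambda> \<beta> \<gamma>] by (auto simp: below_def)
  define K where "K = insert (Sup (below \<Lambda> b)) (below \<Lambda> b)"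
  have wo: "wo_summable (below \<Lambda> b) x \<longleftrightarrow> (\<exists>\<sigma>. \<sigma> a = 0 \<and>
      (\<forall>\<beta>\<in>below \<Lambda> b. \<forall>\<gamma>. is_succ K \<beta> \<gamma> \<longrightarrow> \<sigma> \<gamma> = x \<beta> + \<sigma> \<beta>) \<and>
      (\<forall>\<gamma>. limit_element K \<gamma> \<longrightarrow> (\<forall>\<eta>>0. \<exists>\<beta>0\<in>below (below \<Lambda> b) \<gamma>.
        \<forall>\<beta>\<in>below \<Lambda> b \<inter> {\<beta>0..<\<gamma>}. norm (\<sigma> \<beta> - \<sigma> \<gamma>) < \<eta>)))"
    unfolding wo_summable_def K_def[symmetric] min by simp
  have lim_eq: "(\<forall>\<eta>>0. \<exists>\<beta>0\<in>below (below \<Lambda> b) \<gamma>.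
        \<forall>\<beta>\<in>below \<Lambda> b \<inter> {\<beta>0..<\<gamma>}. norm (\<sigma> \<beta> - \<sigma> \<gamma>) < \<eta>) \<longleftrightarrow>
      (\<forall>\<eta>>0. \<exists>\<beta>0\<in>\<Lambda>. \<beta>0 < \<gamma> \<and>
        (\<forall>\<beta>\<in>\<Lambda>. \<beta>0 \<le> \<beta> \<and> \<beta> < \<gamma> \<longrightarrow> norm (\<sigma> \<beta> - \<sigma> \<gamma>) < \<eta>))"
    if "\<gamma> \<in> \<Lambda>" for \<gamma> and \<sigma> :: "real \<Rightarrow> 'e"
    unfolding below_below[OF that] Bex_def Ball_def mem_Collect_eq
    by (simp only: conj_assoc imp_conjL)
  have lim_all_eq: "(\<forall>\<gamma>. limit_element \<Lambda> \<gamma> \<longrightarrow> (\<forall>\<eta>>0. \<exists>\<beta>0\<in>below (below \<Lambda> b) \<gamma>.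
        \<forall>\<beta>\<in>below \<Lambda> b \<inter> {\<beta>0..<\<gamma>}. norm (\<sigma> \<beta> - \<sigma> \<gamma>) < \<eta>)) \<longleftrightarrow>
      (\<forall>\<gamma>. limit_element \<Lambda> \<gamma> \<longrightarrow> (\<forall>\<eta>>0. \<exists>\<beta>0\<in>\<Lambda>. \<beta>0 < \<gamma> \<and>
        (\<forall>\<beta>\<in>\<Lambda>. \<beta>0 \<le> \<beta> \<and> \<beta> < \<gamma> \<longrightarrow> norm (\<sigma> \<beta> - \<sigma> \<gamma>) < \<eta>)))" for \<sigma> :: "real \<Rightarrow> 'e"
    by (intro all_cong1 imp_cong refl lim_eq) (simp add: limit_element_def)
  show ?thesis
  proof (cases "limit_element \<Lambda> b")
    case True
    have "Sup (below \<Lambda> b) = b"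
    proof (rule cSup_eq_non_empty)
      show "below \<Lambda> b \<noteq> {}" using a_mem ab by (auto simp: below_def)
      show "b \<le> y" if "\<And>x. x \<in> below \<Lambda> b \<Longrightarrow> x \<le> y" for y
        using limit_element_approx[OF True, of y] that by (force simp: below_def)
    qed (auto simp: below_def)
    \<comment> \<open>A limit b is recovered as the supremum, so both notions refer to the same
      index set.\<close>
    then have K: "K = \<Lambda>" using b_mem sub by (force simp: K_def below_def)
    have "step_sums c \<sigma> \<longleftrightarrow> \<sigma> a = 0 \<and>
      (\<forall>\<beta>\<in>below \<Lambda> b. \<forall>\<gamma>. is_succ K \<beta> \<gamma> \<longrightarrow> \<sigma> \<gamma> = x \<beta> + \<sigma> \<beta>) \<and>
      (\<forall>\<gamma>. limit_element K \<gamma> \<longrightarrow> (\<forall>\<eta>>0. \<exists>\<beta>0\<in>below (below \<Lambda> b) \<gamma>.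
        \<forall>\<beta>\<in>below \<Lambda> b \<inter> {\<beta>0..<\<gamma>}. norm (\<sigma> \<beta> - \<sigma> \<gamma>) < \<eta>))" for \<sigma>
      unfolding step_sums_def K lim_all_eq
      by (intro conj_cong refl) (auto simp: succ_iff x_def below_def)
    then show ?thesis using wo unfolding x_def by simp
  next
    case False
    then obtain \<beta>1 where \<beta>1: "\<beta>1 \<in> \<Lambda>" "\<beta>1 < b" "Succ \<Lambda> \<beta>1 = b"
      using b_mem ab by (auto simp: limit_element_iff)
    have "\<beta> \<le> \<beta>1" if "\<beta> \<in> \<Lambda>" "\<beta> < b" for \<beta>
      using Succ_le[OF \<beta>1(1) that(1)] \<beta>1(3) that(2) by force
    then have "Sup (below \<Lambda> b) = \<beta>1"
      using \<beta>1 by (intro cSup_eq_maximum) (auto simp: below_def)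
    then have K: "K = below \<Lambda> b" using \<beta>1 by (auto simp: K_def below_def)
    have succ_K: "is_succ K \<beta> \<gamma> \<longleftrightarrow> \<gamma> = Succ \<Lambda> \<beta> \<and> \<gamma> < b" if "\<beta> \<in> below \<Lambda> b" for \<beta> \<gamma>
      unfolding succ_iff[OF that, symmetric] using that sub
      by (force simp: K is_succ_def below_def)
    have lim_K: "limit_element K \<gamma> \<longleftrightarrow> limit_element \<Lambda> \<gamma>" for \<gamma>
    proof -
      have "limit_element K \<gamma> \<longleftrightarrow> \<gamma> \<in> \<Lambda> \<and> \<gamma> < b \<and> \<gamma> \<noteq> a \<and> (\<forall>\<beta>\<in>below \<Lambda> b. Succ \<Lambda> \<beta> \<noteq> \<gamma>)"
        unfolding limit_element_def K[symmetric] using succ_K min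
        by (auto simp: K below_def)
      also have "\<dots> \<longleftrightarrow> limit_element \<Lambda> \<gamma>"
        unfolding limit_element_iff using \<beta>1 sub by (force simp: below_def)
      finally show ?thesis .
    qed
    \<comment> \<open>\<open>step_sums\<close> is the summability condition together with the
      recursion at b, whose predecessor is \<open>\<beta>1\<close>.\<close>
    have main: "step_sums c \<sigma> \<longleftrightarrow> \<sigma> b = x \<beta>1 + \<sigma> \<beta>1 \<and> \<sigma> a = 0 \<and>
      (\<forall>\<beta>\<in>below \<Lambda> b. \<forall>\<gamma>. is_succ K \<beta> \<gamma> \<longrightarrow> \<sigma> \<gamma> = x \<beta> + \<sigma> \<beta>) \<and>
      (\<forall>\<gamma>. limit_element K \<gamma> \<longrightarrow> (\<forall>\<eta>>0. \<exists>\<beta>0\<in>below (below \<Lambda> b) \<gamma>.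
        \<forall>\<beta>\<in>below \<Lambda> b \<inter> {\<beta>0..<\<gamma>}. norm (\<sigma> \<beta> - \<sigma> \<gamma>) < \<eta>))" for \<sigma>
    proof -
      have "(\<forall>\<beta>\<in>\<Lambda>. \<beta> < b \<longrightarrow> \<sigma> (Succ \<Lambda> \<beta>) = x \<beta> + \<sigma> \<beta>) \<longleftrightarrow> \<sigma> b = x \<beta>1 + \<sigma> \<beta>1 \<and>
        (\<forall>\<beta>\<in>below \<Lambda> b. \<forall>\<gamma>. is_succ K \<beta> \<gamma> \<longrightarrow> \<sigma> \<gamma> = x \<beta> + \<sigma> \<beta>)"
      proof (intro iffI conjI ballI allI impI)
        fix \<beta> assume H: "\<sigma> b = x \<beta>1 + \<sigma> \<beta>1 \<and>
          (\<forall>\<beta>\<in>below \<Lambda> b. \<forall>\<gamma>. is_succ K \<beta> \<gamma> \<longrightarrow> \<sigma> \<gamma> = x \<beta> + \<sigma> \<beta>)" and \<beta>: "\<beta> \<in> \<Lambda>" "\<beta> < b"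
        show "\<sigma> (Succ \<Lambda> \<beta>) = x \<beta> + \<sigma> \<beta>"
        proof (cases "Succ \<Lambda> \<beta> = b")
          case True
          then have "\<beta> = \<beta>1" using Succ_le[OF \<beta>(1) \<beta>1(1)] Succ_le[OF \<beta>1(1) \<beta>(1)] \<beta> \<beta>1
            by (cases \<beta> \<beta>1 rule: linorder_cases) auto
          then show ?thesis using H True by simp
        next
          case False
          then show ?thesis using H \<beta> succ_K[of \<beta>] Succ_le_b[OF \<beta>] by (auto simp: below_def)
        qed
      qed (use \<beta>1 succ_K in \<open>auto simp: below_def\<close>)
      moreover have "(\<forall>\<gamma>. limit_element \<Lambda> \<gamma> \<longrightarrow> (\<forall>\<eta>>0. \<exists>\<beta>0\<in>\<Lambda>. \<beta>0 < \<gamma> \<and>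
          (\<forall>\<beta>\<in>\<Lambda>. \<beta>0 \<le> \<beta> \<and> \<beta> < \<gamma> \<longrightarrow> norm (\<sigma> \<beta> - \<sigma> \<gamma>) < \<eta>))) \<longleftrightarrow>
        (\<forall>\<gamma>. limit_element K \<gamma> \<longrightarrow> (\<forall>\<eta>>0. \<exists>\<beta>0\<in>below (below \<Lambda> b) \<gamma>.
          \<forall>\<beta>\<in>below \<Lambda> b \<inter> {\<beta>0..<\<gamma>}. norm (\<sigma> \<beta> - \<sigma> \<gamma>) < \<eta>))"
        unfolding lim_K lim_all_eq ..
      ultimately show ?thesis unfolding step_sums_def x_def by blast
    qed
    show ?thesis
      unfolding x_def[symmetric] wo main
    proof (intro iffI; elim exE conjE)
      fix \<sigma> :: "real \<Rightarrow> 'e"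
      assume H: "\<sigma> a = 0" "\<forall>\<beta>\<in>below \<Lambda> b. \<forall>\<gamma>. is_succ K \<beta> \<gamma> \<longrightarrow> \<sigma> \<gamma> = x \<beta> + \<sigma> \<beta>"
        "\<forall>\<gamma>. limit_element K \<gamma> \<longrightarrow> (\<forall>\<eta>>0. \<exists>\<beta>0\<in>below (below \<Lambda> b) \<gamma>.
          \<forall>\<beta>\<in>below \<Lambda> b \<inter> {\<beta>0..<\<gamma>}. norm (\<sigma> \<beta> - \<sigma> \<gamma>) < \<eta>)"
      \<comment> \<open>The recursion at b dictates the missing value; the other clauses concern
        only \<open>K\<close>, which does not contain b.\<close>
      define \<sigma>' where "\<sigma>' = \<sigma>(b := x \<beta>1 + \<sigma> \<beta>1)"
      have eq: "\<sigma>' \<beta> = \<sigma> \<beta>" if "\<beta> \<in> K" for \<beta> using that by (auto simp: \<sigma>'_def K below_def)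
      have "\<sigma>' b = x \<beta>1 + \<sigma>' \<beta>1" using \<beta>1 by (simp add: \<sigma>'_def)
      moreover have "\<sigma>' a = 0" using H(1) ab by (simp add: \<sigma>'_def)
      moreover have "\<forall>\<beta>\<in>below \<Lambda> b. \<forall>\<gamma>. is_succ K \<beta> \<gamma> \<longrightarrow> \<sigma>' \<gamma> = x \<beta> + \<sigma>' \<beta>"
        using H(2) eq by (auto simp: is_succ_def K)
      moreover have "\<forall>\<gamma>. limit_element K \<gamma> \<longrightarrow> (\<forall>\<eta>>0. \<exists>\<beta>0\<in>below (below \<Lambda> b) \<gamma>.
          \<forall>\<beta>\<in>below \<Lambda> b \<inter> {\<beta>0..<\<gamma>}. norm (\<sigma>' \<beta> - \<sigma>' \<gamma>) < \<eta>)"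
      proof (intro allI impI)
        fix \<gamma> and \<eta> :: real assume \<gamma>: "limit_element K \<gamma>" and \<eta>: "\<eta> > 0"
        then have "\<gamma> \<in> K" by (simp add: limit_element_def)
        obtain \<beta>0 where "\<beta>0\<in>below (below \<Lambda> b) \<gamma>"
          "\<forall>\<beta>\<in>below \<Lambda> b \<inter> {\<beta>0..<\<gamma>}. norm (\<sigma> \<beta> - \<sigma> \<gamma>) < \<eta>"
          using H(3) \<gamma> \<eta> by blast
        then show "\<exists>\<beta>0\<in>below (below \<Lambda> b) \<gamma>.
            \<forall>\<beta>\<in>below \<Lambda> b \<inter> {\<beta>0..<\<gamma>}. norm (\<sigma>' \<beta> - \<sigma>' \<gamma>) < \<eta>"
          using eq \<open>\<gamma> \<in> K\<close> K by (intro bexI[of _ \<beta>0]) auto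
      qed
      ultimately show "\<exists>\<sigma>. \<sigma> b = x \<beta>1 + \<sigma> \<beta>1 \<and> \<sigma> a = 0 \<and>
        (\<forall>\<beta>\<in>below \<Lambda> b. \<forall>\<gamma>. is_succ K \<beta> \<gamma> \<longrightarrow> \<sigma> \<gamma> = x \<beta> + \<sigma> \<beta>) \<and>
        (\<forall>\<gamma>. limit_element K \<gamma> \<longrightarrow> (\<forall>\<eta>>0. \<exists>\<beta>0\<in>below (below \<Lambda> b) \<gamma>.
          \<forall>\<beta>\<in>below \<Lambda> b \<inter> {\<beta>0..<\<gamma>}. norm (\<sigma> \<beta> - \<sigma> \<gamma>) < \<eta>))" by blast
    qed blast
  qed
qed

end

section \<open>Right regulated mappings\<close>

text \<open>The supremum defining \<open>G_eps\<close> need not be attained, but two points below it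
  lie below a common member of the set. The right limit of \<open>A\<close> at x shows that the set
  is nonempty.\<close>

lemma G_eps_osc:
  assumes rr: "right_regulated a b A" and eps: "\<epsilon> > 0" and x: "x \<in> {a..<b}"
    and st: "s \<in> {x<..<G_eps b A \<epsilon> x}" "t \<in> {x<..<G_eps b A \<epsilon> x}"
  shows "norm (A s - A t) \<le> \<epsilon>"
proof -
  define Y where "Y = {y \<in> {x<..b}. \<forall>s\<in>{x<..<y}. \<forall>t\<in>{x<..<y}. norm (A s - A t) \<le> \<epsilon>}"
  have G: "G_eps b A \<epsilon> x = Sup Y" using x by (simp add: G_eps_def Y_def)
  have "Y \<noteq> {}"
  proof
    assume "Y = {}"
    obtain l where "(A \<longlongrightarrow> l) (at_right x)"
      using rr x unfolding right_regulated_def by blast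
    then have "eventually (\<lambda>s. dist (A s) l < \<epsilon> / 2) (at_right x)"
      using eps by (intro tendstoD) auto
    then obtain c where c: "c > x" "\<And>s. x < s \<Longrightarrow> s < c \<Longrightarrow> dist (A s) l < \<epsilon> / 2"
      unfolding eventually_at_right_field by auto
    have "min b c \<in> Y"
      unfolding Y_def
    proof (intro CollectI conjI ballI)
      fix s t assume "s \<in> {x<..<min b c}" "t \<in> {x<..<min b c}"
      then have "dist (A s) l < \<epsilon> / 2" "dist (A t) l < \<epsilon> / 2" using c(2) by auto
      then have "dist (A s) (A t) < \<epsilon>" by (rule dist_triangle_half_l)
      then show "norm (A s - A t) \<le> \<epsilon>" by (simp add: dist_norm)
    qed (use x c(1) in auto)
    then show False using \<open>Y = {}\<close> by blast
  qed
  moreover have "max s t < Sup Y" using st by (simp add: G)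
  ultimately obtain y where "y \<in> Y" "max s t < y" using less_cSupE by blast
  then show ?thesis using st by (auto simp: Y_def)
qed

section \<open>Successors and suprema in the well-ordered set\<close>

context
  fixes A :: "real \<Rightarrow> 'e::real_normed_vector" and a b \<epsilon> :: real and \<Lambda> :: "real set"
  assumes ab: "a < b" and rr: "right_regulated a b A" and eps: "\<epsilon> > 0"
    and L: "is_Lambda a b A \<epsilon> \<Lambda>"
begin

lemma Lambda_facts:
  shows Lambda_subset: "\<Lambda> \<subseteq> {a..b}" and Lambda_a: "a \<in> \<Lambda>"
    and Lambda_iff: "\<And>\<gamma>. a < \<gamma> \<Longrightarrow> \<gamma> \<in> \<Lambda> \<longleftrightarrow> \<gamma> = Sup (G_eps b A \<epsilon> ` below \<Lambda> \<gamma>)"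
  using L unfolding is_Lambda_def is_min_def by blast+

lemma bdd_G_below: "bdd_above (G_eps b A \<epsilon> ` below \<Lambda> \<gamma>)"
proof (rule bdd_aboveI2)
  fix x assume "x \<in> below \<Lambda> \<gamma>"
  then have "x \<in> {a..b}" using Lambda_subset by (auto simp: below_def)
  then show "G_eps b A \<epsilon> x \<le> b" using G_eps_properties(1)[OF rr eps] by simp
qed

text \<open>Every later \<gamma> in \<Lambda> is the supremum of a set containing G(\<beta>), so it
  is at least G(\<beta>). Conversely G(\<beta>) solves its own membership equation: the elements
  below it are at most \<beta>, and G is monotone.\<close>

lemma is_succ_G_eps:
  assumes \<beta>: "\<beta> \<in> \<Lambda>" "\<beta> < b"
  shows "is_succ \<Lambda> \<beta> (G_eps b A \<epsilon> \<beta>)"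
proof -
  let ?G = "G_eps b A \<epsilon>"
  have \<beta>ab: "\<beta> \<in> {a..b}" using \<beta> Lambda_subset by blast
  have gt: "\<beta> < ?G \<beta>" by (rule G_eps_properties(2)[OF rr eps \<beta>ab \<beta>(2)])
  have le: "?G \<beta> \<le> \<gamma>" if "\<gamma> \<in> \<Lambda>" "\<beta> < \<gamma>" for \<gamma>
  proof -
    have "\<gamma> = Sup (?G ` below \<Lambda> \<gamma>)" using Lambda_iff[of \<gamma>] that \<beta>ab by simp
    moreover have "?G \<beta> \<le> Sup (?G ` below \<Lambda> \<gamma>)"
      using \<beta> that by (intro cSup_upper bdd_G_below imageI) (simp add: below_def)
    ultimately show ?thesis by simp
  qed
  have "Sup (?G ` below \<Lambda> (?G \<beta>)) = ?G \<beta>"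
  proof (rule cSup_eq_maximum)
    show "?G \<beta> \<in> ?G ` below \<Lambda> (?G \<beta>)" using \<beta> gt by (simp add: below_def)
    fix y assume "y \<in> ?G ` below \<Lambda> (?G \<beta>)"
    then obtain x where x: "y = ?G x" "x \<in> \<Lambda>" "x < ?G \<beta>" by (auto simp: below_def)
    then have "x \<le> \<beta>" using le[of x] by force
    then show "y \<le> ?G \<beta>"
      using x G_eps_properties(3)[OF rr eps, of x \<beta>] \<beta>ab Lambda_subset by auto
  qed
  then have "?G \<beta> \<in> \<Lambda>" using Lambda_iff[of "?G \<beta>"] gt \<beta>ab by simp
  then show ?thesis using gt le by (simp add: is_succ_def)
qed

text \<open>\<Lambda> is closed under suprema: if elements of \<Lambda> increase to m without
  reaching it, their images under G stay below m and are cofinal in it, and the membership equation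
  puts m into \<Lambda>. So there is a largest element up to x. The guard \<beta> < b is there
  because G fixes b.\<close>

lemma Lambda_floor:
  assumes x: "x \<in> {a..b}"
  obtains \<beta> where "\<beta> \<in> \<Lambda>" "\<beta> \<le> x" "\<beta> < b \<Longrightarrow> x < G_eps b A \<epsilon> \<beta>"
proof -
  let ?G = "G_eps b A \<epsilon>"
  define T where "T = {\<beta>\<in>\<Lambda>. \<beta> \<le> x}"
  have aT: "a \<in> T" using Lambda_a x by (simp add: T_def)
  have bdd: "bdd_above T" by (rule bdd_aboveI[of _ x]) (simp add: T_def)
  define m where "m = Sup T"
  have upper: "\<beta> \<le> m" if "\<beta> \<in> T" for \<beta> unfolding m_def using that bdd by (rule cSup_upper)
  have "m \<le> x" unfolding m_def using aT by (intro cSup_least) (auto simp: T_def)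
  have "m \<in> \<Lambda>"
  proof (rule ccontr)
    assume nm: "m \<notin> \<Lambda>"
    have "a < m" using upper[OF aT] nm Lambda_a by (cases "a = m") auto
    have "Sup (?G ` below \<Lambda> m) = m"
    proof (rule cSup_eq_non_empty)
      show "?G ` below \<Lambda> m \<noteq> {}" using \<open>a < m\<close> Lambda_a by (auto simp: below_def)
      fix y assume "y \<in> ?G ` below \<Lambda> m"
      then obtain \<beta> where \<beta>: "\<beta> \<in> \<Lambda>" "\<beta> < m" "y = ?G \<beta>" by (auto simp: below_def)
      obtain \<beta>' where \<beta>': "\<beta>' \<in> T" "\<beta> < \<beta>'"
        using less_cSupE[of \<beta> T] aT \<beta>(2) unfolding m_def by blast
      have "\<beta> < b" using \<beta>(2) \<open>m \<le> x\<close> x by simp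
      then have "?G \<beta> \<le> \<beta>'" using is_succ_G_eps[OF \<beta>(1)] \<beta>' by (auto simp: is_succ_def T_def)
      then show "y \<le> m" using upper[OF \<beta>'(1)] \<beta>(3) by simp
    next
      fix y assume y: "\<And>z. z \<in> ?G ` below \<Lambda> m \<Longrightarrow> z \<le> y"
      show "m \<le> y"
        unfolding m_def
      proof (rule cSup_least)
        fix \<beta> assume "\<beta> \<in> T"
        then have \<beta>: "\<beta> \<in> \<Lambda>" "\<beta> < m" using upper[of \<beta>] nm by (auto simp: T_def less_le)
        then have "\<beta> \<le> ?G \<beta>"
          using G_eps_properties(1)[OF rr eps, of \<beta>] Lambda_subset by auto
        moreover have "?G \<beta> \<le> y" using \<beta> by (intro y) (simp add: below_def)
        ultimately show "\<beta> \<le> y" by simp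
      qed (use aT in blast)
    qed
    then show False using Lambda_iff[OF \<open>a < m\<close>] nm by simp
  qed
  moreover have "x < ?G m" if "m < b"
  proof (rule ccontr)
    assume "\<not> x < ?G m"
    then have "?G m \<in> T" using is_succ_G_eps[OF \<open>m \<in> \<Lambda>\<close> that] by (simp add: T_def is_succ_def)
    then have "?G m \<le> m" by (rule upper)
    then show False using is_succ_G_eps[OF \<open>m \<in> \<Lambda>\<close> that] by (simp add: is_succ_def)
  qed
  ultimately show ?thesis using \<open>m \<le> x\<close> that by blast
qed

lemma step_partition_Lambda: "step_partition a b \<Lambda>"
proof
  show "b \<in> \<Lambda>"
  proof -
    \<comment> \<open>An element \<beta> < b would satisfy b < G(\<beta>), while G never exceeds b;
      so the element found is b.\<close>
    obtain \<beta> where \<beta>: "\<beta> \<in> \<Lambda>" "\<beta> \<le> b" "\<beta> < b \<Longrightarrow> b < G_eps b A \<epsilon> \<beta>"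
      using Lambda_floor[of b] ab by auto
    have "G_eps b A \<epsilon> \<beta> \<le> b"
      using G_eps_properties(1)[OF rr eps, of \<beta>] \<beta> Lambda_subset by auto
    then show ?thesis using \<beta> by force
  qed
  fix x assume x: "x \<in> {a..<b}"
  obtain \<beta> where \<beta>: "\<beta> \<in> \<Lambda>" "\<beta> \<le> x" "\<beta> < b \<Longrightarrow> x < G_eps b A \<epsilon> \<beta>"
    using Lambda_floor[of x] x by auto
  then show "\<exists>\<beta>\<in>\<Lambda>. \<exists>\<gamma>. is_succ \<Lambda> \<beta> \<gamma> \<and> \<beta> \<le> x \<and> x < \<gamma>"
    using is_succ_G_eps[of \<beta>] x by (intro bexI[of _ \<beta>] exI[of _ "G_eps b A \<epsilon> \<beta>"]) auto
qed (use ab Lambda_subset Lambda_a in auto)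

lemma Lambda_osc:
  assumes \<beta>: "\<beta> \<in> \<Lambda>" "\<beta> < b" and st: "s \<in> {\<beta><..<Succ \<Lambda> \<beta>}" "t \<in> {\<beta><..<Succ \<Lambda> \<beta>}"
  shows "norm (A s - A t) \<le> \<epsilon>"
proof -
  have "\<beta> \<in> {a..<b}" using \<beta> Lambda_subset by auto
  then show ?thesis
    using G_eps_osc[OF rr eps, of \<beta> s t] st Succ_eq[OF is_succ_G_eps[OF \<beta>]] by simp
qed

end

lemma right_regulated_tendsto:
  assumes "right_regulated a b A" "x \<in> {a..<b}"
  shows "(A \<longlongrightarrow> Lim (at_right x) A) (at_right x)"
proof -
  obtain l where "(A \<longlongrightarrow> l) (at_right x)"
    using assms unfolding right_regulated_def by blast
  then show ?thesis using tendsto_Lim[OF trivial_limit_at_right_real] by metis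
qed

lemma right_limit_close:
  assumes A: "right_regulated a b A" and x: "x \<in> {a..<b}" and c: "x < c"
    and bound: "\<And>y. x < y \<Longrightarrow> y < c \<Longrightarrow> norm (A y - l) \<le> e"
  shows "norm (Lim (at_right x) A - l) \<le> e"
proof (rule tendsto_upperbound)
  show "((\<lambda>y. norm (A y - l)) \<longlongrightarrow> norm (Lim (at_right x) A - l)) (at_right x)"
    by (intro tendsto_intros right_regulated_tendsto[OF A x])
  show "\<forall>\<^sub>F y in at_right x. norm (A y - l) \<le> e"
    by (rule eventually_at_rightI[of x c]) (use bound c in auto)
qed simp

context
  fixes A :: "real \<Rightarrow> 'e::real_normed_vector" and a b \<epsilon> :: real and \<Lambda> :: "real set"
  assumes ab: "a < b" and rr: "right_regulated a b A" and eps: "\<epsilon> > 0"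
    and L: "is_Lambda a b A \<epsilon> \<Lambda>"
begin

interpretation step_partition a b \<Lambda> by (rule step_partition_Lambda[OF ab rr eps L])

text \<open>The oscillation is controlled only inside the open step, which excludes A(base x) and,
  if x starts the step, A(x). Both right limits are therefore compared with an interior value
  A(y).\<close>

lemma right_limit_near_base:
  assumes x: "x \<in> {a..<b}"
  shows "norm (Lim (at_right (base x)) A - Lim (at_right x) A) \<le> \<epsilon>"
proof -
  note bx = base[OF x]
  have bab: "base x \<in> {a..<b}" using bx sub by auto
  have "norm (Lim (at_right x) A - Lim (at_right (base x)) A) \<le> \<epsilon>"
  proof (rule right_limit_close[OF rr x bx(4)])
    fix y assume y: "x < y" "y < Succ \<Lambda> (base x)"
    have "norm (Lim (at_right (base x)) A - A y) \<le> \<epsilon>"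
      by (rule right_limit_close[OF rr bab, of "Succ \<Lambda> (base x)"])
         (use y bx Lambda_osc[OF ab rr eps L bx(1,2)] in auto)
    then show "norm (A y - Lim (at_right (base x)) A) \<le> \<epsilon>" by (simp add: norm_minus_commute)
  qed
  then show ?thesis by (simp add: norm_minus_commute)
qed

text \<open>A point outside \<Lambda> is interior to its step, so here the value A(x) itself is
  controlled; at the elements of \<Lambda> this may fail.\<close>

lemma right_limit_near_value:
  assumes x: "x \<in> {a..<b}" "x \<notin> \<Lambda>" and y: "base x < y" "y < Succ \<Lambda> (base x)"
  shows "norm (Lim (at_right y) A - A x) \<le> \<epsilon>"
proof -
  note bx = base[OF x(1)]
  have "base x < x" using bx x(2) by (auto simp: less_le)
  have "y \<in> {a..<b}" using y bx sub Succ_le_b[OF bx(1,2)] by auto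
  then show ?thesis
    by (rule right_limit_close[OF rr _ y(2)])
       (use y bx \<open>base x < x\<close> Lambda_osc[OF ab rr eps L bx(1,2)] in auto)
qed

end

section \<open>Primitives of the right limits\<close>

text \<open>Each accuracy e brings its own partition, and boundedness makes the sums over its steps
  converge absolutely. The bound is on right limits, which is what the difference of
  \<open>A\<close> and \<open>A_eps\<close> satisfies below.\<close>

lemma bounded_primitive:
  fixes A :: "real \<Rightarrow> 'e::banach"
  assumes ab: "a < b" and rr: "right_regulated a b A"
    and M: "\<And>x. x \<in> {a..<b} \<Longrightarrow> norm (Lim (at_right x) A) \<le> M"
  shows "\<exists>F. primitive a b (\<lambda>x. Lim (at_right x) A) F"
proof (rule primitive_if_approximable)
  fix e :: real assume e: "e > 0"
  define \<Lambda> where "\<Lambda> = Lambda_eps a b A e"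
  have L: "is_Lambda a b A e \<Lambda>" unfolding \<Lambda>_def by (rule is_Lambda_Lambda_eps[OF ab rr e])
  interpret step_partition a b \<Lambda> by (rule step_partition_Lambda[OF ab rr e L])
  obtain \<sigma> where "step_sums (\<lambda>\<beta>. Lim (at_right \<beta>) A) \<sigma>"
    using step_sums_bounded[of "\<lambda>\<beta>. Lim (at_right \<beta>) A" M] M sub by force
  then obtain F where F: "primitive a b (\<lambda>x. Lim (at_right (base x)) A) F"
    using primitive_if_step_sums by blast
  then show "\<exists>g G. primitive a b g G \<and> (\<forall>x\<in>{a..<b}. norm (g x - Lim (at_right x) A) \<le> e)"
    using right_limit_near_base[OF ab rr e L] by blast
qed (use ab in simp)

definition right_primitive :: "real \<Rightarrow> real \<Rightarrow> (real \<Rightarrow> 'e::real_normed_vector) \<Rightarrow> (real \<Rightarrow> 'e) \<Rightarrow> bool"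
  where "right_primitive a b A = primitive a b (\<lambda>x. Lim (at_right x) A)"

context
  fixes A :: "real \<Rightarrow> 'e::banach" and a b \<epsilon> :: real
  assumes ab: "a < b" and rr: "right_regulated a b A" and eps: "\<epsilon> > 0"
begin

private lemma is_L: "is_Lambda a b A \<epsilon> (Lambda_eps a b A \<epsilon>)"
  by (rule is_Lambda_Lambda_eps[OF ab rr eps])

interpretation step_partition a b "Lambda_eps a b A \<epsilon>" by (rule step_partition_Lambda[OF ab rr eps is_L])

lemma A_eps_tendsto:
  assumes x: "x \<in> {a..<b}"
  shows "(A_eps a b A \<epsilon> \<longlongrightarrow> Lim (at_right (base x)) A) (at_right x)"
proof (rule tendsto_eventually, rule eventually_at_rightI)
  note bx = base[OF x]
  fix y assume y: "y \<in> {x<..<Succ (Lambda_eps a b A \<epsilon>) (base x)}"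
  then have "base y = base x" using bx by (intro base_eq) auto
  moreover have "y \<noteq> b" using y Succ_le_b[OF bx(1,2)] by auto
  ultimately show "A_eps a b A \<epsilon> y = Lim (at_right (base x)) A"
    by (simp add: A_eps_def base_def)
qed (use base[OF x] in auto)

lemma right_limit_A_eps:
  "x \<in> {a..<b} \<Longrightarrow> Lim (at_right x) (A_eps a b A \<epsilon>) = Lim (at_right (base x)) A"
  using A_eps_tendsto by (intro tendsto_Lim) auto

lemma right_regulated_A_eps: "right_regulated a b (A_eps a b A \<epsilon>)"
  unfolding right_regulated_def using A_eps_tendsto by blast

lemma right_primitive_A_eps_iff:
  "(\<exists>F. right_primitive a b (A_eps a b A \<epsilon>) F) \<longleftrightarrow>
    (\<exists>F. primitive a b (\<lambda>x. Lim (at_right (base x)) A) F)"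
  unfolding right_primitive_def
  by (intro iffI; elim exE; intro exI; erule primitive_cong) (simp_all add: right_limit_A_eps)

lemma right_primitive_A_eps_iff_wo_summable:
  "(\<exists>F. right_primitive a b (A_eps a b A \<epsilon>) F) \<longleftrightarrow>
    wo_summable (below (Lambda_eps a b A \<epsilon>) b) (\<lambda>\<beta>. (Succ (Lambda_eps a b A \<epsilon>) \<beta> - \<beta>) *\<^sub>R Lim (at_right \<beta>) A)"
  unfolding right_primitive_A_eps_iff wo_summable_iff_step_sums
  by (intro iffI; elim exE) (auto dest: step_sums_if_primitive primitive_if_step_sums)

lemma right_primitive_iff_A_eps:
  "(\<exists>F. right_primitive a b A F) \<longleftrightarrow> (\<exists>F. right_primitive a b (A_eps a b A \<epsilon>) F)"
proof -
  define D where "D x = A x - A_eps a b A \<epsilon> x" for x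
  have D: "(D \<longlongrightarrow> Lim (at_right x) A - Lim (at_right (base x)) A) (at_right x)"
    if "x \<in> {a..<b}" for x
    unfolding D_def by (intro tendsto_intros right_regulated_tendsto[OF rr that] A_eps_tendsto[OF that])
  then have LD: "Lim (at_right x) D = Lim (at_right x) A - Lim (at_right (base x)) A"
    if "x \<in> {a..<b}" for x
    using that by (intro tendsto_Lim) auto
  have "right_regulated a b D" unfolding right_regulated_def using D by blast
  moreover have "norm (Lim (at_right x) D) \<le> \<epsilon>" if "x \<in> {a..<b}" for x
    using right_limit_near_base[OF ab rr eps is_L that] LD[OF that] by (simp add: norm_minus_commute)
  ultimately obtain G where "primitive a b (\<lambda>x. Lim (at_right x) D) G"
    using bounded_primitive[OF ab] by blast
  then have G: "primitive a b (\<lambda>x. Lim (at_right x) A - Lim (at_right (base x)) A) G"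
    by (rule primitive_cong) (rule LD)
  show ?thesis
    unfolding right_primitive_A_eps_iff unfolding right_primitive_def
  proof (intro iffI; elim exE)
    fix F assume "primitive a b (\<lambda>x. Lim (at_right x) A) F"
    from primitive_diff[OF this G] show "\<exists>F. primitive a b (\<lambda>x. Lim (at_right (base x)) A) F"
      by auto
  next
    fix F assume "primitive a b (\<lambda>x. Lim (at_right (base x)) A) F"
    from primitive_add[OF this G] show "\<exists>F. primitive a b (\<lambda>x. Lim (at_right x) A) F"
      by auto
  qed
qed

text \<open>Here \<epsilon> is the accuracy of an integral. It is later taken arbitrarily small,
  independently of the \<epsilon> of the step mapping in the theorem, and the countable set changes
  with it.\<close>

lemma right_primitive_straddle:
  assumes F: "right_primitive a b A F"
  shows "\<exists>C. countable C \<and> (\<forall>\<xi>\<in>{a..b} - C. \<exists>d>0. \<forall>s t. a \<le> s \<and> s \<le> \<xi> \<and> \<xi> \<le> t \<and> t \<le> b \<and> t - s < d \<longrightarrow>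
    norm (F t - F s - (t - s) *\<^sub>R A \<xi>) \<le> \<epsilon> * (t - s))"
proof (intro exI[of _ "Lambda_eps a b A \<epsilon>"] conjI ballI)
  show "countable (Lambda_eps a b A \<epsilon>)" by (rule countable_steps)
  fix \<xi> assume "\<xi> \<in> {a..b} - (Lambda_eps a b A \<epsilon>)"
  then have \<xi>: "\<xi> \<in> {a..<b}" "\<xi> \<notin> (Lambda_eps a b A \<epsilon>)" using b_mem by (cases "\<xi> = b"; auto)+
  note bx = base[OF \<xi>(1)]
  have "base \<xi> < \<xi>" using bx \<xi>(2) by (auto simp: less_le)
  show "\<exists>d>0. \<forall>s t. a \<le> s \<and> s \<le> \<xi> \<and> \<xi> \<le> t \<and> t \<le> b \<and> t - s < d \<longrightarrow>
    norm (F t - F s - (t - s) *\<^sub>R A \<xi>) \<le> \<epsilon> * (t - s)"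
  \<comment> \<open>The distance from \<xi> to the ends of its step keeps [s, t] inside the step; it
    is positive because \<xi> is not an element of the set.\<close>
  proof (intro exI[of _ "min (\<xi> - base \<xi>) (Succ (Lambda_eps a b A \<epsilon>) (base \<xi>) - \<xi>)"] conjI allI impI)
    fix s t assume st: "a \<le> s \<and> s \<le> \<xi> \<and> \<xi> \<le> t \<and> t \<le> b \<and>
      t - s < min (\<xi> - base \<xi>) (Succ (Lambda_eps a b A \<epsilon>) (base \<xi>) - \<xi>)"
    show "norm (F t - F s - (t - s) *\<^sub>R A \<xi>) \<le> \<epsilon> * (t - s)"
    proof (rule primitive_approx)
      show "primitive s t (\<lambda>x. Lim (at_right x) A) F"
        using F unfolding right_primitive_def by (rule primitive_subset) (use st in auto)
      fix y assume "y \<in> {s..<t}"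
      then show "norm (Lim (at_right y) A - A \<xi>) \<le> \<epsilon>"
        using st by (intro right_limit_near_value[OF ab rr eps is_L \<xi>]) auto
    qed (use st in simp)
  qed (use bx \<open>base \<xi> < \<xi>\<close> in auto)
qed

end

lemma scaleR_small:
  fixes v :: "'e::real_normed_vector"
  assumes "\<eta> > 0"
  shows "\<exists>d>0. \<forall>s t. s \<le> t \<and> t - s < d \<longrightarrow> norm ((t - s) *\<^sub>R v) \<le> \<eta>"
proof (intro exI[of _ "\<eta> / (norm v + 1)"] conjI allI impI)
  show "\<eta> / (norm v + 1) > 0" using assms by (simp add: add_nonneg_pos)
  fix s t :: real assume st: "s \<le> t \<and> t - s < \<eta> / (norm v + 1)"
  have "norm ((t - s) *\<^sub>R v) = (t - s) * norm v" using st by simp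
  also have "\<dots> \<le> (t - s) * (norm v + 1)" using st by (intro mult_left_mono) auto
  also have "\<dots> \<le> \<eta>"
  proof -
    have "t - s < \<eta> / (norm v + 1)" using st by blast
    then show ?thesis by (simp add: pos_less_divide_eq add_nonneg_pos)
  qed
  finally show "norm ((t - s) *\<^sub>R v) \<le> \<eta>" .
qed

lemma increment_small:
  fixes F :: "real \<Rightarrow> 'e::real_normed_vector"
  assumes F: "continuous_on {a..b} F" and \<xi>: "\<xi> \<in> {a..b}" and \<eta>: "\<eta> > 0"
  shows "\<exists>d>0. \<forall>s t. a \<le> s \<and> s \<le> \<xi> \<and> \<xi> \<le> t \<and> t \<le> b \<and> t - s < d \<longrightarrow> norm (F t - F s) \<le> \<eta>"
proof -
  obtain d where d: "d > 0" "\<And>y. y \<in> {a..b} \<Longrightarrow> dist y \<xi> < d \<Longrightarrow> dist (F y) (F \<xi>) < \<eta> / 2"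
    using F \<xi> half_gt_zero[OF \<eta>] unfolding continuous_on_iff by metis
  have "norm (F t - F s) \<le> \<eta>"
    if "a \<le> s \<and> s \<le> \<xi> \<and> \<xi> \<le> t \<and> t \<le> b \<and> t - s < d" for s t
  proof -
    have "dist (F t) (F s) < \<eta>"
      by (rule dist_triangle_half_l; rule d(2)) (use that in \<open>auto simp: dist_real_def\<close>)
    then show ?thesis by (simp add: dist_norm)
  qed
  then show ?thesis using d(1) by blast
qed

lemma right_primitive_small:
  assumes F: "right_primitive a b A F" and \<xi>: "\<xi> \<in> {a..b}" and \<eta>: "\<eta> > 0"
  shows "\<exists>d>0. \<forall>s t. a \<le> s \<and> s \<le> \<xi> \<and> \<xi> \<le> t \<and> t \<le> b \<and> t - s < d \<longrightarrow>
    norm ((t - s) *\<^sub>R A \<xi> - (F t - F s)) \<le> \<eta>"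
proof -
  have "continuous_on {a..b} F" using F by (simp add: right_primitive_def primitive_def)
  from increment_small[OF this \<xi> half_gt_zero[OF \<eta>]] obtain d1 where d1: "d1 > 0"
    "\<And>s t. a \<le> s \<and> s \<le> \<xi> \<and> \<xi> \<le> t \<and> t \<le> b \<and> t - s < d1 \<Longrightarrow> norm (F t - F s) \<le> \<eta> / 2" by blast
  from scaleR_small[OF half_gt_zero[OF \<eta>], of "A \<xi>"] obtain d2 where d2: "d2 > 0"
    "\<And>s t. s \<le> t \<and> t - s < d2 \<Longrightarrow> norm ((t - s) *\<^sub>R A \<xi>) \<le> \<eta> / 2" by blast
  have "norm ((t - s) *\<^sub>R A \<xi> - (F t - F s)) \<le> \<eta>"
    if "a \<le> s \<and> s \<le> \<xi> \<and> \<xi> \<le> t \<and> t \<le> b \<and> t - s < min d1 d2" for s t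
    using norm_triangle_ineq4[of "(t - s) *\<^sub>R A \<xi>" "F t - F s"] d1(2)[of s t] d2(2)[of s t] that
    by simp
  then show ?thesis using d1(1) d2(1) by (intro exI[of _ "min d1 d2"]) simp
qed

section \<open>Strong Henstock-Kurzweil integrals and primitives\<close>

lemma strongly_HK_integrable_iff_right_primitive:
  fixes A :: "real \<Rightarrow> 'e::banach"
  assumes ab: "a < b" and rr: "right_regulated a b A"
  shows "strongly_HK_integrable a b A \<longleftrightarrow> (\<exists>F. right_primitive a b A F)"
proof
  assume "strongly_HK_integrable a b A"
  then obtain F where F: "strongly_null a b (\<lambda>\<xi> s t. (t - s) *\<^sub>R A \<xi> - (F t - F s))"
    unfolding strongly_HK_integrable_iff by blast
  have "primitive a b (\<lambda>x. Lim (at_right x) A) F"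
  proof (rule strongly_null_primitive[OF F])
    show "continuous_on {a..b} F"
    proof (rule strongly_null_continuous[OF F])
      fix \<xi> \<eta> :: real assume "\<eta> > 0"
      from scaleR_small[OF this, of "A \<xi>"]
      show "\<exists>d>0. \<forall>s t. a \<le> s \<and> s \<le> \<xi> \<and> \<xi> \<le> t \<and> t \<le> b \<and> t - s < d \<longrightarrow> norm ((t - s) *\<^sub>R A \<xi>) \<le> \<eta>"
        by (meson order_trans)
    qed
    fix x e :: real assume x: "x \<in> {a..<b}" and e: "e > 0"
    obtain c where c: "c > x" "\<And>y. x < y \<Longrightarrow> y < c \<Longrightarrow> dist (A y) (Lim (at_right x) A) < e"
      using tendstoD[OF right_regulated_tendsto[OF rr x] e]
      unfolding eventually_at_right_field by auto
    show "\<exists>h>0. \<forall>\<xi> u v. x < u \<and> u \<le> \<xi> \<and> \<xi> \<le> v \<and> v < x + h \<and> v \<le> b \<longrightarrow>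
        norm ((v - u) *\<^sub>R A \<xi> - (v - u) *\<^sub>R Lim (at_right x) A) \<le> e * (v - u)"
    proof (intro exI[of _ "c - x"] conjI allI impI)
      fix \<xi> u v assume H: "x < u \<and> u \<le> \<xi> \<and> \<xi> \<le> v \<and> v < x + (c - x) \<and> v \<le> b"
      then have "norm (A \<xi> - Lim (at_right x) A) \<le> e" using c(2)[of \<xi>] by (simp add: dist_norm)
      then have "(v - u) * norm (A \<xi> - Lim (at_right x) A) \<le> (v - u) * e"
        using H by (intro mult_left_mono) auto
      then show "norm ((v - u) *\<^sub>R A \<xi> - (v - u) *\<^sub>R Lim (at_right x) A) \<le> e * (v - u)"
        using H by (simp add: mult.commute flip: scaleR_diff_right)
    qed (use c in simp)
  qed
  then show "\<exists>F. right_primitive a b A F" unfolding right_primitive_def by blast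
next
  assume "\<exists>F. right_primitive a b A F"
  then obtain F where F: "right_primitive a b A F" by blast
  have "strongly_null a b (\<lambda>\<xi> s t. (t - s) *\<^sub>R A \<xi> - (F t - F s))"
  proof (rule strongly_nullI)
    fix \<eta> :: real assume "\<eta> > 0"
    from right_primitive_straddle[OF ab rr this F]
    show "\<exists>C. countable C \<and> (\<forall>\<xi>\<in>{a..b} - C. \<exists>d>0. \<forall>s t. a \<le> s \<and> s \<le> \<xi> \<and> \<xi> \<le> t \<and> t \<le> b \<and> t - s < d
      \<longrightarrow> norm ((t - s) *\<^sub>R A \<xi> - (F t - F s)) \<le> \<eta> * (t - s))"
      by (simp add: norm_minus_commute)
  qed (use right_primitive_small[OF F] ab in auto)
  then show "strongly_HK_integrable a b A" unfolding strongly_HK_integrable_iff by blast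
qed

section \<open>Product integrals\<close>

text \<open>Termwise comparison with the real series, from the quadratic term on, leaves exp r - 1 -
  r with r = norm X, which is at most r^2 for r \<le> 1.\<close>

lemma norm_exp_remainder_le:
  fixes X :: "'a::{real_normed_algebra_1, banach}"
  assumes "norm X \<le> 1"
  shows "norm (exp X - 1 - X) \<le> (norm X)\<^sup>2"
proof -
  have "(\<lambda>n. X ^ (n + 2) /\<^sub>R fact (n + 2)) sums (exp X - (\<Sum>i<2. X ^ i /\<^sub>R fact i))"
    by (rule sums_split_initial_segment[OF exp_converges])
  moreover have "(\<lambda>n. norm X ^ (n + 2) /\<^sub>R fact (n + 2)) sums (exp (norm X) - (\<Sum>i<2. norm X ^ i /\<^sub>R fact i))"
    by (rule sums_split_initial_segment[OF exp_converges])
  ultimately have "norm (exp X - (\<Sum>i<2. X ^ i /\<^sub>R fact i)) \<le> exp (norm X) - (\<Sum>i<2. norm X ^ i /\<^sub>R fact i)"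
  proof (rule norm_sums_le)
    fix n
    have "norm (X ^ (n + 2)) \<le> norm X ^ (n + 2)" by (rule norm_power_ineq)
    then show "norm (X ^ (n + 2) /\<^sub>R fact (n + 2)) \<le> norm X ^ (n + 2) /\<^sub>R fact (n + 2)"
      by (simp del: power_Suc add: divide_right_mono mult_left_mono)
  qed
  then have "norm (exp X - 1 - X) \<le> exp (norm X) - 1 - norm X"
    by (simp add: numeral_2_eq_2 algebra_simps)
  also have "\<dots> \<le> (norm X)\<^sup>2" using exp_bound[of "norm X"] assms by simp
  finally show ?thesis .
qed

lemma right_limit_commute:
  fixes A :: "real \<Rightarrow> 'e::real_normed_algebra"
  assumes rr: "right_regulated a b A" and x: "x \<in> {a..<b}"
    and comm: "\<And>t. t \<in> {a..b} \<Longrightarrow> c * A t = A t * c"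
  shows "c * Lim (at_right x) A = Lim (at_right x) A * c"
proof (rule tendsto_unique[OF trivial_limit_at_right_real])
  note lim = right_regulated_tendsto[OF rr x]
  show "((\<lambda>y. c * A y) \<longlongrightarrow> c * Lim (at_right x) A) (at_right x)" by (intro tendsto_intros lim)
  have "\<forall>\<^sub>F y in at_right x. A y * c = c * A y"
    by (rule eventually_at_rightI[of x b]) (use comm x in auto)
  moreover have "((\<lambda>y. A y * c) \<longlongrightarrow> Lim (at_right x) A * c) (at_right x)" by (intro tendsto_intros lim)
  ultimately show "((\<lambda>y. c * A y) \<longlongrightarrow> Lim (at_right x) A * c) (at_right x)"
    by (simp only: tendsto_cong)
qed

text \<open>The commutator of c with \<open>F\<close> has right derivative 0. Normalising
  \<open>F\<close> to vanish at a makes the commutator start at 0; an additive constant in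
  \<open>F\<close> need not commute with c.\<close>

lemma right_primitive_commute:
  fixes A :: "real \<Rightarrow> 'e::real_normed_algebra"
  assumes rr: "right_regulated a b A" and F: "right_primitive a b A F" and Fa: "F a = 0"
    and comm: "\<And>t. t \<in> {a..b} \<Longrightarrow> c * A t = A t * c" and t: "t \<in> {a..b}"
  shows "c * F t = F t * c"
proof -
  have "primitive a b (\<lambda>x. 0) (\<lambda>x. c * F x - F x * c)"
    unfolding primitive_def
  proof (intro conjI ballI)
    show "continuous_on {a..b} (\<lambda>x. c * F x - F x * c)"
      using F unfolding right_primitive_def primitive_def by (auto intro!: continuous_intros)
    fix x assume x: "x \<in> {a..<b}"
    then have "(F has_vector_derivative Lim (at_right x) A) (at_right x)"
      using F unfolding right_primitive_def primitive_def by blast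
    then have "((\<lambda>x. c * F x - F x * c) has_vector_derivative
        c * Lim (at_right x) A - Lim (at_right x) A * c) (at_right x)"
      by (intro derivative_intros)
    then show "((\<lambda>x. c * F x - F x * c) has_vector_derivative 0) (at_right x)"
      using right_limit_commute[OF rr x comm] by simp
  qed
  from primitive_zero_const[OF this t] show ?thesis using Fa by simp
qed

text \<open>Commutativity turns W(t) W(s)^-1 into exp (F t - F s), so each error exceeds that of the
  Henstock-Kurzweil sum by at most the square of the increment of F. Off a countable set this square
  is small against t - s; at the remaining points it is small by continuity.\<close>

lemma product_integrable_if_right_primitive:
  fixes A :: "real \<Rightarrow> 'e::{real_normed_algebra_1, banach}"
  assumes ab: "a < b" and rr: "right_regulated a b A"
    and comm: "\<And>s t. s \<in> {a..b} \<Longrightarrow> t \<in> {a..b} \<Longrightarrow> A s * A t = A t * A s"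
    and F0: "right_primitive a b A F0"
  shows "strongly_Kurzweil_product_integrable a b A"
proof -
  define F where "F x = F0 x - F0 a" for x
  have F: "right_primitive a b A F"
    using primitive_diff[OF F0[unfolded right_primitive_def] primitive_const[of a b "F0 a"]]
    by (simp add: F_def[abs_def] right_primitive_def)
  have Fa: "F a = 0" by (simp add: F_def)
  have contF: "continuous_on {a..b} F" using F by (simp add: right_primitive_def primitive_def)
  have AF: "A s * F t = F t * A s" if "s \<in> {a..b}" "t \<in> {a..b}" for s t
    using right_primitive_commute[OF rr F Fa comm[OF that(1)] that(2)] .
  \<comment> \<open>The same lemma once more: by \<open>AF\<close> each \<open>F s\<close> is a
    constant commuting with the values of \<open>A\<close>.\<close>
  have FF: "F s * F t = F t * F s" if "s \<in> {a..b}" "t \<in> {a..b}" for s t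
    using right_primitive_commute[OF rr F Fa AF[OF _ that(1), symmetric] that(2)] .
  have inv: "is_inverse (exp (F t)) (exp (- F t))" for t
    using exp_minus_inverse[of "F t"] exp_minus_inverse[of "- F t"] by (simp add: is_inverse_def)
  have W: "exp (F t) * inv_elem (exp (F s)) = exp (F t - F s)" if "s \<in> {a..b}" "t \<in> {a..b}" for s t
    using exp_add_commuting[of "F t" "- F s"] FF[OF that] inv_elem_eq[OF inv] by simp
  have "bounded (F ` {a..b})"
    by (intro compact_imp_bounded compact_continuous_image contF) simp
  then obtain K where K: "\<And>t. t \<in> {a..b} \<Longrightarrow> norm (F t) \<le> K"
    unfolding bounded_iff by blast
  have bnd: "norm (exp (F t)) \<le> exp K" "norm (exp (- F t)) \<le> exp K" if "t \<in> {a..b}" for t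
    using K[OF that] by (auto intro!: order_trans[OF norm_exp])
  have "strongly_null a b (\<lambda>\<xi> s t. 1 + (t - s) *\<^sub>R A \<xi> - exp (F t - F s))"
  proof (rule strongly_nullI)
    have split: "norm (1 + (t - s) *\<^sub>R A \<xi> - exp (F t - F s)) \<le>
        norm ((t - s) *\<^sub>R A \<xi> - (F t - F s)) + (norm (F t - F s))\<^sup>2"
      if "norm (F t - F s) \<le> 1" for \<xi> s t
      using norm_triangle_ineq4[of "(t - s) *\<^sub>R A \<xi> - (F t - F s)" "exp (F t - F s) - 1 - (F t - F s)"]
        norm_exp_remainder_le[OF that] by (simp add: algebra_simps)
    show "\<exists>d>0. \<forall>s t. a \<le> s \<and> s \<le> \<xi> \<and> \<xi> \<le> t \<and> t \<le> b \<and> t - s < d \<longrightarrow>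
        norm (1 + (t - s) *\<^sub>R A \<xi> - exp (F t - F s)) \<le> \<eta>"
      if \<xi>: "\<xi> \<in> {a..b}" and \<eta>: "\<eta> > 0" for \<xi> \<eta> :: real
    proof -
      obtain d1 where d1: "d1 > 0" "\<And>s t. a \<le> s \<and> s \<le> \<xi> \<and> \<xi> \<le> t \<and> t \<le> b \<and> t - s < d1 \<Longrightarrow>
          norm ((t - s) *\<^sub>R A \<xi> - (F t - F s)) \<le> \<eta> / 2"
        using right_primitive_small[OF F \<xi> half_gt_zero[OF \<eta>]] by blast
      have "min 1 (\<eta> / 2) > 0" using \<eta> by simp
      then obtain d2 where d2: "d2 > 0" "\<And>s t. a \<le> s \<and> s \<le> \<xi> \<and> \<xi> \<le> t \<and> t \<le> b \<and> t - s < d2 \<Longrightarrow>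
          norm (F t - F s) \<le> min 1 (\<eta> / 2)"
        using increment_small[OF contF \<xi>] by blast
      have "norm (1 + (t - s) *\<^sub>R A \<xi> - exp (F t - F s)) \<le> \<eta>"
        if st: "a \<le> s \<and> s \<le> \<xi> \<and> \<xi> \<le> t \<and> t \<le> b \<and> t - s < min d1 d2" for s t
      proof -
        have n: "norm (F t - F s) \<le> 1" "norm (F t - F s) \<le> \<eta> / 2" using d2(2)[of s t] st by auto
        have "(norm (F t - F s))\<^sup>2 \<le> norm (F t - F s)"
          using n(1) by (simp add: power2_eq_square mult_left_le)
        then show ?thesis using split[OF n(1), of \<xi>] d1(2)[of s t] st n(2) by auto
      qed
      then show ?thesis using d1(1) d2(1) by (intro exI[of _ "min d1 d2"]) simp
    qed
    show "\<exists>C. countable C \<and> (\<forall>\<xi>\<in>{a..b} - C. \<exists>d>0. \<forall>s t. a \<le> s \<and> s \<le> \<xi> \<and> \<xi> \<le> t \<and> t \<le> b \<and> t - s < d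
      \<longrightarrow> norm (1 + (t - s) *\<^sub>R A \<xi> - exp (F t - F s)) \<le> \<eta> * (t - s))" if \<eta>: "\<eta> > 0" for \<eta> :: real
    proof -
      obtain C where C: "countable C" "\<And>\<xi>. \<xi> \<in> {a..b} - C \<Longrightarrow> \<exists>d>0. \<forall>s t. a \<le> s \<and> s \<le> \<xi> \<and> \<xi> \<le> t \<and> t \<le> b \<and>
          t - s < d \<longrightarrow> norm (F t - F s - (t - s) *\<^sub>R A \<xi>) \<le> \<eta> / 2 * (t - s)"
        using right_primitive_straddle[OF ab rr half_gt_zero[OF \<eta>] F] by (elim exE conjE) (rule that, auto)
      have "\<exists>d>0. \<forall>s t. a \<le> s \<and> s \<le> \<xi> \<and> \<xi> \<le> t \<and> t \<le> b \<and> t - s < d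
        \<longrightarrow> norm (1 + (t - s) *\<^sub>R A \<xi> - exp (F t - F s)) \<le> \<eta> * (t - s)" if \<xi>: "\<xi> \<in> {a..b} - C" for \<xi>
      proof -
        obtain d1 where d1: "d1 > 0" "\<And>s t. a \<le> s \<and> s \<le> \<xi> \<and> \<xi> \<le> t \<and> t \<le> b \<and> t - s < d1 \<Longrightarrow>
            norm (F t - F s - (t - s) *\<^sub>R A \<xi>) \<le> \<eta> / 2 * (t - s)"
          using C(2)[OF \<xi>] by blast
        \<comment> \<open>By estimate 2, M bounds the growth of \<open>F\<close> over short
          intervals around \<xi>. The two other entries of \<open>d\<close> make M (t - s) at most
          1, as the remainder of exp requires, and M^2 (t - s) at most \<eta> / 2.\<close>
        define M where "M = norm (A \<xi>) + \<eta> / 2"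
        have M: "M > 0" using \<eta> by (simp add: M_def add_nonneg_pos)
        define d where "d = min d1 (min (1 / M) (\<eta> / (2 * M\<^sup>2)))"
        have "norm (1 + (t - s) *\<^sub>R A \<xi> - exp (F t - F s)) \<le> \<eta> * (t - s)"
          if st: "a \<le> s \<and> s \<le> \<xi> \<and> \<xi> \<le> t \<and> t \<le> b \<and> t - s < d" for s t
        proof -
          have 1: "norm (F t - F s - (t - s) *\<^sub>R A \<xi>) \<le> \<eta> / 2 * (t - s)"
            using st by (intro d1(2)) (simp add: d_def)
          have "norm (F t - F s) \<le> norm (F t - F s - (t - s) *\<^sub>R A \<xi>) + norm ((t - s) *\<^sub>R A \<xi>)"
            using norm_triangle_ineq[of "F t - F s - (t - s) *\<^sub>R A \<xi>" "(t - s) *\<^sub>R A \<xi>"] by simp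
          also have "\<dots> \<le> \<eta> / 2 * (t - s) + (t - s) * norm (A \<xi>)" using 1 st by simp
          finally have 2: "norm (F t - F s) \<le> M * (t - s)" by (simp add: M_def algebra_simps)
          have "t - s < 1 / M" "t - s < \<eta> / (2 * M\<^sup>2)" using st by (auto simp: d_def)
          then have 3: "M * (t - s) \<le> 1" "(t - s) * M\<^sup>2 \<le> \<eta> / 2"
            using M by (simp_all add: pos_less_divide_eq field_simps)
          have "(norm (F t - F s))\<^sup>2 \<le> (M * (t - s))\<^sup>2" using 2 by (intro power_mono) auto
          also have "\<dots> = ((t - s) * M\<^sup>2) * (t - s)" by (simp add: power2_eq_square)
          also have "\<dots> \<le> \<eta> / 2 * (t - s)" using 3(2) st by (intro mult_right_mono) auto
          finally have "(norm (F t - F s))\<^sup>2 \<le> \<eta> / 2 * (t - s)" .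
          moreover have "norm ((t - s) *\<^sub>R A \<xi> - (F t - F s)) \<le> \<eta> / 2 * (t - s)"
            using 1 by (simp add: norm_minus_commute)
          ultimately show ?thesis using split[of t s \<xi>] 2 3(1) by linarith
        qed
        moreover have "d > 0" using d1(1) M \<eta> by (simp add: d_def)
        ultimately show ?thesis by blast
      qed
      then show ?thesis using C(1) by blast
    qed
  qed (use ab in simp)
  then have null: "\<exists>\<delta>. pos_gauge a b \<delta> \<and> (\<forall>m \<xi> t. tagged_partition a b m \<xi> t \<and> delta_fine \<delta> m \<xi> t \<longrightarrow>
        (\<Sum>i<m. norm (1 + (t (Suc i) - t i) *\<^sub>R A (\<xi> i) - exp (F (t (Suc i)) - F (t i)))) < \<eta>)"
    if "\<eta> > 0" for \<eta>
    using that unfolding strongly_null_def by blast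
  show ?thesis
    unfolding strongly_Kurzweil_product_integrable_def
  proof (intro exI[of _ "\<lambda>t. exp (F t)"] conjI allI impI ballI)
    show "invertible_elem (exp (F t))" for t using inv unfolding invertible_elem_def by blast
    show "bounded ((\<lambda>t. exp (F t)) ` {a..b})" using bnd unfolding bounded_iff by blast
    show "bounded ((\<lambda>t. inv_elem (exp (F t))) ` {a..b})"
      using bnd unfolding bounded_iff inv_elem_eq[OF inv] by blast
    fix \<eta> :: real assume "\<eta> > 0"
    have eq: "(\<Sum>i<m. norm (1 + (t (Suc i) - t i) *\<^sub>R A (\<xi> i) - exp (F (t (Suc i))) * inv_elem (exp (F (t i)))))
      = (\<Sum>i<m. norm (1 + (t (Suc i) - t i) *\<^sub>R A (\<xi> i) - exp (F (t (Suc i)) - F (t i))))"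
      if tp: "tagged_partition a b m \<xi> t" for m \<xi> t
    proof (rule sum.cong)
      fix i assume "i \<in> {..<m}"
      then have "t i \<in> {a..b}" "t (Suc i) \<in> {a..b}"
        using tagged_partition_bounds[OF tp, of i] by auto
      then show "norm (1 + (t (Suc i) - t i) *\<^sub>R A (\<xi> i) - exp (F (t (Suc i))) * inv_elem (exp (F (t i))))
        = norm (1 + (t (Suc i) - t i) *\<^sub>R A (\<xi> i) - exp (F (t (Suc i)) - F (t i)))" by (simp add: W)
    qed simp
    show "\<exists>\<delta>. pos_gauge a b \<delta> \<and> (\<forall>m \<xi> t. tagged_partition a b m \<xi> t \<and> delta_fine \<delta> m \<xi> t \<longrightarrow>
      (\<Sum>i<m. norm (1 + (t (Suc i) - t i) *\<^sub>R A (\<xi> i)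
        - exp (F (t (Suc i))) * inv_elem (exp (F (t i))))) < \<eta>)"
      using null[OF \<open>\<eta> > 0\<close>] by (elim ex_forward conj_forward all_forward) (auto simp: eq)
  qed
qed

section \<open>The logarithm near the unit\<close>

lemma norm_power_le_half:
  fixes X :: "'a::real_normed_algebra_1"
  assumes "norm X \<le> 1/2"
  shows "norm (X ^ n) \<le> (1/2) ^ n"
  using norm_power_ineq[of X n] power_mono[OF assms norm_ge_zero, of n] by linarith

text \<open>If R is the remainder for exponent n + 1, then by commutativity the one for n + 2 is Y R
  + (n + 1) X^n (Y - X)^2. The factor n (n + 1) / 2^n solves exactly the recursion that results from
  norm X, norm Y \<le> 1/2.\<close>

lemma norm_power_Suc_remainder_le:
  fixes X Y :: "'a::real_normed_algebra_1"
  assumes comm: "X * Y = Y * X" and X: "norm X \<le> 1/2" and Y: "norm Y \<le> 1/2"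
  shows "norm (Y ^ Suc n - X ^ Suc n - real (Suc n) *\<^sub>R (X ^ n * (Y - X)))
    \<le> real n * real (Suc n) * (1/2) ^ n * (norm (Y - X))\<^sup>2"
proof (induction n)
  case (Suc n)
  define D where "D = Y ^ Suc n - X ^ Suc n - real (Suc n) *\<^sub>R (X ^ n * (Y - X))"
  have XnY: "X ^ k * Y = Y * X ^ k" for k by (rule power_commuting_commutes[OF comm])
  have "Y ^ Suc (Suc n) - X ^ Suc (Suc n) - real (Suc (Suc n)) *\<^sub>R (X ^ Suc n * (Y - X))
    = Y * D + real (Suc n) *\<^sub>R (X ^ n * (Y - X) * (Y - X))"
  proof -
    have 1: "Y * (X ^ n * Z) = X ^ n * (Y * Z)" for Z using XnY[of n] by (metis mult.assoc)
    have 2: "X ^ Suc n * Z = X ^ n * (X * Z)" for Z by (simp add: power_Suc2 mult.assoc del: power_Suc)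
    have 3: "Y * X ^ Suc n = X ^ n * (X * Y)" using XnY[of "Suc n"] by (simp add: power_Suc2 mult.assoc del: power_Suc)
    have 4: "X ^ Suc (Suc n) = X ^ n * (X * X)" by (simp add: power_Suc2 mult.assoc del: power_Suc)
    have "Y * D = Y ^ Suc (Suc n) - X ^ n * (X * Y) - real (Suc n) *\<^sub>R (X ^ n * (Y * (Y - X)))"
      unfolding D_def right_diff_distrib mult_scaleR_right 1 3 by simp
    moreover have "X ^ n * (Y - X) * (Y - X) = X ^ n * (Y * (Y - X)) - X ^ n * (X * (Y - X))"
      by (simp add: mult.assoc left_diff_distrib right_diff_distrib)
    ultimately have "Y * D + real (Suc n) *\<^sub>R (X ^ n * (Y - X) * (Y - X))
      = Y ^ Suc (Suc n) - X ^ n * (X * Y) - real (Suc n) *\<^sub>R (X ^ n * (X * (Y - X)))"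
      by (simp add: scaleR_diff_right del: power_Suc of_nat_Suc)
    also have "\<dots> = Y ^ Suc (Suc n) - X ^ n * (X * X) - X ^ n * (X * (Y - X)) - real (Suc n) *\<^sub>R (X ^ n * (X * (Y - X)))"
      by (simp add: right_diff_distrib del: power_Suc of_nat_Suc)
    also have "\<dots> = Y ^ Suc (Suc n) - X ^ Suc (Suc n) - real (Suc (Suc n)) *\<^sub>R (X ^ Suc n * (Y - X))"
      unfolding 2 4 of_nat_Suc[of "Suc n"] scaleR_add_left by (simp del: power_Suc of_nat_Suc)
    finally show ?thesis ..
  qed
  also have "norm \<dots> \<le> norm Y * norm D + real (Suc n) * (norm (X ^ n) * norm (Y - X) * norm (Y - X))"
    by (intro order_trans[OF norm_triangle_ineq] add_mono norm_mult_ineq)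
       (simp add: mult_left_mono order_trans[OF norm_mult_ineq] mult_right_mono norm_mult_ineq del: of_nat_Suc)
  also have "\<dots> \<le> 1/2 * (real n * real (Suc n) * (1/2) ^ n * (norm (Y - X))\<^sup>2)
      + real (Suc n) * ((1/2) ^ n * norm (Y - X) * norm (Y - X))"
  proof (intro add_mono mult_mono mult_left_mono mult_right_mono)
    show "norm (X ^ n) \<le> (1/2) ^ n" by (rule norm_power_le_half[OF X])
  qed (use Suc.IH Y in \<open>simp_all add: D_def del: power_Suc of_nat_Suc\<close>)
  also have "\<dots> = real (Suc n) * real (Suc (Suc n)) * (1/2) ^ Suc n * (norm (Y - X))\<^sup>2"
    by (simp add: power2_eq_square algebra_simps)
  finally show ?case .
qed simp

text \<open>The series for (1 + X)^-1 is the derivative of \<open>log1p\<close> at X; it stands to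
  the left of 1 + X because the chain rule below produces it there.\<close>

lemma neumann_series:
  fixes X :: "'a::{real_normed_algebra_1, banach}"
  assumes X: "norm X \<le> 1/2"
  shows "summable (\<lambda>n. (-1) ^ n *\<^sub>R X ^ n)" "(\<Sum>n. (-1) ^ n *\<^sub>R X ^ n) * (1 + X) = 1"
proof -
  show sm: "summable (\<lambda>n. (-1) ^ n *\<^sub>R X ^ n)"
  proof (rule summable_comparison_test)
    show "\<exists>N. \<forall>n\<ge>N. norm ((-1) ^ n *\<^sub>R X ^ n) \<le> (1/2) ^ n"
      using norm_power_le_half[OF X] by (simp add: power_abs)
  qed (simp add: summable_geometric)
  have part: "(\<Sum>i<n. (-1) ^ i *\<^sub>R X ^ i) * (1 + X) = 1 - (-1) ^ n *\<^sub>R X ^ n" for n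
  proof (induction n)
    case (Suc n)
    have "(\<Sum>i<Suc n. (-1) ^ i *\<^sub>R X ^ i) * (1 + X)
      = (\<Sum>i<n. (-1) ^ i *\<^sub>R X ^ i) * (1 + X) + ((-1) ^ n *\<^sub>R X ^ n) * (1 + X)"
      by (simp only: sum.lessThan_Suc distrib_right)
    also have "\<dots> = 1 - (-1) ^ n *\<^sub>R X ^ n + ((-1) ^ n *\<^sub>R X ^ n + (-1) ^ n *\<^sub>R (X ^ n * X))"
      unfolding Suc by (simp add: distrib_left)
    also have "\<dots> = 1 - (-1) ^ Suc n *\<^sub>R X ^ Suc n" by (simp add: power_commutes)
    finally show ?case .
  qed simp
  have "(\<lambda>n. (\<Sum>i<n. (-1) ^ i *\<^sub>R X ^ i) * (1 + X)) \<longlonglongrightarrow> (\<Sum>n. (-1) ^ n *\<^sub>R X ^ n) * (1 + X)"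
    by (intro tendsto_intros summable_LIMSEQ sm)
  moreover have "(\<lambda>n. 1 - (-1) ^ n *\<^sub>R X ^ n) \<longlonglongrightarrow> 1 - 0"
    by (intro tendsto_intros summable_LIMSEQ_zero sm)
  ultimately show "(\<Sum>n. (-1) ^ n *\<^sub>R X ^ n) * (1 + X) = 1"
    unfolding part by (simp add: LIMSEQ_unique)
qed

text \<open>Mercator's series for log (1 + X); the shift to \<open>Suc n\<close> reflects the
  missing constant term.\<close>

definition log1p :: "'a::{real_normed_algebra_1, banach} \<Rightarrow> 'a"
  where "log1p X = (\<Sum>n. ((-1) ^ n / real (Suc n)) *\<^sub>R X ^ Suc n)"

lemma log1p_sums:
  fixes X :: "'a::{real_normed_algebra_1, banach}"
  assumes X: "norm X \<le> 1/2"
  shows "(\<lambda>n. ((-1) ^ n / real (Suc n)) *\<^sub>R X ^ Suc n) sums log1p X"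
  unfolding log1p_def
proof (rule summable_sums, rule summable_comparison_test)
  show "\<exists>N. \<forall>n\<ge>N. norm (((-1) ^ n / real (Suc n)) *\<^sub>R X ^ Suc n) \<le> (1/2) ^ n"
  proof (intro exI allI impI)
    fix n
    have "norm (((-1) ^ n / real (Suc n)) *\<^sub>R X ^ Suc n) = norm (X ^ Suc n) / real (Suc n)"
      by (simp add: power_abs del: power_Suc)
    also have "\<dots> \<le> norm (X ^ Suc n)" by (simp add: divide_le_eq mult_le_cancel_left1 del: power_Suc)
    also have "\<dots> \<le> (1/2) ^ Suc n" by (rule norm_power_le_half[OF X])
    also have "\<dots> \<le> (1/2) ^ n" by simp
    finally show "norm (((-1) ^ n / real (Suc n)) *\<^sub>R X ^ Suc n) \<le> (1/2) ^ n" .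
  qed
qed (simp add: summable_geometric)

text \<open>Since X and Y commute, each power has a quadratic remainder. Division by n + 1 leaves
  the factor n / 2^n, which is at most (n + 1) / 2^n, and these sum to 1 / (1 - 1/2)^2 = 4.\<close>

lemma log1p_expansion:
  fixes X Y :: "'a::{real_normed_algebra_1, banach}"
  assumes comm: "X * Y = Y * X" and X: "norm X \<le> 1/2" and Y: "norm Y \<le> 1/2"
  shows "norm (log1p Y - log1p X - (\<Sum>n. (-1) ^ n *\<^sub>R X ^ n) * (Y - X)) \<le> 4 * (norm (Y - X))\<^sup>2"
proof (rule norm_sums_le)
  show "(\<lambda>n. ((-1) ^ n / real (Suc n)) *\<^sub>R Y ^ Suc n - ((-1) ^ n / real (Suc n)) *\<^sub>R X ^ Suc n
      - (-1) ^ n *\<^sub>R X ^ n * (Y - X)) sums (log1p Y - log1p X - (\<Sum>n. (-1) ^ n *\<^sub>R X ^ n) * (Y - X))"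
    by (intro sums_diff log1p_sums X Y sums_mult2 summable_sums neumann_series)
  have "(\<lambda>n. of_nat (Suc n) * (1/2) ^ n :: real) sums (1 / (1 - 1/2)\<^sup>2)"
    by (rule geometric_deriv_sums) simp
  then have "(\<lambda>n. real (Suc n) * (1/2) ^ n) sums 4" by (simp add: power2_eq_square)
  then show "(\<lambda>n. real (Suc n) * (1/2) ^ n * (norm (Y - X))\<^sup>2) sums (4 * (norm (Y - X))\<^sup>2)"
    by (rule sums_mult2)
  fix n
  define R where "R = Y ^ Suc n - X ^ Suc n - real (Suc n) *\<^sub>R (X ^ n * (Y - X))"
  have "((-1) ^ n / real (Suc n)) *\<^sub>R Y ^ Suc n - ((-1) ^ n / real (Suc n)) *\<^sub>R X ^ Suc n
      - (-1) ^ n *\<^sub>R X ^ n * (Y - X) = ((-1) ^ n / real (Suc n)) *\<^sub>R R"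
    unfolding R_def scaleR_diff_right by (simp del: power_Suc of_nat_Suc)
  also have "norm \<dots> = norm R / real (Suc n)" by (simp add: power_abs)
  also have "\<dots> \<le> (real n * real (Suc n) * (1/2) ^ n * (norm (Y - X))\<^sup>2) / real (Suc n)"
    unfolding R_def by (intro divide_right_mono norm_power_Suc_remainder_le comm X Y) simp
  also have "\<dots> = real n * (1/2) ^ n * (norm (Y - X))\<^sup>2" by (simp del: of_nat_Suc)
  also have "\<dots> \<le> real (Suc n) * (1/2) ^ n * (norm (Y - X))\<^sup>2"
    by (intro mult_right_mono) auto
  finally show "norm (((-1) ^ n / real (Suc n)) *\<^sub>R Y ^ Suc n - ((-1) ^ n / real (Suc n)) *\<^sub>R X ^ Suc n
      - (-1) ^ n *\<^sub>R X ^ n * (Y - X)) \<le> real (Suc n) * (1/2) ^ n * (norm (Y - X))\<^sup>2" .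
qed

text \<open>A chain rule along the path f only: \<open>log1p_expansion\<close> compares commuting
  elements, so it does not expand the logarithm on a whole neighbourhood in the algebra. Divided by
  y - x, the quadratic error is C times the squared difference quotient times y - x.\<close>

lemma has_right_derivative_quadratic:
  fixes f F :: "real \<Rightarrow> 'e::real_normed_algebra"
  assumes f: "(f has_vector_derivative D) (at_right x)" and c: "x < c"
    and bound: "\<And>y. x < y \<Longrightarrow> y < c \<Longrightarrow> norm (F y - F x - G * (f y - f x)) \<le> C * (norm (f y - f x))\<^sup>2"
  shows "(F has_vector_derivative G * D) (at_right x)"
proof -
  define q where "q y = (f y - f x) /\<^sub>R (y - x)" for y
  have q: "(q \<longlongrightarrow> D) (at_right x)"
    using f unfolding has_vector_derivative_at_right_iff q_def .
  have "((\<lambda>y. (F y - F x) /\<^sub>R (y - x) - G * q y) \<longlongrightarrow> 0) (at_right x)"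
  proof (rule Lim_null_comparison)
    show "\<forall>\<^sub>F y in at_right x. norm ((F y - F x) /\<^sub>R (y - x) - G * q y) \<le> C * (norm (q y))\<^sup>2 * (y - x)"
    proof (rule eventually_at_rightI)
      fix y assume y: "y \<in> {x<..<c}"
      have "(F y - F x) /\<^sub>R (y - x) - G * q y = (F y - F x - G * (f y - f x)) /\<^sub>R (y - x)"
        by (simp add: q_def scaleR_diff_right right_diff_distrib)
      also have "norm \<dots> = norm (F y - F x - G * (f y - f x)) / (y - x)"
        using y by (simp add: divide_inverse)
      also have "\<dots> \<le> C * (norm (f y - f x))\<^sup>2 / (y - x)"
        using bound[of y] y by (intro divide_right_mono) auto
      also have "norm (f y - f x) = norm (q y) * (y - x)" using y by (simp add: q_def)
      also have "C * (norm (q y) * (y - x))\<^sup>2 / (y - x) = C * (norm (q y))\<^sup>2 * (y - x)"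
        using y by (simp add: power2_eq_square)
      finally show "norm ((F y - F x) /\<^sub>R (y - x) - G * q y) \<le> C * (norm (q y))\<^sup>2 * (y - x)" .
    qed (rule c)
    have "((\<lambda>y. C * (norm (q y))\<^sup>2 * (y - x)) \<longlongrightarrow> C * (norm D)\<^sup>2 * (x - x)) (at_right x)"
      by (intro tendsto_intros q)
    then show "((\<lambda>y. C * (norm (q y))\<^sup>2 * (y - x)) \<longlongrightarrow> 0) (at_right x)" by simp
  qed
  then have "((\<lambda>y. ((F y - F x) /\<^sub>R (y - x) - G * q y) + G * q y) \<longlongrightarrow> 0 + G * D) (at_right x)"
    by (intro tendsto_intros q)
  then show ?thesis unfolding has_vector_derivative_at_right_iff by simp
qed

text \<open>By the chain rule the logarithm of U Z has right derivative (U Z)^-1 (f U Z), and moving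
  f to the right leaves f. The constant factor Z brings the path near 1 and respects the equation U'
  = f U.\<close>

lemma log_primitive:
  fixes f U :: "real \<Rightarrow> 'e::{real_normed_algebra_1, banach}"
  assumes U: "primitive s t (\<lambda>x. f x * U x) U"
    and near: "\<And>x. x \<in> {s..t} \<Longrightarrow> norm (U x * Z - 1) \<le> 1/2"
    and UU: "\<And>x y. x \<in> {s..t} \<Longrightarrow> y \<in> {s..t} \<Longrightarrow> (U x * Z) * (U y * Z) = (U y * Z) * (U x * Z)"
    and fU: "\<And>x. x \<in> {s..<t} \<Longrightarrow> f x * (U x * Z) = (U x * Z) * f x"
  shows "\<exists>F. primitive s t f F"
proof
  define X where "X x = U x * Z - 1" for x
  have contX: "continuous_on {s..t} X"
    using U unfolding X_def primitive_def by (auto intro!: continuous_intros)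
  have XX: "X x * X y = X y * X x" if "x \<in> {s..t}" "y \<in> {s..t}" for x y
    using UU[OF that] by (simp add: X_def algebra_simps)
  define G where "G x = (\<Sum>n. (-1) ^ n *\<^sub>R X x ^ n)" for x
  have exp: "norm (log1p (X y) - log1p (X x) - G x * (X y - X x)) \<le> 4 * (norm (X y - X x))\<^sup>2"
    if "x \<in> {s..t}" "y \<in> {s..t}" for x y
    unfolding G_def by (rule log1p_expansion) (use XX that near in \<open>auto simp: X_def\<close>)
  show "primitive s t f (\<lambda>x. log1p (X x))"
    unfolding primitive_def
  proof (intro conjI ballI)
    show "continuous_on {s..t} (\<lambda>x. log1p (X x))"
      unfolding continuous_on_def
    proof
      fix x assume x: "x \<in> {s..t}"
      have Xlim: "(X \<longlongrightarrow> X x) (at x within {s..t})" using contX x by (simp add: continuous_on_def)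
      have "((\<lambda>y. log1p (X y) - log1p (X x) - G x * (X y - X x)) \<longlongrightarrow> 0) (at x within {s..t})"
      proof (rule Lim_null_comparison)
        show "\<forall>\<^sub>F y in at x within {s..t}. norm (log1p (X y) - log1p (X x) - G x * (X y - X x))
            \<le> 4 * (norm (X y - X x))\<^sup>2"
          unfolding eventually_at_filter using exp[OF x] by (intro always_eventually) blast
        have "((\<lambda>y. 4 * (norm (X y - X x))\<^sup>2) \<longlongrightarrow> 4 * (norm (X x - X x))\<^sup>2) (at x within {s..t})"
          by (intro tendsto_intros Xlim)
        then show "((\<lambda>y. 4 * (norm (X y - X x))\<^sup>2) \<longlongrightarrow> 0) (at x within {s..t})" by simp
      qed
      then have "((\<lambda>y. (log1p (X y) - log1p (X x) - G x * (X y - X x)) + G x * (X y - X x) + log1p (X x))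
          \<longlongrightarrow> 0 + G x * (X x - X x) + log1p (X x)) (at x within {s..t})"
        by (intro tendsto_intros Xlim)
      then show "((\<lambda>y. log1p (X y)) \<longlongrightarrow> log1p (X x)) (at x within {s..t})" by simp
    qed
    fix x assume x: "x \<in> {s..<t}"
    have "(U has_vector_derivative f x * U x) (at_right x)" using U x by (simp add: primitive_def)
    then have "(X has_vector_derivative f x * U x * Z - 0) (at_right x)"
      unfolding X_def by (intro derivative_intros)
    then have "((\<lambda>x. log1p (X x)) has_vector_derivative G x * (f x * U x * Z - 0)) (at_right x)"
      by (rule has_right_derivative_quadratic[where c = t and C = 4]) (use x exp in auto)
    also have "G x * (f x * U x * Z - 0) = G x * (1 + X x) * f x"
      using fU[OF x] by (simp add: X_def mult.assoc)
    also have "\<dots> = f x"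
      using neumann_series(2)[of "X x"] near[of x] x by (simp add: G_def X_def)
    finally show "((\<lambda>x. log1p (X x)) has_vector_derivative f x) (at_right x)" .
  qed
qed

section \<open>From the product integral to a primitive\<close>

text \<open>The identity V(y) - V(x) = - V(y) (W(y) - W(x)) V(x) gives the difference quotient, and
  right continuity of V its limit.\<close>

lemma right_derivative_inverse:
  fixes W V :: "real \<Rightarrow> 'e::real_normed_algebra_1"
  assumes W: "(W has_vector_derivative D) (at_right x)" and V: "(V \<longlongrightarrow> V x) (at_right x)"
    and c: "x < c"
    and inv: "\<And>y. x \<le> y \<Longrightarrow> y < c \<Longrightarrow> V y * W y = 1" "W x * V x = 1"
  shows "(V has_vector_derivative - (V x * D * V x)) (at_right x)"
proof -
  have "((\<lambda>y. - (V y * ((W y - W x) /\<^sub>R (y - x)) * V x)) \<longlongrightarrow> - (V x * D * V x)) (at_right x)"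
    using W unfolding has_vector_derivative_at_right_iff by (intro tendsto_intros V)
  moreover have "\<forall>\<^sub>F y in at_right x.
    - (V y * ((W y - W x) /\<^sub>R (y - x)) * V x) = (V y - V x) /\<^sub>R (y - x)"
  proof (rule eventually_at_rightI)
    fix y assume y: "y \<in> {x<..<c}"
    have "V y * (W y - W x) * V x = V y * W y * V x - V y * (W x * V x)"
      by (simp add: algebra_simps)
    also have "\<dots> = V x - V y" using inv(1)[of y] inv(2) y by simp
    finally show "- (V y * ((W y - W x) /\<^sub>R (y - x)) * V x) = (V y - V x) /\<^sub>R (y - x)"
      by (metis (no_types, opaque_lifting) minus_diff_eq mult_scaleR_left mult_scaleR_right scaleR_minus_right)
  qed (rule c)
  ultimately show ?thesis
    unfolding has_vector_derivative_at_right_iff by (simp only: tendsto_cong)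
qed

text \<open>W solves W' = A(x+) W in the sense of right derivatives. Near x the error of the slope
  splits into (A(\<xi>) - l) W(u), small by the right limit and the bound on W, and l (W(u) - W(x)),
  small by continuity of W, which is therefore shown first.\<close>

lemma product_integrable_primitive:
  fixes A :: "real \<Rightarrow> 'e::{real_normed_algebra_1, banach}"
  assumes rr: "right_regulated a b A" and W: "\<And>t. t \<in> {a..b} \<Longrightarrow> norm (W t) \<le> K"
    and null: "strongly_null a b (\<lambda>\<xi> s t. (t - s) *\<^sub>R (A \<xi> * W s) - (W t - W s))"
    and K: "K > 0"
  shows "primitive a b (\<lambda>x. Lim (at_right x) A * W x) W"
proof -
  have cont: "continuous_on {a..b} W"
  proof (rule strongly_null_continuous[OF null])
    fix \<xi> \<eta> :: real assume "\<xi> \<in> {a..b}" "\<eta> > 0"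
    define M where "M = norm (A \<xi>) * K + 1"
    have M: "M > 0" using K by (simp add: M_def add_nonneg_pos)
    show "\<exists>d>0. \<forall>s t. a \<le> s \<and> s \<le> \<xi> \<and> \<xi> \<le> t \<and> t \<le> b \<and> t - s < d \<longrightarrow>
      norm ((t - s) *\<^sub>R (A \<xi> * W s)) \<le> \<eta>"
    proof (intro exI[of _ "\<eta> / M"] conjI allI impI)
      fix s t assume st: "a \<le> s \<and> s \<le> \<xi> \<and> \<xi> \<le> t \<and> t \<le> b \<and> t - s < \<eta> / M"
      have "norm (A \<xi> * W s) \<le> norm (A \<xi>) * norm (W s)" by (rule norm_mult_ineq)
      also have "\<dots> \<le> norm (A \<xi>) * K" using W[of s] st by (intro mult_left_mono) auto
      also have "\<dots> \<le> M" by (simp add: M_def)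
      finally have "norm ((t - s) *\<^sub>R (A \<xi> * W s)) \<le> (t - s) * M"
        using st by (simp add: mult_left_mono)
      also have "\<dots> \<le> \<eta>"
      proof -
        have "t - s < \<eta> / M" using st by blast
        then show ?thesis using M by (simp add: pos_less_divide_eq)
      qed
      finally show "norm ((t - s) *\<^sub>R (A \<xi> * W s)) \<le> \<eta>" .
    qed (use M \<open>\<eta> > 0\<close> in simp)
  qed
  show ?thesis
  proof (rule strongly_null_primitive[OF null cont])
    fix x e :: real assume x: "x \<in> {a..<b}" and e: "e > 0"
    define l where "l = Lim (at_right x) A"
    have "((\<lambda>y. norm (A y - l) * K) \<longlongrightarrow> norm (l - l) * K) (at_right x)"
      unfolding l_def by (intro tendsto_intros right_regulated_tendsto[OF rr x])
    then have "\<forall>\<^sub>F y in at_right x. norm (A y - l) * K < e / 2"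
      using e by (intro order_tendstoD(2)) auto
    then obtain c1 where c1: "c1 > x" "\<And>y. x < y \<Longrightarrow> y < c1 \<Longrightarrow> norm (A y - l) * K < e / 2"
      unfolding eventually_at_right_field by auto
    have "((\<lambda>y. norm l * norm (W y - W x)) \<longlongrightarrow> norm l * norm (W x - W x)) (at_right x)"
      by (intro tendsto_intros tendsto_at_right_if_continuous_on[OF cont x])
    then have "\<forall>\<^sub>F y in at_right x. norm l * norm (W y - W x) < e / 2"
      using e by (intro order_tendstoD(2)) auto
    then obtain c2 where c2: "c2 > x" "\<And>y. x < y \<Longrightarrow> y < c2 \<Longrightarrow> norm l * norm (W y - W x) < e / 2"
      unfolding eventually_at_right_field by auto
    show "\<exists>h>0. \<forall>\<xi> u v. x < u \<and> u \<le> \<xi> \<and> \<xi> \<le> v \<and> v < x + h \<and> v \<le> b \<longrightarrow>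
      norm ((v - u) *\<^sub>R (A \<xi> * W u) - (v - u) *\<^sub>R (Lim (at_right x) A * W x)) \<le> e * (v - u)"
    proof (intro exI[of _ "min c1 c2 - x"] conjI allI impI)
      fix \<xi> u v assume H: "x < u \<and> u \<le> \<xi> \<and> \<xi> \<le> v \<and> v < x + (min c1 c2 - x) \<and> v \<le> b"
      have "norm (A \<xi> * W u - l * W x) = norm ((A \<xi> - l) * W u + l * (W u - W x))"
        by (simp add: algebra_simps)
      also have "\<dots> \<le> norm (A \<xi> - l) * norm (W u) + norm l * norm (W u - W x)"
        by (intro order_trans[OF norm_triangle_ineq] add_mono norm_mult_ineq)
      also have "\<dots> \<le> norm (A \<xi> - l) * K + norm l * norm (W u - W x)"
        using W[of u] H x by (intro add_right_mono mult_left_mono) auto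
      also have "\<dots> \<le> e" using c1(2)[of \<xi>] c2(2)[of u] H by simp
      finally have "(v - u) * norm (A \<xi> * W u - l * W x) \<le> (v - u) * e"
        using H by (intro mult_left_mono) auto
      then show "norm ((v - u) *\<^sub>R (A \<xi> * W u) - (v - u) *\<^sub>R (Lim (at_right x) A * W x)) \<le> e * (v - u)"
        using H by (simp add: l_def mult.commute flip: scaleR_diff_right)
    qed (use c1 c2 in simp)
  qed
qed

lemma right_primitive_if_product_integrable:
  fixes A :: "real \<Rightarrow> 'e::{real_normed_algebra_1, banach}"
  assumes ab: "a < b" and rr: "right_regulated a b A"
    and comm: "\<And>s t. s \<in> {a..b} \<Longrightarrow> t \<in> {a..b} \<Longrightarrow> A s * A t = A t * A s"
    and int: "strongly_Kurzweil_product_integrable a b A"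
  shows "\<exists>F. right_primitive a b A F"
proof -
  obtain W where inv: "\<And>t. t \<in> {a..b} \<Longrightarrow> invertible_elem (W t)"
    and bW: "bounded (W ` {a..b})" and bV: "bounded ((\<lambda>t. inv_elem (W t)) ` {a..b})"
    and null0: "strongly_null a b (\<lambda>\<xi> s t. 1 + (t - s) *\<^sub>R A \<xi> - W t * inv_elem (W s))"
    using int unfolding strongly_Kurzweil_product_integrable_def strongly_null_def by blast
  define V where "V t = inv_elem (W t)" for t
  define l where "l x = Lim (at_right x) A" for x
  have WV: "W t * V t = 1" "V t * W t = 1" if t: "t \<in> {a..b}" for t
  proof -
    obtain y where "is_inverse (W t) y" using inv[OF t] unfolding invertible_elem_def by blast
    moreover from this have "V t = y" unfolding V_def by (rule inv_elem_eq)
    ultimately show "W t * V t = 1" "V t * W t = 1" by (auto simp: is_inverse_def)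
  qed
  obtain K1 where K1: "\<And>t. t \<in> {a..b} \<Longrightarrow> norm (W t) \<le> K1" using bW unfolding bounded_iff by blast
  obtain K2 where K2: "\<And>t. t \<in> {a..b} \<Longrightarrow> norm (V t) \<le> K2"
    using bV unfolding bounded_iff V_def by blast
  define K where "K = \<bar>K1\<bar> + \<bar>K2\<bar> + 1"
  have K: "K > 0" by (simp add: K_def)
  have nW: "norm (W t) \<le> K" and nV: "norm (V t) \<le> K" if "t \<in> {a..b}" for t
    using K1[OF that] K2[OF that] by (auto simp: K_def)
  \<comment> \<open>Multiplication by W(s) from the right makes the error additive in W, so that
    increments telescope; the bound on W costs the factor \<open>K\<close>.\<close>
  have null: "strongly_null a b (\<lambda>\<xi> s t. (t - s) *\<^sub>R (A \<xi> * W s) - (W t - W s))"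
    unfolding strongly_null_def
  proof (intro allI impI)
    fix \<eta> :: real assume "\<eta> > 0"
    then have "\<eta> / K > 0" using K by simp
    then obtain \<delta> where \<delta>: "pos_gauge a b \<delta>"
      and sum: "\<And>m \<xi> t. tagged_partition a b m \<xi> t \<Longrightarrow> delta_fine \<delta> m \<xi> t \<Longrightarrow>
        (\<Sum>i<m. norm (1 + (t (Suc i) - t i) *\<^sub>R A (\<xi> i) - W (t (Suc i)) * inv_elem (W (t i)))) < \<eta> / K"
      using null0 unfolding strongly_null_def by meson
    show "\<exists>\<delta>. pos_gauge a b \<delta> \<and> (\<forall>m \<xi> t. tagged_partition a b m \<xi> t \<and> delta_fine \<delta> m \<xi> t \<longrightarrow>
      (\<Sum>i<m. norm ((t (Suc i) - t i) *\<^sub>R (A (\<xi> i) * W (t i)) - (W (t (Suc i)) - W (t i)))) < \<eta>)"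
    proof (intro exI[of _ \<delta>] conjI allI impI \<delta>)
      fix m \<xi> t assume tp: "tagged_partition a b m \<xi> t \<and> delta_fine \<delta> m \<xi> t"
      have "(\<Sum>i<m. norm ((t (Suc i) - t i) *\<^sub>R (A (\<xi> i) * W (t i)) - (W (t (Suc i)) - W (t i))))
        \<le> (\<Sum>i<m. norm (1 + (t (Suc i) - t i) *\<^sub>R A (\<xi> i) - W (t (Suc i)) * V (t i)) * K)"
      proof (rule sum_mono)
        fix i assume "i \<in> {..<m}"
        then have ti: "t i \<in> {a..b}" using tagged_partition_bounds[of a b m \<xi> t i] tp by auto
        have "(t (Suc i) - t i) *\<^sub>R (A (\<xi> i) * W (t i)) - (W (t (Suc i)) - W (t i))
          = W (t i) + (t (Suc i) - t i) *\<^sub>R (A (\<xi> i) * W (t i)) - W (t (Suc i)) * (V (t i) * W (t i))"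
          using WV[OF ti] by simp
        also have "\<dots> = (1 + (t (Suc i) - t i) *\<^sub>R A (\<xi> i) - W (t (Suc i)) * V (t i)) * W (t i)"
          by (simp add: distrib_right left_diff_distrib mult.assoc)
        also have "norm \<dots> \<le> norm (1 + (t (Suc i) - t i) *\<^sub>R A (\<xi> i) - W (t (Suc i)) * V (t i)) * norm (W (t i))"
          by (rule norm_mult_ineq)
        also have "\<dots> \<le> norm (1 + (t (Suc i) - t i) *\<^sub>R A (\<xi> i) - W (t (Suc i)) * V (t i)) * K"
          using nW[OF ti] by (intro mult_left_mono) auto
        finally show "norm ((t (Suc i) - t i) *\<^sub>R (A (\<xi> i) * W (t i)) - (W (t (Suc i)) - W (t i)))
          \<le> norm (1 + (t (Suc i) - t i) *\<^sub>R A (\<xi> i) - W (t (Suc i)) * V (t i)) * K" .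
      qed
      also have "\<dots> = (\<Sum>i<m. norm (1 + (t (Suc i) - t i) *\<^sub>R A (\<xi> i) - W (t (Suc i)) * V (t i))) * K"
        by (simp add: sum_distrib_right)
      also have "\<dots> < \<eta>"
        using sum[of m \<xi> t] tp K by (simp add: V_def pos_less_divide_eq)
      finally show "(\<Sum>i<m. norm ((t (Suc i) - t i) *\<^sub>R (A (\<xi> i) * W (t i)) - (W (t (Suc i)) - W (t i)))) < \<eta>" .
    qed
  qed
  have W: "primitive a b (\<lambda>x. l x * W x) W"
    unfolding l_def by (rule product_integrable_primitive[OF rr nW null K])
  then have contW: "continuous_on {a..b} W" by (simp add: primitive_def)
  \<comment> \<open>Continuity passes to the inverse by V(y) - V(x) = V(y) (W(x) - W(y)) V(x) and
    the bound on V.\<close>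
  have contV: "continuous_on {a..b} V"
    unfolding continuous_on_def
  proof
    fix x assume x: "x \<in> {a..b}"
    have "((\<lambda>y. V y - V x) \<longlongrightarrow> 0) (at x within {a..b})"
    proof (rule Lim_null_comparison)
      have "norm (V y - V x) \<le> K * norm (W x - W y) * K" if y: "y \<in> {a..b}" for y
      proof -
        have "V y - V x = V y * (W x * V x) - (V y * W y) * V x" using WV[OF x] WV[OF y] by simp
        also have "\<dots> = V y * (W x - W y) * V x" by (simp add: algebra_simps)
        also have "norm \<dots> \<le> norm (V y) * norm (W x - W y) * norm (V x)"
          by (meson norm_mult_ineq order_trans mult_right_mono norm_ge_zero)
        also have "\<dots> \<le> K * norm (W x - W y) * K"
          using nV[OF x] nV[OF y] K by (intro mult_mono) auto
        finally show ?thesis .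
      qed
      then show "\<forall>\<^sub>F y in at x within {a..b}. norm (V y - V x) \<le> K * norm (W x - W y) * K"
        unfolding eventually_at_filter by (intro always_eventually) blast
      have "((\<lambda>y. K * norm (W x - W y) * K) \<longlongrightarrow> K * norm (W x - W x) * K) (at x within {a..b})"
        using contW x by (intro tendsto_intros) (auto simp: continuous_on_def)
      then show "((\<lambda>y. K * norm (W x - W y) * K) \<longlongrightarrow> 0) (at x within {a..b})" by simp
    qed
    then show "(V \<longlongrightarrow> V x) (at x within {a..b})" by (simp add: LIM_zero_iff)
  qed
  have dW: "(W has_vector_derivative l x * W x) (at_right x)" if "x \<in> {a..<b}" for x
    using W that by (simp add: primitive_def)
  have dV: "(V has_vector_derivative - (V x * l x)) (at_right x)" if x: "x \<in> {a..<b}" for x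
  proof -
    have "(V has_vector_derivative - (V x * (l x * W x) * V x)) (at_right x)"
      by (rule right_derivative_inverse[OF dW[OF x] tendsto_at_right_if_continuous_on[OF contV x], of b])
         (use x WV in auto)
    then show ?thesis using WV(1)[of x] x by (simp add: mult.assoc)
  qed
  \<comment> \<open>This replaces Gronwall's inequality, which is not available as \<open>A\<close> may be unbounded.\<close>
  have conj: "V t * c * W t = V a * c * W a"
    if c: "\<And>t. t \<in> {a..b} \<Longrightarrow> c * A t = A t * c" and t: "t \<in> {a..b}" for c t
  proof -
    have "primitive a b (\<lambda>x. 0) (\<lambda>x. V x * c * W x)"
      unfolding primitive_def
    proof (intro conjI ballI)
      show "continuous_on {a..b} (\<lambda>x. V x * c * W x)" by (intro continuous_intros contV contW)
      fix x assume x: "x \<in> {a..<b}"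
      have "((\<lambda>x. V x * c * W x) has_vector_derivative
          V x * c * (l x * W x) + - (V x * l x) * c * W x) (at_right x)"
        by (intro derivative_intros dV[OF x] dW[OF x])
      moreover have "V x * c * (l x * W x) + - (V x * l x) * c * W x = V x * (c * l x - l x * c) * W x"
        by (simp add: algebra_simps)
      ultimately show "((\<lambda>x. V x * c * W x) has_vector_derivative 0) (at_right x)"
        using right_limit_commute[OF rr x c] by (simp add: l_def)
    qed
    from primitive_zero_const[OF this t] show ?thesis .
  qed
  \<comment> \<open>\<open>conj\<close> moves c past W only up to the constant W(a). Normalising W
    to be 1 at a absorbs this constant; W itself need not commute with \<open>A\<close>.\<close>
  define U where "U t = W t * V a" for t
  have aab: "a \<in> {a..b}" using ab by simp
  have cU: "c * U t = U t * c" if c: "\<And>t. t \<in> {a..b} \<Longrightarrow> c * A t = A t * c" and t: "t \<in> {a..b}" for c t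
  proof -
    have "c * W t = W t * (V t * c * W t)" using WV(1)[OF t] by (simp add: mult.assoc[symmetric])
    also have "\<dots> = W t * (V a * c * W a)" by (simp only: conj[OF c t])
    finally have "c * W t * V a = W t * V a * c * (W a * V a)" by (simp add: mult.assoc)
    then show ?thesis using WV(1)[OF aab] by (simp add: U_def mult.assoc)
  qed
  have AU: "A s * U t = U t * A s" if "s \<in> {a..b}" "t \<in> {a..b}" for s t
    by (rule cU[OF comm[OF that(1)] that(2)])
  \<comment> \<open>Second use of \<open>cU\<close>: each value of U commutes with \<open>A\<close>
    by \<open>AU\<close> and may itself serve as c.\<close>
  have UU: "U s * U t = U t * U s" if "s \<in> {a..b}" "t \<in> {a..b}" for s t
    by (rule cU[OF AU[OF _ that(1), symmetric] that(2)])
  have lU: "l x * U t = U t * l x" if "x \<in> {a..<b}" "t \<in> {a..b}" for x t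
    unfolding l_def using right_limit_commute[OF rr that(1) AU[OF _ that(2), symmetric]] by simp
  \<comment> \<open>The inverse of \<open>U t\<close>. It inherits the commutation relations of
    \<open>U t\<close>, and \<open>K * K\<close> bounds it.\<close>
  define Z where "Z t = W a * V t" for t
  have UZ: "U t * Z t = 1" "Z t * U t = 1" if "t \<in> {a..b}" for t
  proof -
    have "U t * Z t = W t * (V a * W a) * V t" by (simp add: U_def Z_def mult.assoc)
    then show "U t * Z t = 1" using WV[OF aab] WV[OF that] by simp
    have "Z t * U t = W a * (V t * W t) * V a" by (simp add: U_def Z_def mult.assoc)
    then show "Z t * U t = 1" using WV[OF aab] WV[OF that] by simp
  qed
  have cZ: "c * Z t = Z t * c" if c: "c * U t = U t * c" and t: "t \<in> {a..b}" for c t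
  proof -
    have "c * Z t = Z t * (U t * c) * Z t" using UZ(2)[OF t] by (simp add: mult.assoc[symmetric])
    also have "\<dots> = Z t * (c * U t) * Z t" using c by simp
    also have "\<dots> = Z t * c" using UZ(1)[OF t] by (simp add: mult.assoc)
    finally show ?thesis .
  qed
  have nZ: "norm (Z t) \<le> K * K" if "t \<in> {a..b}" for t
    unfolding Z_def using nW[OF aab] nV[OF that] K
    by (intro order_trans[OF norm_mult_ineq] mult_mono) auto
  have U: "primitive a b (\<lambda>x. l x * U x) U"
    unfolding primitive_def
  proof (intro conjI ballI)
    show "continuous_on {a..b} U" unfolding U_def by (intro continuous_intros contW)
    fix x assume "x \<in> {a..<b}"
    then have "(U has_vector_derivative l x * W x * V a) (at_right x)"
      unfolding U_def by (intro derivative_intros dW)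
    then show "(U has_vector_derivative l x * U x) (at_right x)" by (simp add: U_def mult.assoc)
  qed
  have "uniformly_continuous_on {a..b} U"
    using U by (intro compact_uniformly_continuous) (auto simp: primitive_def)
  \<comment> \<open>As \<open>Z s\<close> has norm at most \<open>K * K\<close>, increments of U
    below this constant keep \<open>U y * Z s\<close> within 1/2 of 1, where the logarithmic series
    applies.\<close>
  moreover have "1 / (2 * (K * K)) > 0" using K by simp
  ultimately obtain d where d: "d > 0"
    "\<And>x y. x \<in> {a..b} \<Longrightarrow> y \<in> {a..b} \<Longrightarrow> dist y x < d \<Longrightarrow> dist (U y) (U x) < 1 / (2 * (K * K))"
    unfolding uniformly_continuous_on_def by metis
  \<comment> \<open>\<open>Bolzano\<close> asks for all short intervals around a point, also those
    that leave [a, b]; the guard settles these.\<close>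
  define P where "P s t \<longleftrightarrow> (a \<le> s \<and> s \<le> t \<and> t \<le> b \<longrightarrow> (\<exists>F. primitive s t l F))" for s t
  have "P a b"
  proof (rule Bolzano)
    show "a \<le> b" using ab by simp
    show "P r t" if "P r s" "P s t" "r \<le> s" "s \<le> t" for r s t
      using that primitive_combine[of r s l _ t] unfolding P_def by (meson order_trans)
    fix x
    have "P s t" if st: "s \<le> x \<and> x \<le> t \<and> t - s < d" for s t
      unfolding P_def
    proof
      assume st': "a \<le> s \<and> s \<le> t \<and> t \<le> b"
      then have s: "s \<in> {a..b}" by simp
      show "\<exists>F. primitive s t l F"
      proof (rule log_primitive)
        show "primitive s t (\<lambda>x. l x * U x) U" using U by (rule primitive_subset) (use st' in auto)
      next
        fix y assume y: "y \<in> {s..t}"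
        then have yab: "y \<in> {a..b}" using st' by auto
        have "dist (U y) (U s) < 1 / (2 * (K * K))"
          using y st by (intro d(2) s yab) (auto simp: dist_real_def)
        then have 1: "norm (U y - U s) \<le> 1 / (2 * (K * K))" by (simp add: dist_norm)
        have "U y * Z s - 1 = (U y - U s) * Z s" using UZ(1)[OF s] by (simp add: left_diff_distrib)
        also have "norm \<dots> \<le> norm (U y - U s) * norm (Z s)" by (rule norm_mult_ineq)
        also have "\<dots> \<le> 1 / (2 * (K * K)) * (K * K)" using 1 nZ[OF s] K by (intro mult_mono) auto
        also have "\<dots> = 1 / 2" using K by simp
        finally show "norm (U y * Z s - 1) \<le> 1/2" .
      next
        fix y z assume "y \<in> {s..t}" "z \<in> {s..t}"
        then have yz: "y \<in> {a..b}" "z \<in> {a..b}" using st' by auto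
        have "U y * Z s = Z s * U y" "U z * Z s = Z s * U z" by (intro cZ UU s yz)+
        then show "(U y * Z s) * (U z * Z s) = (U z * Z s) * (U y * Z s)"
          using UU[OF yz] by (metis mult.assoc)
      next
        fix y assume "y \<in> {s..<t}"
        then have y: "y \<in> {a..<b}" "y \<in> {a..b}" using st' by auto
        have "l y * Z s = Z s * l y" by (intro cZ lU s y)
        then show "l y * (U y * Z s) = (U y * Z s) * l y"
          using lU[OF y] by (metis mult.assoc)
      qed
    qed
    then show "\<exists>d>0. \<forall>s t. s \<le> x \<and> x \<le> t \<and> t - s < d \<longrightarrow> P s t" using d(1) by blast
  qed
  then show ?thesis using ab by (simp add: P_def right_primitive_def l_def[abs_def])
qed

section \<open>The four equivalent properties\<close>

theorem theorem5p3:
  fixes A :: "real \<Rightarrow> 'e::{real_normed_algebra_1, banach}"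
    and a b \<epsilon> :: real
  assumes "a < b"
    and "right_regulated a b A"
    and "\<forall>t1\<in>{a..b}. \<forall>t2\<in>{a..b}. A t1 * A t2 = A t2 * A t1"
    and "\<epsilon> > 0"
  shows "(strongly_Kurzweil_product_integrable a b A \<longleftrightarrow> strongly_HK_integrable a b A) \<and>
    (strongly_HK_integrable a b A \<longleftrightarrow> strongly_HK_integrable a b (A_eps a b A \<epsilon>)) \<and>
    (strongly_HK_integrable a b (A_eps a b A \<epsilon>) \<longleftrightarrow>
      wo_summable (below (Lambda_eps a b A \<epsilon>) b)
        (\<lambda>\<beta>. (Succ (Lambda_eps a b A \<epsilon>) \<beta> - \<beta>) *\<^sub>R Lim (at_right \<beta>) A))"
proof -
  note ab = assms(1) and rr = assms(2) and eps = assms(4)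
  have comm: "A s * A t = A t * A s" if "s \<in> {a..b}" "t \<in> {a..b}" for s t
    using assms(3) that by blast
  have "strongly_Kurzweil_product_integrable a b A \<longleftrightarrow> (\<exists>F. right_primitive a b A F)"
    using product_integrable_if_right_primitive[OF ab rr comm]
      right_primitive_if_product_integrable[OF ab rr comm] by blast
  \<comment> \<open>Each property becomes the existence of a primitive of right limits;
    \<open>A_eps\<close> is itself right regulated, so the characterisation of the strong integral
    applies to it as well.\<close>
  then show ?thesis
    unfolding strongly_HK_integrable_iff_right_primitive[OF ab rr]
      strongly_HK_integrable_iff_right_primitive[OF ab right_regulated_A_eps[OF ab rr eps]]
      right_primitive_A_eps_iff_wo_summable[OF ab rr eps, symmetric]
    using right_primitive_iff_A_eps[OF ab rr eps] by blast
qed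

end
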